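(* Every monomorphism in $\mathsf{ICM}$ (as a category with homomorphisms of implicitly closed meadows as arrows) is regular. Equivalently, for all $\mathbf A\le\mathbf B\in\mathsf{ICM}$ one has $\mathsf d_{\mathsf{ICM}}(\mathbf A,\mathbf B)=A$.
   Context: A field is weakly rooted if it has characteristic $0$, or has prime characteristic $p$ and every element has a $p$-th root. Weak inverse: $a^*=a^{-1}$ if $a\ne0$, $0^*=0$. Weak $p$-root (in a weakly rooted field, $p$ prime): $r_p(a)=\sqrt[p]{a}$ if the characteristic is $p$, and $0$ otherwise. An implicitly closed field is a weakly rooted field (in the ring language $\{+,\cdot,-,0,1\}$) expanded by $(\,)^*$ and all $r_p$; $\mathsf{ICM}$ is the class of algebras in the resulting language isomorphic to subalgebras of direct products of implicitly closed fields. A monomorphism is regular if it is an equalizer of a parallel pair. For a class $\mathsf K$ of similar algebras and $\mathbf A\le\mathbf B\in\mathsf K$, the dominion $\mathsf d_{\mathsf K}(\mathbf A,\mathbf B)$ is the set of $b\in B$ such that $g(b)=h(b)$ for all pairs of homomorphisms $g,h:\mathbf B\to\mathbf C$ with $\mathbf C\in\mathsf K$ and $g{\restriction}_A=h{\restriction}_A$. *)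

theory Defs
  imports "HOL-Computational_Algebra.Primes" "HOL-Library.FuncSet"
begin

text \<open>An algebra is given by a carrier set and its operations.  The weak p-roots are
  bundled as one function indexed by natural numbers; only prime indices are part of
  the language, values at non-prime indices are irrelevant (ignored by homomorphisms,
  subalgebras, isomorphisms).\<close>

record 'a alg =
  carrier :: "'a set"
  add  :: "'a \<Rightarrow> 'a \<Rightarrow> 'a"
  mul  :: "'a \<Rightarrow> 'a \<Rightarrow> 'a"
  neg  :: "'a \<Rightarrow> 'a"
  zero :: 'a
  one  :: 'a
  winv :: "'a \<Rightarrow> 'a"
  wroot :: "nat \<Rightarrow> 'a \<Rightarrow> 'a"

definition is_alg :: "'a alg \<Rightarrow> bool" where
  "is_alg A \<longleftrightarrow>
     zero A \<in> carrier A \<and> one A \<in> carrier A \<and>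
     (\<forall>x\<in>carrier A. \<forall>y\<in>carrier A. add A x y \<in> carrier A \<and> mul A x y \<in> carrier A) \<and>
     (\<forall>x\<in>carrier A. neg A x \<in> carrier A \<and> winv A x \<in> carrier A) \<and>
     (\<forall>p. prime p \<longrightarrow> (\<forall>x\<in>carrier A. wroot A p x \<in> carrier A))"

definition hom :: "'a alg \<Rightarrow> 'b alg \<Rightarrow> ('a \<Rightarrow> 'b) \<Rightarrow> bool" where
  "hom A B f \<longleftrightarrow>
     (\<forall>x\<in>carrier A. f x \<in> carrier B) \<and>
     f (zero A) = zero B \<and> f (one A) = one B \<and>
     (\<forall>x\<in>carrier A. \<forall>y\<in>carrier A.
        f (add A x y) = add B (f x) (f y) \<and> f (mul A x y) = mul B (f x) (f y)) \<and>
     (\<forall>x\<in>carrier A. f (neg A x) = neg B (f x) \<and> f (winv A x) = winv B (f x)) \<and>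
     (\<forall>p. prime p \<longrightarrow> (\<forall>x\<in>carrier A. f (wroot A p x) = wroot B p (f x)))"

definition iso :: "'a alg \<Rightarrow> 'b alg \<Rightarrow> ('a \<Rightarrow> 'b) \<Rightarrow> bool" where
  "iso A B f \<longleftrightarrow> hom A B f \<and> bij_betw f (carrier A) (carrier B)"

definition isomorphic :: "'a alg \<Rightarrow> 'b alg \<Rightarrow> bool" where
  "isomorphic A B \<longleftrightarrow> (\<exists>f. iso A B f)"

definition subalg :: "'a alg \<Rightarrow> 'a alg \<Rightarrow> bool" where
  "subalg A B \<longleftrightarrow>
     carrier A \<subseteq> carrier B \<and> is_alg A \<and>
     zero A = zero B \<and> one A = one B \<and>
     (\<forall>x\<in>carrier A. \<forall>y\<in>carrier A. add A x y = add B x y \<and> mul A x y = mul B x y) \<and>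
     (\<forall>x\<in>carrier A. neg A x = neg B x \<and> winv A x = winv B x) \<and>
     (\<forall>p. prime p \<longrightarrow> (\<forall>x\<in>carrier A. wroot A p x = wroot B p x))"

definition prod_alg :: "'i set \<Rightarrow> ('i \<Rightarrow> 'f alg) \<Rightarrow> ('i \<Rightarrow> 'f) alg" where
  "prod_alg I F =
     \<lparr> carrier = (\<Pi>\<^sub>E i\<in>I. carrier (F i)),
       add = (\<lambda>x y. \<lambda>i\<in>I. add (F i) (x i) (y i)),
       mul = (\<lambda>x y. \<lambda>i\<in>I. mul (F i) (x i) (y i)),
       neg = (\<lambda>x. \<lambda>i\<in>I. neg (F i) (x i)),
       zero = (\<lambda>i\<in>I. zero (F i)),
       one = (\<lambda>i\<in>I. one (F i)),
       winv = (\<lambda>x. \<lambda>i\<in>I. winv (F i) (x i)),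
       wroot = (\<lambda>p x. \<lambda>i\<in>I. wroot (F i) p (x i)) \<rparr>"

definition field_ax :: "'a alg \<Rightarrow> bool" where
  "field_ax R \<longleftrightarrow>
     zero R \<in> carrier R \<and> one R \<in> carrier R \<and>
     (\<forall>x\<in>carrier R. \<forall>y\<in>carrier R. add R x y \<in> carrier R \<and> mul R x y \<in> carrier R) \<and>
     (\<forall>x\<in>carrier R. neg R x \<in> carrier R) \<and>
     (\<forall>x\<in>carrier R. \<forall>y\<in>carrier R. \<forall>z\<in>carrier R.
        add R (add R x y) z = add R x (add R y z) \<and>
        mul R (mul R x y) z = mul R x (mul R y z) \<and>
        mul R x (add R y z) = add R (mul R x y) (mul R x z)) \<and>
     (\<forall>x\<in>carrier R. \<forall>y\<in>carrier R. add R x y = add R y x \<and> mul R x y = mul R y x) \<and>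
     (\<forall>x\<in>carrier R. add R x (zero R) = x \<and> add R x (neg R x) = zero R \<and> mul R x (one R) = x) \<and>
     zero R \<noteq> one R \<and>
     (\<forall>x\<in>carrier R. x \<noteq> zero R \<longrightarrow> (\<exists>y\<in>carrier R. mul R x y = one R))"

definition natmult :: "'a alg \<Rightarrow> nat \<Rightarrow> 'a \<Rightarrow> 'a" where
  "natmult R n x = (add R x ^^ n) (zero R)"

definition apow :: "'a alg \<Rightarrow> 'a \<Rightarrow> nat \<Rightarrow> 'a" where
  "apow R x n = (mul R x ^^ n) (one R)"

definition char_zero_alg :: "'a alg \<Rightarrow> bool" where
  "char_zero_alg R \<longleftrightarrow> (\<forall>n>0. natmult R n (one R) \<noteq> zero R)"

definition char_is :: "'a alg \<Rightarrow> nat \<Rightarrow> bool" where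
  "char_is R p \<longleftrightarrow> prime p \<and> natmult R p (one R) = zero R"

definition weakly_rooted :: "'a alg \<Rightarrow> bool" where
  "weakly_rooted R \<longleftrightarrow> field_ax R \<and>
     (char_zero_alg R \<or>
      (\<exists>p. char_is R p \<and> (\<forall>a\<in>carrier R. \<exists>r\<in>carrier R. apow R r p = a)))"

text \<open>Implicitly closed field: weakly rooted field with weak inverse and weak p-roots
  (in characteristic p the p-th root is unique, so these conditions determine the operations).\<close>
definition implicitly_closed_field :: "'a alg \<Rightarrow> bool" where
  "implicitly_closed_field R \<longleftrightarrow> weakly_rooted R \<and>
     winv R (zero R) = zero R \<and>
     (\<forall>x\<in>carrier R. x \<noteq> zero R \<longrightarrow> winv R x \<in> carrier R \<and> mul R x (winv R x) = one R) \<and>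
     (\<forall>p. prime p \<longrightarrow> (\<forall>a\<in>carrier R. wroot R p a \<in> carrier R \<and>
        (if char_is R p then apow R (wroot R p a) p = a else wroot R p a = zero R)))"

definition ICM :: "'i itself \<Rightarrow> 'f itself \<Rightarrow> 'a alg \<Rightarrow> bool" where
  "ICM _ _ B \<longleftrightarrow>
     (\<exists>(I::'i set) (F::'i \<Rightarrow> 'f alg) S.
        (\<forall>i\<in>I. implicitly_closed_field (F i)) \<and>
        subalg S (prod_alg I F) \<and> isomorphic B S)"

definition dominion :: "('c alg \<Rightarrow> bool) \<Rightarrow> 'a alg \<Rightarrow> 'a alg \<Rightarrow> 'a set" where
  "dominion K A B =
     {b \<in> carrier B. \<forall>(C::'c alg) g h.
        K C \<and> hom B C g \<and> hom B C h \<and> (\<forall>a\<in>carrier A. g a = h a) \<longrightarrow> g b = h b}"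

end

theory Submission
  imports "HOL-Algebra.QuotRing" "HOL-Algebra.Ring_Divisibility" Defs
begin

text \<open>
  An algebra \<open>S\<close> in the class is a commutative von Neumann regular ring whose weak inverses and roots are
  determined by its ring structure, so ring homomorphisms into implicitly closed fields preserve all
  operations.  Let \<open>b\<close> lie outside the subalgebra \<open>A\<close>, let \<open>m\<close> be a prime ideal of \<open>A\<close> containing all
  \<open>e \<in> A\<close> with \<open>e b \<in> A\<close>, and let \<open>N\<close> be the radical ideal of \<open>S\<close> generated by \<open>m\<close>.  No \<open>b - a\<close> with
  \<open>a \<in> A\<close> lies in \<open>N\<close>, and therefore there are primes \<open>n, n'\<close> above \<open>N\<close> such that no \<open>a \<in> A\<close> agrees with
  \<open>b\<close> both in \<open>L = S/n\<close> and in \<open>M = S/n'\<close>.  Both are extension fields of \<open>k = A/m\<close>, and it remains to map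
  them over \<open>k\<close> into one field so that the two images of \<open>b\<close> differ.

  Instead of the tensor product of \<open>L\<close> and \<open>M\<close> over \<open>k\<close> we use the commutative ring of operators on the
  \<open>k\<close>-linear maps \<open>\<phi> : M \<rightarrow> L\<close> generated by \<open>\<phi> \<mapsto> x \<phi>\<close> and \<open>\<phi> \<mapsto> \<phi>(y \<cdot>)\<close>.  The operator
  \<open>t : \<phi> \<mapsto> b \<phi> - \<phi>(b \<cdot>)\<close> is not nilpotent.  In characteristic \<open>p\<close> this follows from the Frobenius
  endomorphism, as \<open>k\<close> is perfect.  In characteristic 0, take \<open>\<psi> = t \<chi> \<noteq> 0\<close> with \<open>t \<psi> = 0\<close>: measuring
  how far \<open>\<chi>\<close> is from being semilinear yields a derivation over \<open>k\<close> that sends \<open>b\<close> to \<open>-1\<close>, so \<open>b\<close> is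
  transcendental over \<open>k\<close>, whereas nilpotency of \<open>t\<close> makes \<open>b\<close> algebraic.  A prime ideal of the operator
  ring avoiding the powers of \<open>t\<close> then gives the field.
\<close>

text \<open>Inseparability is the only obstruction: over an imperfect subfield, two embeddings
  cannot tell apart the images of a purely inseparable element, and the weak p-roots exclude this by
  making \<open>k\<close> perfect. Weak inverses enter twice: they turn residue rings modulo primes
  into fields, and they make \<open>N\<close> radical. One prime above \<open>N\<close> need not
  suffice, because \<open>b\<close> may agree there with some element of \<open>A\<close>; the
  second prime is chosen against that element.

  Equality of operators is tested on linear functionals, which a maximality argument supplies, so
  neither bases nor tensor relations have to be handled.

  A further obstacle is the type of the test algebras. The separating field consists of fractions of
  cosets of operators, whereas \<open>dominion\<close> is to be tested on
  \<open>'b \<times> nat\<close>. The field is therefore cut down to the subalgebra generated by the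
  two images of \<open>S\<close>. Its elements are values of terms, which can be coded in
  \<open>'b \<times> nat\<close>, and it is again an implicitly closed field because inverses and
  roots are operations of the language.\<close>

abbreviation car :: "('a, 'm) partial_object_scheme \<Rightarrow> 'a set" where
  "car \<equiv> partial_object.carrier"

text \<open>An ideal \<open>M\<close> that is maximal among those containing \<open>J\<close> and
  missing all powers of \<open>s\<close> is prime: if \<open>a\<close> and \<open>b\<close> lie
  outside it, some power of \<open>s\<close> lies in \<open>M + (a)\<close> and another in
  \<open>M + (b)\<close>, and their product lies in \<open>M + (ab)\<close>.\<close>

lemma (in cring) exists_primeideal_avoiding_powers:
  assumes J: "ideal J R" and s: "s \<in> car R" and pow: "\<And>n::nat. s [^] n \<notin> J"
  obtains P where "primeideal P R" "J \<subseteq> P" "s \<notin> P"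
proof -
  define \<A> where "\<A> = {I. ideal I R \<and> J \<subseteq> I \<and> (\<forall>n::nat. s [^] n \<notin> I)}"
  have "J \<in> \<A>" using J pow by (auto simp: \<A>_def)
  have "\<exists>M\<in>\<A>. \<forall>X\<in>\<A>. M \<subseteq> X \<longrightarrow> X = M"
  proof (rule subset_Zorn_nonempty)
    fix \<C> assume C: "\<C> \<noteq> {}" "subset.chain \<A> \<C>"
    then have "subset.chain {I. ideal I R} \<C>"
      by (auto simp: pred_on.chain_def \<A>_def)
    \<comment> \<open>The case distinction matches the form of \<open>chain_Union_is_ideal\<close>,
      which allows an empty chain.\<close>
    then have "ideal (if \<C> = {} then {\<zero>} else \<Union>\<C>) R" by (rule chain_Union_is_ideal)
    then have "ideal (\<Union>\<C>) R" using C(1) by simp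
    moreover have "\<C> \<subseteq> \<A>" using C(2) by (auto simp: pred_on.chain_def)
    ultimately show "\<Union>\<C> \<in> \<A>" using C(1) unfolding \<A>_def by blast
  qed (use \<open>J \<in> \<A>\<close> in blast)
  then obtain M where M: "M \<in> \<A>" and max: "\<And>X. X \<in> \<A> \<Longrightarrow> M \<subseteq> X \<Longrightarrow> X = M" by blast
  interpret M: ideal M R using M by (simp add: \<A>_def)
  have gen: "\<exists>n::nat. \<exists>m\<in>M. \<exists>r\<in>car R. s [^] n = m \<oplus> r \<otimes> a" if a: "a \<in> car R" "a \<notin> M" for a
  proof (rule ccontr)
    assume neg: "\<not> ?thesis"
    let ?X = "M <+>\<^bsub>R\<^esub> PIdl a"
    have X: "ideal ?X R" using M.is_ideal a by (simp add: add_ideals cgenideal_ideal)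
    have mem: "x \<in> ?X \<longleftrightarrow> (\<exists>m\<in>M. \<exists>r\<in>car R. x = m \<oplus> r \<otimes> a)" for x
      by (auto simp: set_add_defs cgenideal_def)
    have "M \<subseteq> ?X"
    proof
      fix m assume "m \<in> M"
      then have "m = m \<oplus> \<zero> \<otimes> a" using a M.Icarr by simp
      then show "m \<in> ?X" using \<open>m \<in> M\<close> mem by blast
    qed
    moreover have "?X \<in> \<A>"
    proof -
      have "s [^] n \<notin> ?X" for n :: nat using neg mem by blast
      then show ?thesis using X \<open>M \<subseteq> ?X\<close> M by (auto simp: \<A>_def)
    qed
    ultimately have "?X = M" using max by blast
    moreover have "a = \<zero> \<oplus> \<one> \<otimes> a" using a by simp
    then have "a \<in> ?X" using mem M.zero_closed by blast
    ultimately show False using a by blast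
  qed
  have "s [^] (1::nat) \<notin> M" using M unfolding \<A>_def by blast
  then have "s \<notin> M" using s by simp
  moreover have "primeideal M R"
  proof (rule primeidealI)
    show "car R \<noteq> M" using \<open>s \<notin> M\<close> s by blast
    fix a b assume ab: "a \<in> car R" "b \<in> car R" "a \<otimes> b \<in> M"
    show "a \<in> M \<or> b \<in> M"
    proof (rule ccontr)
      assume "\<not> ?thesis"
      then obtain n k m m' r r' where *: "m \<in> M" "m' \<in> M" "r \<in> car R" "r' \<in> car R"
        "s [^] (n::nat) = m \<oplus> r \<otimes> a" "s [^] (k::nat) = m' \<oplus> r' \<otimes> b"
        using gen ab by metis
      have mc: "m \<in> car R" "m' \<in> car R" using * M.Icarr by auto
      have "s [^] (n + k) = (m \<oplus> r \<otimes> a) \<otimes> (m' \<oplus> r' \<otimes> b)"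
        using * s by (simp flip: nat_pow_mult)
      also have "\<dots> = m \<otimes> (m' \<oplus> r' \<otimes> b) \<oplus> (r \<otimes> a) \<otimes> m' \<oplus> (r \<otimes> r') \<otimes> (a \<otimes> b)"
        using * ab mc by algebra
      also have "\<dots> \<in> M"
        by (intro M.a_closed M.I_r_closed[OF *(1)] M.I_l_closed[OF *(2)] M.I_l_closed[OF ab(3)])
          (use * ab mc in auto)
      finally show False using M by (auto simp: \<A>_def)
    qed
  qed (use M.is_ideal is_cring in auto)
  ultimately show thesis using that M by (auto simp: \<A>_def)
qed

section \<open>The binomial theorem and the Frobenius endomorphism\<close>

lemma (in cring) binomial_finsum:
  assumes [simp]: "x \<in> car R" "y \<in> car R"
  shows "(x \<oplus> y) [^] (n::nat) = (\<Oplus>i\<in>{..n}. [(n choose i)] \<cdot> (x [^] i \<otimes> y [^] (n - i)))"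
proof (induction n)
  case 0
  then show ?case by simp
next
  case (Suc n)
  let ?f = "\<lambda>i. [(n choose i)] \<cdot> (x [^] i \<otimes> y [^] (n - i))"
  let ?g = "\<lambda>i. [(Suc n choose i)] \<cdot> (x [^] i \<otimes> y [^] (Suc n - i))"
  let ?h = "\<lambda>i. [(n choose i)] \<cdot> (x [^] i \<otimes> y [^] (Suc n - i))"
  have 1: "(\<Oplus>i\<in>{..n}. ?f i) \<otimes> x = (\<Oplus>i\<in>{..n}. [(n choose i)] \<cdot> (x [^] Suc i \<otimes> y [^] (n - i)))"
  proof -
    have "(\<Oplus>i\<in>{..n}. ?f i) \<otimes> x = (\<Oplus>i\<in>{..n}. ?f i \<otimes> x)"
      by (rule finsum_ldistr) auto
    also have "\<dots> = (\<Oplus>i\<in>{..n}. [(n choose i)] \<cdot> (x [^] Suc i \<otimes> y [^] (n - i)))"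
    proof (intro finsum_cong')
      fix i
      have "x [^] i \<otimes> y [^] (n - i) \<otimes> x = x [^] Suc i \<otimes> y [^] (n - i)"
        by (simp add: m_assoc m_comm m_lcomm)
      then show "?f i \<otimes> x = [(n choose i)] \<cdot> (x [^] Suc i \<otimes> y [^] (n - i))"
        by (subst add_pow_ldistr) auto
    qed auto
    finally show ?thesis .
  qed
  have 2: "(\<Oplus>i\<in>{..n}. ?f i) \<otimes> y = (\<Oplus>i\<in>{..n}. ?h i)"
  proof -
    have "(\<Oplus>i\<in>{..n}. ?f i) \<otimes> y = (\<Oplus>i\<in>{..n}. ?f i \<otimes> y)"
      by (rule finsum_ldistr) auto
    also have "\<dots> = (\<Oplus>i\<in>{..n}. ?h i)"
    proof (intro finsum_cong')
      fix i assume "i \<in> {..n}"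
      then have "x [^] i \<otimes> y [^] (n - i) \<otimes> y = x [^] i \<otimes> y [^] (Suc n - i)"
        by (simp add: m_assoc Suc_diff_le)
      then show "?f i \<otimes> y = ?h i"
        by (subst add_pow_ldistr) auto
    qed auto
    finally show ?thesis .
  qed
  have "finsum R ?g {..Suc n} = (\<Oplus>i\<in>{..n}. ?g (Suc i)) \<oplus> ?g 0"
    by (subst finsum_Suc2) (auto simp del: binomial_Suc_Suc)
  also have "(\<Oplus>i\<in>{..n}. ?g (Suc i)) = (\<Oplus>i\<in>{..n}. [(n choose i)] \<cdot> (x [^] Suc i \<otimes> y [^] (n - i)) \<oplus> ?h (Suc i))"
    by (intro finsum_cong') (auto simp: add.nat_pow_mult)
  also have "\<dots> = (\<Oplus>i\<in>{..n}. [(n choose i)] \<cdot> (x [^] Suc i \<otimes> y [^] (n - i))) \<oplus> (\<Oplus>i\<in>{..n}. ?h (Suc i))"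
    by (rule finsum_addf) auto
  finally have "finsum R ?g {..Suc n} = (\<Oplus>i\<in>{..n}. ?f i) \<otimes> x \<oplus> ((\<Oplus>i\<in>{..n}. ?h (Suc i)) \<oplus> ?h 0)"
    unfolding 1 by (simp add: a_assoc)
  also have "(\<Oplus>i\<in>{..n}. ?h (Suc i)) \<oplus> ?h 0 = finsum R ?h {..Suc n}"
    by (subst finsum_Suc2) auto
  \<comment> \<open>At the index \<open>Suc n\<close> the coefficient \<open>n choose Suc n\<close>
    is zero, so the longer sum gains nothing.\<close>
  also have "finsum R ?h {..Suc n} = finsum R ?h {..n}"
    by (subst finsum_Suc) (auto simp: binomial_eq_0)
  finally show ?case using Suc.IH 2 by (simp add: r_distr del: finsum_Suc finsum_Suc2)
qed

lemma (in cring) add_pow_one_eq_zero: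
  assumes "[(p::nat)] \<cdot> \<one> = \<zero>" "x \<in> car R" "p dvd n"
  shows "[(n::nat)] \<cdot> x = \<zero>"
proof -
  have "[p] \<cdot> x = [p] \<cdot> \<one> \<otimes> x" using assms(2) by (simp add: add_pow_ldistr)
  then have "[p] \<cdot> x = \<zero>" using assms by simp
  then show ?thesis using assms by (auto simp: dvd_def simp flip: add.nat_pow_pow)
qed

lemma (in cring) freshmans_dream:
  assumes p: "prime p" "[(p::nat)] \<cdot> \<one> = \<zero>" and [simp]: "x \<in> car R" "y \<in> car R"
  shows "(x \<oplus> y) [^] p = x [^] p \<oplus> y [^] p"
proof -
  \<comment> \<open>Writing \<open>p\<close> as \<open>m + 2\<close> allows both end terms,
    \<open>i = p\<close> and \<open>i = 0\<close>, to be split off; the coefficients in between are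
    divisible by \<open>p\<close>.\<close>
  obtain m where m: "p = Suc (Suc m)"
    using prime_ge_2_nat[OF p(1)] by (metis Suc_eq_plus1 add_2_eq_Suc le_Suc_ex)
  let ?f = "\<lambda>i. [(p choose i)] \<cdot> (x [^] i \<otimes> y [^] (p - i))"
  have z: "?f (Suc i) = \<zero>" if "i \<le> m" for i
  proof (rule add_pow_one_eq_zero[OF p(2)])
    show "p dvd (p choose Suc i)" using that m p by (intro dvd_choose_prime) auto
  qed (use that m in auto)
  have "(x \<oplus> y) [^] p = finsum R ?f {..p}" by (rule binomial_finsum) auto
  also have "\<dots> = ?f p \<oplus> finsum R ?f {..Suc m}"
    unfolding m by (subst finsum_Suc) (auto simp del: binomial_Suc_Suc)
  also have "finsum R ?f {..Suc m} = (\<Oplus>i\<in>{..m}. ?f (Suc i)) \<oplus> ?f 0"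
    by (subst finsum_Suc2) auto
  also have "(\<Oplus>i\<in>{..m}. ?f (Suc i)) = (\<Oplus>i\<in>{..m}. \<zero>)"
    using z by (intro finsum_cong') auto
  finally show ?thesis by simp
qed

lemma (in cring) freshmans_dream_iterated:
  assumes p: "prime p" "[(p::nat)] \<cdot> \<one> = \<zero>" and [simp]: "x \<in> car R" "y \<in> car R"
  shows "(x \<oplus> y) [^] (p ^ m) = x [^] (p ^ m) \<oplus> y [^] (p ^ m)"
proof (induction m)
  case (Suc m)
  then show ?case
    by (simp add: mult.commute[of p] freshmans_dream[OF p] flip: nat_pow_pow)
qed simp

text \<open>Frobenius is applied to \<open>-1 + 1 = 0\<close>, which avoids a case distinction on
  the parity of \<open>p\<close>.\<close>

lemma (in cring) minus_one_pow_prime: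
  assumes p: "prime p" "[(p::nat)] \<cdot> \<one> = \<zero>"
  shows "(\<ominus> \<one>) [^] (p ^ m) = \<ominus> \<one>"
proof -
  have 0: "p ^ m \<noteq> 0" using p by auto
  have "(\<ominus> \<one> \<oplus> \<one>) [^] (p ^ m) = (\<ominus> \<one>) [^] (p ^ m) \<oplus> \<one> [^] (p ^ m)"
    by (rule freshmans_dream_iterated[OF p]) auto
  then have "(\<ominus> \<one>) [^] (p ^ m) \<oplus> \<one> = \<zero>" using 0 by (simp add: l_neg nat_pow_zero)
  then show ?thesis by (simp add: sum_zero_eq_neg)
qed

lemma (in cring) neg_pow_prime:
  assumes p: "prime p" "[(p::nat)] \<cdot> \<one> = \<zero>" and x: "x \<in> car R"
  shows "(\<ominus> x) [^] (p ^ m) = \<ominus> (x [^] (p ^ m))"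
proof -
  have "\<ominus> x = \<ominus> \<one> \<otimes> x" using x by algebra
  then have "(\<ominus> x) [^] (p ^ m) = (\<ominus> \<one>) [^] (p ^ m) \<otimes> x [^] (p ^ m)"
    using x by (simp add: nat_pow_distrib)
  also have "\<dots> = \<ominus> (x [^] (p ^ m))"
    unfolding minus_one_pow_prime[OF p] using x nat_pow_closed[OF x] by algebra
  finally show ?thesis .
qed

text \<open>Induction on \<open>n\<close>: a prime factor is split off, and in a domain one of the
  two factors already vanishes.\<close>

lemma (in domain) exists_prime_char:
  assumes "[(n::nat)] \<cdot> \<one> = \<zero>" "n > 0"
  shows "\<exists>p::nat. prime p \<and> [p] \<cdot> \<one> = \<zero>"
  using assms
proof (induction n rule: less_induct)
  case (less n)
  show ?case
  proof (cases "n = 1")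
    case True
    then show ?thesis using less.prems by simp
  next
    case False
    then obtain p k :: nat where pk: "prime p" "n = p * k"
      by (metis dvdE prime_factor_nat)
    then have "[p] \<cdot> \<one> \<otimes> [k] \<cdot> \<one> = \<zero>"
      using less.prems by (subst add_pow_ldistr) (auto simp: add.nat_pow_pow mult.commute)
    then have "[p] \<cdot> \<one> = \<zero> \<or> [k] \<cdot> \<one> = \<zero>" by (simp add: integral_iff)
    moreover have "0 < k" "k < n"
      using pk less.prems prime_gt_1_nat[of p] by (auto intro: Nat.gr0I)
    ultimately show ?thesis using less.IH[of k] pk(1) by auto
  qed
qed

text \<open>The power \<open>p ^ m\<close> of \<open>x - y\<close> is the difference of the powers,
  hence zero, and a domain has no nonzero nilpotent elements.\<close>

lemma (in domain) root_unique:
  assumes p: "prime p" "[(p::nat)] \<cdot> \<one> = \<zero>" and [simp]: "x \<in> car R" "y \<in> car R"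
    and eq: "x [^] (p ^ m) = y [^] (p ^ m)"
  shows "x = y"
proof -
  have "(x \<ominus> y) [^] (p ^ m) = x [^] (p ^ m) \<oplus> (\<ominus> y) [^] (p ^ m)"
    using freshmans_dream_iterated[OF p, of x "\<ominus> y"] by (simp add: a_minus_def)
  also have "\<dots> = \<zero>" using eq by (simp add: neg_pow_prime[OF p] r_neg)
  finally have z: "(x \<ominus> y) [^] (p ^ m) = \<zero>" .
  have "a [^] (k::nat) = \<zero> \<Longrightarrow> a \<in> car R \<Longrightarrow> a = \<zero>" for a k
    by (induction k) (auto simp: integral_iff)
  then have "x \<ominus> y = \<zero>" using z by simp
  then show ?thesis by simp
qed

section \<open>The field of fractions of a domain\<close>

text \<open>A fraction is stored as its full equivalence class, so that equality of fractions is
  equality of sets.\<close>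

definition frac :: "('a, 'm) ring_scheme \<Rightarrow> 'a \<Rightarrow> 'a \<Rightarrow> ('a \<times> 'a) set" where
  "frac R a b = {(c, d). c \<in> car R \<and> d \<in> car R - {\<zero>\<^bsub>R\<^esub>} \<and> a \<otimes>\<^bsub>R\<^esub> d = c \<otimes>\<^bsub>R\<^esub> b}"

text \<open>Operations are computed on representatives selected by \<open>SOME\<close>;
  \<open>frac_mult\<close> and \<open>frac_add\<close> show that the choice is immaterial.\<close>

definition lift_frac :: "('a \<times> 'a \<Rightarrow> 'a \<times> 'a \<Rightarrow> 'b) \<Rightarrow> ('a \<times> 'a) set \<Rightarrow> ('a \<times> 'a) set \<Rightarrow> 'b" where
  "lift_frac f X Y = f (SOME p. p \<in> X) (SOME p. p \<in> Y)"

definition frac_field :: "('a, 'm) ring_scheme \<Rightarrow> ('a \<times> 'a) set ring" where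
  "frac_field R = \<lparr>
     partial_object.carrier = {frac R a b | a b. a \<in> car R \<and> b \<in> car R - {\<zero>\<^bsub>R\<^esub>}},
     monoid.mult = lift_frac (\<lambda>(a, b) (c, d). frac R (a \<otimes>\<^bsub>R\<^esub> c) (b \<otimes>\<^bsub>R\<^esub> d)),
     monoid.one = frac R \<one>\<^bsub>R\<^esub> \<one>\<^bsub>R\<^esub>,
     ring.zero = frac R \<zero>\<^bsub>R\<^esub> \<one>\<^bsub>R\<^esub>,
     ring.add = lift_frac (\<lambda>(a, b) (c, d). frac R (a \<otimes>\<^bsub>R\<^esub> d \<oplus>\<^bsub>R\<^esub> c \<otimes>\<^bsub>R\<^esub> b) (b \<otimes>\<^bsub>R\<^esub> d))\<rparr>"

context domain
begin

lemma frac_eq_iff: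
  assumes [simp]: "a \<in> car R" "c \<in> car R" and bd: "b \<in> car R - {\<zero>}" "d \<in> car R - {\<zero>}"
  shows "frac R a b = frac R c d \<longleftrightarrow> a \<otimes> d = c \<otimes> b"
proof -
  have [simp]: "b \<in> car R" "d \<in> car R" using assms by auto
  show ?thesis
  proof
    assume "frac R a b = frac R c d"
    moreover have "(c, d) \<in> frac R c d" using bd by (simp add: frac_def)
    ultimately have "(c, d) \<in> frac R a b" by blast
    then show "a \<otimes> d = c \<otimes> b" by (simp add: frac_def)
  next
    assume eq: "a \<otimes> d = c \<otimes> b"
    have nz: "b \<noteq> \<zero>" "d \<noteq> \<zero>" using bd by auto
    \<comment> \<open>Transitivity of cross-multiplication: scale by \<open>d\<close>, replace
      \<open>a d\<close> by \<open>c b\<close>, and cancel \<open>b\<close>.\<close>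
    have "a \<otimes> y = x \<otimes> b \<longleftrightarrow> c \<otimes> y = x \<otimes> d" if [simp]: "x \<in> car R" "y \<in> car R" for x y
    proof -
      have "a \<otimes> y = x \<otimes> b \<longleftrightarrow> d \<otimes> (a \<otimes> y) = d \<otimes> (x \<otimes> b)"
        using m_lcancel nz by simp
      also have "d \<otimes> (a \<otimes> y) = b \<otimes> (c \<otimes> y)"
      proof -
        have "d \<otimes> (a \<otimes> y) = (a \<otimes> d) \<otimes> y" by (simp add: m_ac)
        then show ?thesis unfolding eq by (simp add: m_ac)
      qed
      also have "d \<otimes> (x \<otimes> b) = b \<otimes> (x \<otimes> d)" by (simp add: m_ac)
      also have "b \<otimes> (c \<otimes> y) = b \<otimes> (x \<otimes> d) \<longleftrightarrow> c \<otimes> y = x \<otimes> d"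
        using m_lcancel nz by simp
      finally show ?thesis .
    qed
    then show "frac R a b = frac R c d" unfolding frac_def by blast
  qed
qed

lemma frac_rep:
  assumes "a \<in> car R" "b \<in> car R - {\<zero>}"
  obtains a' b' where "(SOME p. p \<in> frac R a b) = (a', b')"
    "a' \<in> car R" "b' \<in> car R - {\<zero>}" "frac R a b = frac R a' b'"
proof -
  have "(a, b) \<in> frac R a b" using assms by (simp add: frac_def)
  then have "(SOME p. p \<in> frac R a b) \<in> frac R a b" by (rule someI)
  then show thesis
    using that frac_eq_iff[OF assms(1) _ assms(2)] by (cases "SOME p. p \<in> frac R a b") (auto simp: frac_def)
qed

lemma mult_nonzero: "b \<in> car R - {\<zero>} \<Longrightarrow> d \<in> car R - {\<zero>} \<Longrightarrow> b \<otimes> d \<in> car R - {\<zero>}"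
  by (auto simp: integral_iff)

lemma frac_mult:
  assumes [simp]: "a \<in> car R" "c \<in> car R" and b: "b \<in> car R - {\<zero>}" and d: "d \<in> car R - {\<zero>}"
  shows "frac R a b \<otimes>\<^bsub>frac_field R\<^esub> frac R c d = frac R (a \<otimes> c) (b \<otimes> d)"
proof -
  have [simp]: "b \<in> car R" "d \<in> car R" using b d by auto
  obtain a' b' where 1: "(SOME p. p \<in> frac R a b) = (a', b')"
    and [simp]: "a' \<in> car R" and b': "b' \<in> car R - {\<zero>}" "frac R a b = frac R a' b'"
    using frac_rep[of a b] b by auto
  obtain c' d' where 2: "(SOME p. p \<in> frac R c d) = (c', d')"
    and [simp]: "c' \<in> car R" and d': "d' \<in> car R - {\<zero>}" "frac R c d = frac R c' d'"
    using frac_rep[of c d] d by auto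
  have [simp]: "b' \<in> car R" "d' \<in> car R" using b' d' by auto
  have "a \<otimes> b' = a' \<otimes> b" "c \<otimes> d' = c' \<otimes> d"
    using b' d' b d by (auto simp: frac_eq_iff)
  then have "(a' \<otimes> b) \<otimes> (c' \<otimes> d) = (a \<otimes> b') \<otimes> (c \<otimes> d')" by simp
  then have "frac R (a' \<otimes> c') (b' \<otimes> d') = frac R (a \<otimes> c) (b \<otimes> d)"
    using mult_nonzero[OF b d] mult_nonzero[OF b'(1) d'(1)]
    by (subst frac_eq_iff) (auto simp: m_ac)
  then show ?thesis by (simp add: frac_field_def lift_frac_def 1 2)
qed

lemma frac_add:
  assumes [simp]: "a \<in> car R" "c \<in> car R" and b: "b \<in> car R - {\<zero>}" and d: "d \<in> car R - {\<zero>}"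
  shows "frac R a b \<oplus>\<^bsub>frac_field R\<^esub> frac R c d = frac R (a \<otimes> d \<oplus> c \<otimes> b) (b \<otimes> d)"
proof -
  have [simp]: "b \<in> car R" "d \<in> car R" using b d by auto
  obtain a' b' where 1: "(SOME p. p \<in> frac R a b) = (a', b')"
    and [simp]: "a' \<in> car R" and b': "b' \<in> car R - {\<zero>}" "frac R a b = frac R a' b'"
    using frac_rep[of a b] b by auto
  obtain c' d' where 2: "(SOME p. p \<in> frac R c d) = (c', d')"
    and [simp]: "c' \<in> car R" and d': "d' \<in> car R - {\<zero>}" "frac R c d = frac R c' d'"
    using frac_rep[of c d] d by auto
  have [simp]: "b' \<in> car R" "d' \<in> car R" using b' d' by auto
  have *: "a \<otimes> b' = a' \<otimes> b" "c \<otimes> d' = c' \<otimes> d"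
    using b' d' b d by (auto simp: frac_eq_iff)
  have "(a' \<otimes> d' \<oplus> c' \<otimes> b') \<otimes> (b \<otimes> d) = (a' \<otimes> b) \<otimes> (d \<otimes> d') \<oplus> (c' \<otimes> d) \<otimes> (b \<otimes> b')"
    by (simp add: l_distr r_distr m_ac)
  also have "\<dots> = (a \<otimes> b') \<otimes> (d \<otimes> d') \<oplus> (c \<otimes> d') \<otimes> (b \<otimes> b')" by (simp add: *)
  also have "\<dots> = (a \<otimes> d \<oplus> c \<otimes> b) \<otimes> (b' \<otimes> d')" by (simp add: l_distr r_distr m_ac)
  finally have "frac R (a' \<otimes> d' \<oplus> c' \<otimes> b') (b' \<otimes> d') = frac R (a \<otimes> d \<oplus> c \<otimes> b) (b \<otimes> d)"
    using mult_nonzero[OF b d] mult_nonzero[OF b'(1) d'(1)]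
    by (subst frac_eq_iff) auto
  then show ?thesis by (simp add: frac_field_def lift_frac_def 1 2)
qed

lemma frac_in_carrier: "a \<in> car R \<Longrightarrow> b \<in> car R - {\<zero>} \<Longrightarrow> frac R a b \<in> car (frac_field R)"
  by (auto simp: frac_field_def)

lemma carrier_frac_fieldE:
  assumes "X \<in> car (frac_field R)"
  obtains a b where "X = frac R a b" "a \<in> car R" "b \<in> car R" "b \<noteq> \<zero>"
  using assms by (auto simp: frac_field_def)

lemma frac_one: "\<one>\<^bsub>frac_field R\<^esub> = frac R \<one> \<one>" and frac_zero: "\<zero>\<^bsub>frac_field R\<^esub> = frac R \<zero> \<one>"
  by (simp_all add: frac_field_def)

lemmas frac_simps = frac_add frac_mult frac_one frac_zero frac_eq_iff frac_in_carrier integral_iff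

text \<open>Once the operands are written as fractions, each axiom becomes a cross-multiplied
  identity in \<open>R\<close>.\<close>

lemma field_frac_field: "field (frac_field R)"
proof -
  let ?K = "frac_field R"
  have grp: "abelian_group ?K"
  proof (rule abelian_groupI)
    fix X Y Z assume "X \<in> car ?K" "Y \<in> car ?K" "Z \<in> car ?K"
    then show "X \<oplus>\<^bsub>?K\<^esub> Y \<oplus>\<^bsub>?K\<^esub> Z = X \<oplus>\<^bsub>?K\<^esub> (Y \<oplus>\<^bsub>?K\<^esub> Z)"
      by (elim carrier_frac_fieldE) (simp add: frac_simps, algebra)
  next
    fix X Y assume "X \<in> car ?K" "Y \<in> car ?K"
    then show "X \<oplus>\<^bsub>?K\<^esub> Y \<in> car ?K"
      by (elim carrier_frac_fieldE) (simp add: frac_simps)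
  next
    fix X Y assume "X \<in> car ?K" "Y \<in> car ?K"
    then show "X \<oplus>\<^bsub>?K\<^esub> Y = Y \<oplus>\<^bsub>?K\<^esub> X"
      by (elim carrier_frac_fieldE) (simp add: frac_simps, algebra)
  next
    fix X assume "X \<in> car ?K"
    then show "\<zero>\<^bsub>?K\<^esub> \<oplus>\<^bsub>?K\<^esub> X = X"
      by (elim carrier_frac_fieldE) (simp add: frac_simps)
  next
    fix X assume "X \<in> car ?K"
    then obtain a b where ab: "X = frac R a b" "a \<in> car R" "b \<in> car R" "b \<noteq> \<zero>"
      by (elim carrier_frac_fieldE)
    then have "frac R (\<ominus> a) b \<in> car ?K" "frac R (\<ominus> a) b \<oplus>\<^bsub>?K\<^esub> X = \<zero>\<^bsub>?K\<^esub>"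
      by (simp_all add: frac_simps flip: l_distr) (simp add: l_neg)
    then show "\<exists>Y\<in>car ?K. Y \<oplus>\<^bsub>?K\<^esub> X = \<zero>\<^bsub>?K\<^esub>" by blast
  qed (simp add: frac_simps)
  have mon: "comm_monoid ?K"
  proof (rule comm_monoidI)
    fix X Y Z assume "X \<in> car ?K" "Y \<in> car ?K" "Z \<in> car ?K"
    then show "X \<otimes>\<^bsub>?K\<^esub> Y \<otimes>\<^bsub>?K\<^esub> Z = X \<otimes>\<^bsub>?K\<^esub> (Y \<otimes>\<^bsub>?K\<^esub> Z)"
      by (elim carrier_frac_fieldE) (simp add: frac_simps m_assoc)
  next
    fix X Y assume "X \<in> car ?K" "Y \<in> car ?K"
    then show "X \<otimes>\<^bsub>?K\<^esub> Y \<in> car ?K"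
      by (elim carrier_frac_fieldE) (simp add: frac_simps)
  next
    fix X Y assume "X \<in> car ?K" "Y \<in> car ?K"
    then show "X \<otimes>\<^bsub>?K\<^esub> Y = Y \<otimes>\<^bsub>?K\<^esub> X"
      by (elim carrier_frac_fieldE) (simp add: frac_simps m_comm)
  next
    fix X assume "X \<in> car ?K"
    then show "\<one>\<^bsub>?K\<^esub> \<otimes>\<^bsub>?K\<^esub> X = X"
      by (elim carrier_frac_fieldE) (simp add: frac_simps)
  qed (simp add: frac_simps)
  interpret K: cring ?K
  proof (rule cringI[OF grp mon])
    fix X Y Z assume "X \<in> car ?K" "Y \<in> car ?K" "Z \<in> car ?K"
    then show "(X \<oplus>\<^bsub>?K\<^esub> Y) \<otimes>\<^bsub>?K\<^esub> Z = X \<otimes>\<^bsub>?K\<^esub> Z \<oplus>\<^bsub>?K\<^esub> Y \<otimes>\<^bsub>?K\<^esub> Z"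
      by (elim carrier_frac_fieldE) (simp add: frac_simps, algebra)
  qed
  show ?thesis
  proof (rule K.cring_fieldI2)
    fix X assume "X \<in> car ?K" "X \<noteq> \<zero>\<^bsub>?K\<^esub>"
    then obtain a b where ab: "X = frac R a b" "a \<in> car R" "b \<in> car R" "b \<noteq> \<zero>" "a \<noteq> \<zero>"
      by (elim carrier_frac_fieldE) (auto simp: frac_simps)
    then have "frac R b a \<in> car ?K" "X \<otimes>\<^bsub>?K\<^esub> frac R b a = \<one>\<^bsub>?K\<^esub>"
      by (simp_all add: frac_simps m_comm)
    then show "\<exists>Y\<in>car ?K. X \<otimes>\<^bsub>?K\<^esub> Y = \<one>\<^bsub>?K\<^esub>" by blast
  qed (simp add: frac_simps)
qed

lemma frac_ring_hom: "(\<lambda>a. frac R a \<one>) \<in> ring_hom R (frac_field R)"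
  by (rule ring_hom_memI) (simp_all add: frac_simps)

lemma frac_inj: "a \<in> car R \<Longrightarrow> frac R a \<one> = \<zero>\<^bsub>frac_field R\<^esub> \<longleftrightarrow> a = \<zero>"
  by (simp add: frac_simps)

end

section \<open>Two fields over a common subfield: operators on linear maps\<close>

text \<open>The common subfield is not a third structure but the set of pairs of its images in
  \<open>L\<close> and \<open>M\<close>. Additivity and \<open>k_zero_iff\<close> make it the graph
  of an isomorphism between a subfield of \<open>L\<close> and one of \<open>M\<close>, so
  \<open>(x, y) \<in> k\<close> means that \<open>x\<close> and \<open>y\<close> are the same
  scalar.\<close>

locale field_pair = L: field L + M: field M
  for L :: "('l, 'a) ring_scheme" (structure) and M :: "('m, 'b) ring_scheme" (structure) +
  fixes k :: "('l \<times> 'm) set"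
  assumes k_carrier: "(c, d) \<in> k \<Longrightarrow> c \<in> car L \<and> d \<in> car M"
    and k_one: "(\<one>\<^bsub>L\<^esub>, \<one>\<^bsub>M\<^esub>) \<in> k"
    and k_neg: "(c, d) \<in> k \<Longrightarrow> (\<ominus>\<^bsub>L\<^esub> c, \<ominus>\<^bsub>M\<^esub> d) \<in> k"
    and k_add: "(c, d) \<in> k \<Longrightarrow> (c', d') \<in> k \<Longrightarrow> (c \<oplus>\<^bsub>L\<^esub> c', d \<oplus>\<^bsub>M\<^esub> d') \<in> k"
    and k_mult: "(c, d) \<in> k \<Longrightarrow> (c', d') \<in> k \<Longrightarrow> (c \<otimes>\<^bsub>L\<^esub> c', d \<otimes>\<^bsub>M\<^esub> d') \<in> k"
    and k_zero_iff: "(c, d) \<in> k \<Longrightarrow> c = \<zero>\<^bsub>L\<^esub> \<longleftrightarrow> d = \<zero>\<^bsub>M\<^esub>"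
    and k_inv: "(c, d) \<in> k \<Longrightarrow> d \<noteq> \<zero>\<^bsub>M\<^esub> \<Longrightarrow> \<exists>(c', d')\<in>k. d' \<otimes>\<^bsub>M\<^esub> d = \<one>\<^bsub>M\<^esub>"
begin

lemma k_carrierD [simp]: "(c, d) \<in> k \<Longrightarrow> c \<in> car L" "(c, d) \<in> k \<Longrightarrow> d \<in> car M"
  using k_carrier by auto

lemma k_zero: "(\<zero>\<^bsub>L\<^esub>, \<zero>\<^bsub>M\<^esub>) \<in> k"
  using k_add[OF k_one k_neg[OF k_one]] by (simp add: L.r_neg M.r_neg)

lemma k_unique:
  assumes "(c, d) \<in> k" "(c', d') \<in> k"
  shows "c = c' \<longleftrightarrow> d = d'"
proof -
  have "(c \<ominus>\<^bsub>L\<^esub> c', d \<ominus>\<^bsub>M\<^esub> d') \<in> k"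
    using k_add[OF assms(1) k_neg[OF assms(2)]] by (simp add: a_minus_def)
  from k_zero_iff[OF this] show ?thesis using assms by simp
qed

lemma k_of_nat: "([(n::nat)] \<cdot>\<^bsub>L\<^esub> \<one>\<^bsub>L\<^esub>, [n] \<cdot>\<^bsub>M\<^esub> \<one>\<^bsub>M\<^esub>) \<in> k"
  by (induction n) (auto simp: k_zero k_add k_one)

definition subspace :: "'m set \<Rightarrow> bool" where
  "subspace W \<longleftrightarrow> W \<subseteq> car M \<and> \<zero>\<^bsub>M\<^esub> \<in> W \<and> (\<forall>x\<in>W. \<forall>y\<in>W. x \<oplus>\<^bsub>M\<^esub> y \<in> W) \<and>
     (\<forall>(c, d)\<in>k. \<forall>x\<in>W. d \<otimes>\<^bsub>M\<^esub> x \<in> W)"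

lemma subspaceD:
  assumes "subspace W"
  shows "x \<in> W \<Longrightarrow> x \<in> car M" "\<zero>\<^bsub>M\<^esub> \<in> W" "x \<in> W \<Longrightarrow> y \<in> W \<Longrightarrow> x \<oplus>\<^bsub>M\<^esub> y \<in> W"
    "(c, d) \<in> k \<Longrightarrow> x \<in> W \<Longrightarrow> d \<otimes>\<^bsub>M\<^esub> x \<in> W"
  using assms by (auto simp: subspace_def)

lemma subspace_neg: "subspace W \<Longrightarrow> x \<in> W \<Longrightarrow> \<ominus>\<^bsub>M\<^esub> x \<in> W"
  using subspaceD(4)[OF _ k_neg[OF k_one], of W x] subspaceD(1)[of W x] by (simp add: M.l_minus)

text \<open>Adjoining one vector is both the extension step in \<open>separating_functional\<close>
  and the recursion step of \<open>power_span\<close>.\<close>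

lemma subspace_sum:
  assumes "subspace W" "z \<in> car M"
  shows "subspace {w \<oplus>\<^bsub>M\<^esub> d \<otimes>\<^bsub>M\<^esub> z | w c d. w \<in> W \<and> (c, d) \<in> k}" (is "subspace ?X")
  unfolding subspace_def
proof (intro conjI ballI, goal_cases)
  case 1
  then show ?case using assms subspaceD by auto
next
  case 2
  have "\<zero>\<^bsub>M\<^esub> = \<zero>\<^bsub>M\<^esub> \<oplus>\<^bsub>M\<^esub> \<zero>\<^bsub>M\<^esub> \<otimes>\<^bsub>M\<^esub> z" using assms by simp
  then show ?case using k_zero subspaceD(2)[OF assms(1)] by blast
next
  case (3 x y)
  then obtain w c d w' c' d' where *: "x = w \<oplus>\<^bsub>M\<^esub> d \<otimes>\<^bsub>M\<^esub> z" "y = w' \<oplus>\<^bsub>M\<^esub> d' \<otimes>\<^bsub>M\<^esub> z"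
    "w \<in> W" "w' \<in> W" "(c, d) \<in> k" "(c', d') \<in> k" by blast
  have [simp]: "w \<in> car M" "w' \<in> car M" "d \<in> car M" "d' \<in> car M"
    using * subspaceD(1)[OF assms(1)] by auto
  have "x \<oplus>\<^bsub>M\<^esub> y = (w \<oplus>\<^bsub>M\<^esub> w') \<oplus>\<^bsub>M\<^esub> (d \<oplus>\<^bsub>M\<^esub> d') \<otimes>\<^bsub>M\<^esub> z"
    using assms(2) by (simp add: * M.l_distr M.a_ac)
  then show ?case using * k_add[OF *(5,6)] subspaceD(3)[OF assms(1)] by blast
next
  case (4 cd)
  obtain c d where cd: "cd = (c, d)" by force
  show ?case unfolding cd
  proof (clarify, goal_cases)
    case (1 x w c' d')
    have [simp]: "w \<in> car M" "d \<in> car M" "d' \<in> car M"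
      using 1 4 cd subspaceD(1)[OF assms(1)] by auto
    have "d \<otimes>\<^bsub>M\<^esub> (w \<oplus>\<^bsub>M\<^esub> d' \<otimes>\<^bsub>M\<^esub> z) = d \<otimes>\<^bsub>M\<^esub> w \<oplus>\<^bsub>M\<^esub> (d \<otimes>\<^bsub>M\<^esub> d') \<otimes>\<^bsub>M\<^esub> z"
      using assms(2) by (simp add: M.r_distr M.m_assoc)
    then show ?case using 1 4 cd k_mult subspaceD(4)[OF assms(1)] by blast
  qed
qed

text \<open>Maps are \<open>undefined\<close> outside \<open>M\<close>, so they are determined by
  their values on \<open>M\<close>.\<close>

definition linear_maps :: "('m \<Rightarrow> 'l) set" where
  "linear_maps = {\<phi> \<in> car M \<rightarrow>\<^sub>E car L.
     (\<forall>x\<in>car M. \<forall>y\<in>car M. \<phi> (x \<oplus>\<^bsub>M\<^esub> y) = \<phi> x \<oplus>\<^bsub>L\<^esub> \<phi> y) \<and>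
     (\<forall>(c, d)\<in>k. \<forall>x\<in>car M. \<phi> (d \<otimes>\<^bsub>M\<^esub> x) = c \<otimes>\<^bsub>L\<^esub> \<phi> x)}"

lemma linear_mapsD:
  assumes "\<phi> \<in> linear_maps"
  shows "x \<in> car M \<Longrightarrow> \<phi> x \<in> car L" "x \<notin> car M \<Longrightarrow> \<phi> x = undefined"
    "x \<in> car M \<Longrightarrow> y \<in> car M \<Longrightarrow> \<phi> (x \<oplus>\<^bsub>M\<^esub> y) = \<phi> x \<oplus>\<^bsub>L\<^esub> \<phi> y"
    "(c, d) \<in> k \<Longrightarrow> x \<in> car M \<Longrightarrow> \<phi> (d \<otimes>\<^bsub>M\<^esub> x) = c \<otimes>\<^bsub>L\<^esub> \<phi> x"
  using assms by (auto simp: linear_maps_def PiE_def extensional_def)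

lemma linear_maps_zero: "\<phi> \<in> linear_maps \<Longrightarrow> \<phi> \<zero>\<^bsub>M\<^esub> = \<zero>\<^bsub>L\<^esub>"
  using linear_mapsD(4)[OF _ k_zero M.zero_closed] linear_mapsD(1)[OF _ M.zero_closed] by simp

lemma linear_maps_neg: "\<phi> \<in> linear_maps \<Longrightarrow> x \<in> car M \<Longrightarrow> \<phi> (\<ominus>\<^bsub>M\<^esub> x) = \<ominus>\<^bsub>L\<^esub> \<phi> x"
  using linear_mapsD(4)[OF _ k_neg[OF k_one], of \<phi> x] linear_mapsD(1)[of \<phi> x]
  by (simp add: M.l_minus L.l_minus)

text \<open>A subspace \<open>U\<close> that is maximal among those containing \<open>W\<close> and
  missing \<open>v\<close> is a complement of the line through \<open>v\<close>. The functional
  sends a vector to its coefficient of \<open>v\<close> modulo \<open>U\<close>, read off in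
  \<open>L\<close>.\<close>

lemma separating_functional:
  assumes W: "subspace W" and v: "v \<in> car M" "v \<notin> W"
  obtains \<phi> where "\<phi> \<in> linear_maps" "\<And>w. w \<in> W \<Longrightarrow> \<phi> w = \<zero>\<^bsub>L\<^esub>" "\<phi> v = \<one>\<^bsub>L\<^esub>"
proof -
  define \<A> where "\<A> = {X. subspace X \<and> W \<subseteq> X \<and> v \<notin> X}"
  have "W \<in> \<A>" using W v by (simp add: \<A>_def)
  have "\<exists>U\<in>\<A>. \<forall>X\<in>\<A>. U \<subseteq> X \<longrightarrow> X = U"
  proof (rule subset_Zorn_nonempty)
    fix \<C> assume C: "\<C> \<noteq> {}" "subset.chain \<A> \<C>"
    have sub: "subspace X" "W \<subseteq> X" "v \<notin> X" if "X \<in> \<C>" for X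
      using C(2) that by (auto simp: pred_on.chain_def \<A>_def)
    have "subspace (\<Union>\<C>)" unfolding subspace_def
    proof (intro conjI ballI, goal_cases)
      case (3 x y)
      then obtain X Y where XY: "X \<in> \<C>" "x \<in> X" "Y \<in> \<C>" "y \<in> Y" by blast
      then have "X \<subseteq> Y \<or> Y \<subseteq> X" using C(2) by (auto simp: pred_on.chain_def)
      then obtain Z where "Z \<in> \<C>" "x \<in> Z" "y \<in> Z" using XY by blast
      then show ?case using subspaceD(3)[OF sub(1)] by blast
    next
      case (4 cd)
      obtain c d where cd: "cd = (c, d)" by force
      show ?case using subspaceD(4)[OF sub(1)] 4 unfolding cd by blast
    qed (use C(1) sub subspaceD in blast)+
    then show "\<Union>\<C> \<in> \<A>" using C(1) sub(2,3) unfolding \<A>_def by blast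
  qed (use \<open>W \<in> \<A>\<close> in blast)
  then obtain U where "U \<in> \<A>" and max: "\<And>X. X \<in> \<A> \<Longrightarrow> U \<subseteq> X \<Longrightarrow> X = U" by blast
  then have U: "subspace U" "W \<subseteq> U" "v \<notin> U" by (auto simp: \<A>_def)
  \<comment> \<open>If \<open>z\<close> is outside \<open>U\<close>, then by maximality adjoining
    \<open>z\<close> captures \<open>v\<close>. In \<open>v = w + d z\<close> the scalar
    \<open>d\<close> is nonzero, because \<open>v\<close> is not in \<open>U\<close>, so the
    equation can be solved for \<open>z\<close>.\<close>
  have decomp: "\<exists>w\<in>U. \<exists>(c, d)\<in>k. z = w \<oplus>\<^bsub>M\<^esub> d \<otimes>\<^bsub>M\<^esub> v" if z: "z \<in> car M" for z
  proof (cases "z \<in> U")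
    case True
    then have "z = z \<oplus>\<^bsub>M\<^esub> \<zero>\<^bsub>M\<^esub> \<otimes>\<^bsub>M\<^esub> v" using z v by simp
    then show ?thesis using True k_zero by blast
  next
    case False
    let ?X = "{w \<oplus>\<^bsub>M\<^esub> d \<otimes>\<^bsub>M\<^esub> z | w c d. w \<in> U \<and> (c, d) \<in> k}"
    have "z = \<zero>\<^bsub>M\<^esub> \<oplus>\<^bsub>M\<^esub> \<one>\<^bsub>M\<^esub> \<otimes>\<^bsub>M\<^esub> z" using z by simp
    then have "z \<in> ?X" using k_one subspaceD(2)[OF U(1)] by blast
    have "w \<in> ?X" if "w \<in> U" for w
    proof -
      have "w = w \<oplus>\<^bsub>M\<^esub> \<zero>\<^bsub>M\<^esub> \<otimes>\<^bsub>M\<^esub> z" using that z subspaceD(1)[OF U(1)] by simp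
      then show ?thesis using that k_zero by blast
    qed
    then have "U \<subseteq> ?X" by blast
    then have "?X \<notin> \<A>" using max \<open>z \<in> ?X\<close> False by blast
    then have "v \<in> ?X" using subspace_sum[OF U(1) z] \<open>U \<subseteq> ?X\<close> U(2) unfolding \<A>_def by blast
    then obtain w c d where *: "w \<in> U" "(c, d) \<in> k" "v = w \<oplus>\<^bsub>M\<^esub> d \<otimes>\<^bsub>M\<^esub> z" by blast
    have [simp]: "w \<in> car M" "d \<in> car M" using * subspaceD(1)[OF U(1)] by auto
    have "d \<noteq> \<zero>\<^bsub>M\<^esub>" using * U(3) z by auto
    then obtain c' d' where **: "(c', d') \<in> k" "d' \<otimes>\<^bsub>M\<^esub> d = \<one>\<^bsub>M\<^esub>" using k_inv[OF *(2)] by blast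
    have [simp]: "d' \<in> car M" using ** by auto
    have "d' \<otimes>\<^bsub>M\<^esub> v = d' \<otimes>\<^bsub>M\<^esub> w \<oplus>\<^bsub>M\<^esub> (d' \<otimes>\<^bsub>M\<^esub> d) \<otimes>\<^bsub>M\<^esub> z"
      unfolding *(3) using z by (simp add: M.r_distr M.m_assoc)
    then have "z = \<ominus>\<^bsub>M\<^esub> (d' \<otimes>\<^bsub>M\<^esub> w) \<oplus>\<^bsub>M\<^esub> d' \<otimes>\<^bsub>M\<^esub> v"
      using z by (simp add: ** M.r_neg1)
    moreover have "\<ominus>\<^bsub>M\<^esub> (d' \<otimes>\<^bsub>M\<^esub> w) \<in> U"
      using subspace_neg[OF U(1)] subspaceD(4)[OF U(1) **(1) *(1)] by blast
    ultimately show ?thesis using ** by blast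
  qed
  \<comment> \<open>Two representations with different coefficients would put a nonzero multiple of
    \<open>v\<close>, hence \<open>v\<close> itself, into \<open>U\<close>.\<close>
  have unique: "c = c'"
    if "w \<in> U" "w' \<in> U" and k: "(c, d) \<in> k" "(c', d') \<in> k"
      and eq: "w \<oplus>\<^bsub>M\<^esub> d \<otimes>\<^bsub>M\<^esub> v = w' \<oplus>\<^bsub>M\<^esub> d' \<otimes>\<^bsub>M\<^esub> v" for w w' c c' d d'
  proof (rule ccontr)
    assume "c \<noteq> c'"
    have [simp]: "w \<in> car M" "w' \<in> car M" "d \<in> car M" "d' \<in> car M"
      using that subspaceD(1)[OF U(1)] by auto
    have "(c \<ominus>\<^bsub>L\<^esub> c', d \<ominus>\<^bsub>M\<^esub> d') \<in> k"
      using k_add[OF k(1) k_neg[OF k(2)]] by (simp add: a_minus_def)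
    moreover have "d \<ominus>\<^bsub>M\<^esub> d' \<noteq> \<zero>\<^bsub>M\<^esub>" using \<open>c \<noteq> c'\<close> k_unique[OF k] by simp
    ultimately obtain e f where ef: "(e, f) \<in> k" "f \<otimes>\<^bsub>M\<^esub> (d \<ominus>\<^bsub>M\<^esub> d') = \<one>\<^bsub>M\<^esub>"
      using k_inv by blast
    have [simp]: "f \<in> car M" using ef by auto
    have "(d \<ominus>\<^bsub>M\<^esub> d') \<otimes>\<^bsub>M\<^esub> v = \<ominus>\<^bsub>M\<^esub> w \<oplus>\<^bsub>M\<^esub> (w \<oplus>\<^bsub>M\<^esub> d \<otimes>\<^bsub>M\<^esub> v) \<ominus>\<^bsub>M\<^esub> d' \<otimes>\<^bsub>M\<^esub> v"
      using v by (simp add: M.r_neg1 a_minus_def M.l_distr M.l_minus)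
    also have "\<dots> = w' \<ominus>\<^bsub>M\<^esub> w"
      unfolding eq using v by (simp add: a_minus_def M.a_ac M.r_neg M.r_neg1 M.r_neg2)
    also have "\<dots> \<in> U"
      using subspaceD(3)[OF U(1)] subspace_neg[OF U(1)] that by (simp add: a_minus_def)
    finally have "f \<otimes>\<^bsub>M\<^esub> ((d \<ominus>\<^bsub>M\<^esub> d') \<otimes>\<^bsub>M\<^esub> v) \<in> U" by (rule subspaceD(4)[OF U(1) ef(1)])
    moreover have "f \<otimes>\<^bsub>M\<^esub> ((d \<ominus>\<^bsub>M\<^esub> d') \<otimes>\<^bsub>M\<^esub> v) = v" using v ef(2) by (simp flip: M.m_assoc)
    ultimately show False using U(3) by simp
  qed
  define \<phi> where "\<phi> = (\<lambda>z\<in>car M. SOME c. \<exists>w\<in>U. \<exists>d. (c, d) \<in> k \<and> z = w \<oplus>\<^bsub>M\<^esub> d \<otimes>\<^bsub>M\<^esub> v)"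
  have \<phi>: "\<phi> (w \<oplus>\<^bsub>M\<^esub> d \<otimes>\<^bsub>M\<^esub> v) = c" if "w \<in> U" "(c, d) \<in> k" for w c d
  proof -
    let ?z = "w \<oplus>\<^bsub>M\<^esub> d \<otimes>\<^bsub>M\<^esub> v"
    let ?P = "\<lambda>c. \<exists>w\<in>U. \<exists>d. (c, d) \<in> k \<and> ?z = w \<oplus>\<^bsub>M\<^esub> d \<otimes>\<^bsub>M\<^esub> v"
    have "?z \<in> car M" using that v subspaceD(1)[OF U(1)] by auto
    moreover have "?P c" using that by blast
    then have "?P (SOME c. ?P c)" by (rule someI)
    then obtain w' d' where "w' \<in> U" "(SOME c. ?P c, d') \<in> k" "?z = w' \<oplus>\<^bsub>M\<^esub> d' \<otimes>\<^bsub>M\<^esub> v" by blast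
    then have "(SOME c. ?P c) = c" using unique[OF that(1) _ that(2)] by simp
    ultimately show ?thesis by (simp add: \<phi>_def)
  qed
  have "\<phi> \<in> linear_maps"
    unfolding linear_maps_def
  proof (intro CollectI conjI ballI, goal_cases)
    case 1
    have "\<phi> z \<in> car L" if "z \<in> car M" for z
      using decomp[OF that] \<phi> by auto
    then show ?case by (auto simp: \<phi>_def)
  next
    case (2 x y)
    from decomp[OF 2(1)] obtain w c d
      where 1: "w \<in> U" "(c, d) \<in> k" "x = w \<oplus>\<^bsub>M\<^esub> d \<otimes>\<^bsub>M\<^esub> v" by blast
    from decomp[OF 2(2)] obtain w' c' d'
      where 2: "w' \<in> U" "(c', d') \<in> k" "y = w' \<oplus>\<^bsub>M\<^esub> d' \<otimes>\<^bsub>M\<^esub> v" by blast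
    note * = 1 2
    have [simp]: "w \<in> car M" "w' \<in> car M" "d \<in> car M" "d' \<in> car M"
      using * subspaceD(1)[OF U(1)] by auto
    have "x \<oplus>\<^bsub>M\<^esub> y = (w \<oplus>\<^bsub>M\<^esub> w') \<oplus>\<^bsub>M\<^esub> (d \<oplus>\<^bsub>M\<^esub> d') \<otimes>\<^bsub>M\<^esub> v"
      using v(1) by (simp add: * M.l_distr M.a_ac)
    also have "\<phi> \<dots> = c \<oplus>\<^bsub>L\<^esub> c'"
      using * k_add subspaceD(3)[OF U(1)] by (intro \<phi>) auto
    finally show ?case using \<phi> * by simp
  next
    case (3 cd)
    obtain c d where cd: "cd = (c, d)" by force
    have "\<phi> (d \<otimes>\<^bsub>M\<^esub> x) = c \<otimes>\<^bsub>L\<^esub> \<phi> x" if x: "x \<in> car M" for x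
    proof -
      obtain w c' d' where *: "w \<in> U" "(c', d') \<in> k" "x = w \<oplus>\<^bsub>M\<^esub> d' \<otimes>\<^bsub>M\<^esub> v" using decomp[OF x] by blast
      have [simp]: "w \<in> car M" "d \<in> car M" "d' \<in> car M"
        using * 3 cd subspaceD(1)[OF U(1)] by auto
      have "d \<otimes>\<^bsub>M\<^esub> x = d \<otimes>\<^bsub>M\<^esub> w \<oplus>\<^bsub>M\<^esub> (d \<otimes>\<^bsub>M\<^esub> d') \<otimes>\<^bsub>M\<^esub> v"
        using v(1) by (simp add: * M.r_distr M.m_assoc)
      also have "\<phi> \<dots> = c \<otimes>\<^bsub>L\<^esub> c'"
        using * 3 cd k_mult subspaceD(4)[OF U(1)] by (intro \<phi>) auto
      finally show ?thesis using \<phi> * by simp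
    qed
    then show ?case by (simp add: cd)
  qed
  moreover have "\<phi> w = \<zero>\<^bsub>L\<^esub>" if "w \<in> W" for w
    using \<phi>[OF _ k_zero, of w] that U subspaceD(1)[OF U(1), of w] v by auto
  moreover have "\<phi> v = \<one>\<^bsub>L\<^esub>"
    using \<phi>[OF subspaceD(2)[OF U(1)] k_one] v by simp
  ultimately show thesis by (rule that)
qed

definition lscale :: "'l \<Rightarrow> ('m \<Rightarrow> 'l) \<Rightarrow> 'm \<Rightarrow> 'l" where
  "lscale x = (\<lambda>\<phi>\<in>linear_maps. \<lambda>z\<in>car M. x \<otimes>\<^bsub>L\<^esub> \<phi> z)"

definition rscale :: "'m \<Rightarrow> ('m \<Rightarrow> 'l) \<Rightarrow> 'm \<Rightarrow> 'l" where
  "rscale y = (\<lambda>\<phi>\<in>linear_maps. \<lambda>z\<in>car M. \<phi> (y \<otimes>\<^bsub>M\<^esub> z))"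

definition op_add :: "(('m \<Rightarrow> 'l) \<Rightarrow> 'm \<Rightarrow> 'l) \<Rightarrow> (('m \<Rightarrow> 'l) \<Rightarrow> 'm \<Rightarrow> 'l) \<Rightarrow> ('m \<Rightarrow> 'l) \<Rightarrow> 'm \<Rightarrow> 'l" where
  "op_add u w = (\<lambda>\<phi>\<in>linear_maps. \<lambda>z\<in>car M. u \<phi> z \<oplus>\<^bsub>L\<^esub> w \<phi> z)"

text \<open>The presentation by generators supports the inductions that give commutativity and, in
  characteristic p, the existence of p-th roots. Negatives arise by composing with the scaling by
  \<open>-1\<close>.\<close>

inductive_set ops :: "(('m \<Rightarrow> 'l) \<Rightarrow> 'm \<Rightarrow> 'l) set" where
  lscale: "x \<in> car L \<Longrightarrow> lscale x \<in> ops"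
| rscale: "y \<in> car M \<Longrightarrow> rscale y \<in> ops"
| add: "u \<in> ops \<Longrightarrow> w \<in> ops \<Longrightarrow> op_add u w \<in> ops"
| mult: "u \<in> ops \<Longrightarrow> w \<in> ops \<Longrightarrow> compose linear_maps u w \<in> ops"

definition op_ring :: "(('m \<Rightarrow> 'l) \<Rightarrow> 'm \<Rightarrow> 'l) ring" where
  "op_ring = \<lparr>partial_object.carrier = ops, monoid.mult = compose linear_maps,
     monoid.one = lscale \<one>\<^bsub>L\<^esub>, ring.zero = lscale \<zero>\<^bsub>L\<^esub>, ring.add = op_add\<rparr>"

definition map_add :: "('m \<Rightarrow> 'l) \<Rightarrow> ('m \<Rightarrow> 'l) \<Rightarrow> 'm \<Rightarrow> 'l" where
  "map_add \<phi> \<psi> = (\<lambda>z\<in>car M. \<phi> z \<oplus>\<^bsub>L\<^esub> \<psi> z)"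

lemma linear_mapsI:
  assumes "\<And>x. x \<in> car M \<Longrightarrow> \<phi> x \<in> car L" "\<And>x. x \<notin> car M \<Longrightarrow> \<phi> x = undefined"
    "\<And>x y. x \<in> car M \<Longrightarrow> y \<in> car M \<Longrightarrow> \<phi> (x \<oplus>\<^bsub>M\<^esub> y) = \<phi> x \<oplus>\<^bsub>L\<^esub> \<phi> y"
    "\<And>c d x. (c, d) \<in> k \<Longrightarrow> x \<in> car M \<Longrightarrow> \<phi> (d \<otimes>\<^bsub>M\<^esub> x) = c \<otimes>\<^bsub>L\<^esub> \<phi> x"
  shows "\<phi> \<in> linear_maps"
  using assms unfolding linear_maps_def by blast

lemma linear_maps_eqI:
  assumes "\<phi> \<in> linear_maps" "\<psi> \<in> linear_maps" "\<And>z. z \<in> car M \<Longrightarrow> \<phi> z = \<psi> z"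
  shows "\<phi> = \<psi>"
  using assms linear_mapsD(2) by (metis ext)

lemma op_simps:
  "\<phi> \<in> linear_maps \<Longrightarrow> z \<in> car M \<Longrightarrow> lscale x \<phi> z = x \<otimes>\<^bsub>L\<^esub> \<phi> z"
  "\<phi> \<in> linear_maps \<Longrightarrow> z \<in> car M \<Longrightarrow> rscale y \<phi> z = \<phi> (y \<otimes>\<^bsub>M\<^esub> z)"
  "\<phi> \<in> linear_maps \<Longrightarrow> z \<in> car M \<Longrightarrow> op_add u w \<phi> z = u \<phi> z \<oplus>\<^bsub>L\<^esub> w \<phi> z"
  "\<phi> \<in> linear_maps \<Longrightarrow> compose linear_maps u w \<phi> = u (w \<phi>)"
  by (simp_all add: lscale_def rscale_def op_add_def compose_def)

lemma map_add_linear: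
  assumes "\<phi> \<in> linear_maps" "\<psi> \<in> linear_maps"
  shows "map_add \<phi> \<psi> \<in> linear_maps"
  by (rule linear_mapsI)
    (use assms in \<open>auto simp: map_add_def linear_mapsD L.r_distr L.a_ac\<close>)

lemma lscale_linear: "x \<in> car L \<Longrightarrow> \<phi> \<in> linear_maps \<Longrightarrow> lscale x \<phi> \<in> linear_maps"
  by (rule linear_mapsI)
    (auto simp: lscale_def linear_mapsD L.r_distr L.m_ac)

lemma rscale_linear: "y \<in> car M \<Longrightarrow> \<phi> \<in> linear_maps \<Longrightarrow> rscale y \<phi> \<in> linear_maps"
  by (rule linear_mapsI)
    (auto simp: rscale_def linear_mapsD M.r_distr M.m_lcomm)

lemma ops_linear: "u \<in> ops \<Longrightarrow> \<phi> \<in> linear_maps \<Longrightarrow> u \<phi> \<in> linear_maps"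
proof (induction u arbitrary: \<phi> rule: ops.induct)
  case (add u w)
  have "op_add u w \<phi> = map_add (u \<phi>) (w \<phi>)" using add by (simp add: op_add_def map_add_def)
  then show ?case using add map_add_linear by simp
qed (auto simp: lscale_linear rscale_linear compose_def)

text \<open>This carries an operator past a pointwise sum, which is the \<open>add\<close> case of
  the commutativity proof.\<close>

lemma ops_additive:
  "u \<in> ops \<Longrightarrow> \<phi> \<in> linear_maps \<Longrightarrow> \<psi> \<in> linear_maps \<Longrightarrow> u (map_add \<phi> \<psi>) = map_add (u \<phi>) (u \<psi>)"
proof (induction u arbitrary: \<phi> \<psi> rule: ops.induct)
  case (add u w)
  show ?case
  proof (rule linear_maps_eqI)
    fix z assume "z \<in> car M"
    then show "op_add u w (map_add \<phi> \<psi>) z = map_add (op_add u w \<phi>) (op_add u w \<psi>) z"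
      using add.prems ops_linear[OF add.hyps(1)] ops_linear[OF add.hyps(2)]
      by (simp add: map_add_linear op_add_def add.IH) (simp add: map_add_def linear_mapsD L.a_ac)
  qed (use add in \<open>simp_all add: ops_linear map_add_linear ops.add\<close>)
next
  case (lscale x)
  show ?case
  proof (rule linear_maps_eqI)
    fix z assume "z \<in> car M"
    then show "lscale x (map_add \<phi> \<psi>) z = map_add (lscale x \<phi>) (lscale x \<psi>) z"
      using lscale by (simp add: op_simps map_add_linear) (simp add: map_add_def op_simps linear_mapsD L.r_distr)
  qed (use lscale in \<open>simp_all add: lscale_linear map_add_linear\<close>)
next
  case (rscale y)
  show ?case
  proof (rule linear_maps_eqI)
    fix z assume "z \<in> car M"
    then show "rscale y (map_add \<phi> \<psi>) z = map_add (rscale y \<phi>) (rscale y \<psi>) z"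
      using rscale by (simp add: op_simps map_add_linear) (simp add: map_add_def op_simps)
  qed (use rscale in \<open>simp_all add: rscale_linear map_add_linear\<close>)
next
  case (mult u w)
  then show ?case by (simp add: compose_def map_add_linear ops_linear)
qed

lemma ops_undefined: "u \<in> ops \<Longrightarrow> \<phi> \<notin> linear_maps \<Longrightarrow> u \<phi> = undefined"
  by (induction rule: ops.induct) (auto simp: lscale_def rscale_def op_add_def compose_def)

lemma ops_eqI:
  assumes "u \<in> ops" "w \<in> ops" "\<And>\<phi> z. \<phi> \<in> linear_maps \<Longrightarrow> z \<in> car M \<Longrightarrow> u \<phi> z = w \<phi> z"
  shows "u = w"
proof
  fix \<phi> show "u \<phi> = w \<phi>"
    using assms ops_undefined linear_maps_eqI ops_linear by (cases "\<phi> \<in> linear_maps") auto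
qed

lemma ops_closed: "u \<in> ops \<Longrightarrow> \<phi> \<in> linear_maps \<Longrightarrow> z \<in> car M \<Longrightarrow> u \<phi> z \<in> car L"
  using ops_linear linear_mapsD(1) by blast

lemma op_add_map_add: "\<phi> \<in> linear_maps \<Longrightarrow> op_add u w \<phi> = map_add (u \<phi>) (w \<phi>)"
  by (simp add: op_add_def map_add_def)

lemma ops_commute_aux:
  assumes "u \<in> ops" "w \<in> ops"
    and gen: "\<And>x \<phi>. x \<in> car L \<Longrightarrow> \<phi> \<in> linear_maps \<Longrightarrow> u (lscale x \<phi>) = lscale x (u \<phi>)"
      "\<And>y \<phi>. y \<in> car M \<Longrightarrow> \<phi> \<in> linear_maps \<Longrightarrow> u (rscale y \<phi>) = rscale y (u \<phi>)"
  shows "\<phi> \<in> linear_maps \<Longrightarrow> u (w \<phi>) = w (u \<phi>)"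
  using assms(2)
proof (induction w arbitrary: \<phi> rule: ops.induct)
  case (add v w)
  then show ?case using assms(1) by (simp add: op_add_map_add ops_additive ops_linear)
next
  case (mult v w)
  then show ?case using assms(1) by (simp add: compose_def ops_linear)
qed (use gen in auto)

text \<open>\<open>ops_commute_aux\<close> is applied three times: to scalings by elements of
  \<open>L\<close>, to scalings by elements of \<open>M\<close>, and then, with these two results as
  its generator cases, to an arbitrary operator.\<close>

lemma ops_commute:
  assumes "u \<in> ops" "w \<in> ops" "\<phi> \<in> linear_maps"
  shows "u (w \<phi>) = w (u \<phi>)"
proof -
  have l: "lscale x (w \<phi>) = w (lscale x \<phi>)" if "x \<in> car L" "w \<in> ops" "\<phi> \<in> linear_maps" for x w \<phi>
  proof (rule ops_commute_aux[OF ops.lscale[OF that(1)] that(2) _ _ that(3)])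
    fix x' \<phi> assume "x' \<in> car L" "\<phi> \<in> linear_maps"
    then show "lscale x (lscale x' \<phi>) = lscale x' (lscale x \<phi>)"
      using that(1) by (intro linear_maps_eqI lscale_linear) (auto simp: op_simps lscale_linear linear_mapsD L.m_lcomm)
  next
    fix y \<phi> assume "y \<in> car M" "\<phi> \<in> linear_maps"
    then show "lscale x (rscale y \<phi>) = rscale y (lscale x \<phi>)"
      using that(1) by (intro linear_maps_eqI lscale_linear rscale_linear) (auto simp: op_simps lscale_linear rscale_linear)
  qed
  have r: "rscale y (w \<phi>) = w (rscale y \<phi>)" if "y \<in> car M" "w \<in> ops" "\<phi> \<in> linear_maps" for y w \<phi>
  proof (rule ops_commute_aux[OF ops.rscale[OF that(1)] that(2) _ _ that(3)])
    fix x \<phi> assume "x \<in> car L" "\<phi> \<in> linear_maps"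
    then show "rscale y (lscale x \<phi>) = lscale x (rscale y \<phi>)"
      using l[OF _ ops.rscale[OF that(1)]] by simp
  next
    fix y' \<phi> assume *: "y' \<in> car M" "\<phi> \<in> linear_maps"
    then show "rscale y (rscale y' \<phi>) = rscale y' (rscale y \<phi>)"
      using that(1) by (intro linear_maps_eqI rscale_linear) (auto simp: op_simps rscale_linear M.m_lcomm)
  qed
  show ?thesis
    by (rule ops_commute_aux[OF assms(1,2) _ _ assms(3)]) (use l r assms(1) in auto)
qed

lemma op_ring_simps:
  "car op_ring = ops" "u \<otimes>\<^bsub>op_ring\<^esub> w = compose linear_maps u w" "u \<oplus>\<^bsub>op_ring\<^esub> w = op_add u w"
  "\<one>\<^bsub>op_ring\<^esub> = lscale \<one>\<^bsub>L\<^esub>" "\<zero>\<^bsub>op_ring\<^esub> = lscale \<zero>\<^bsub>L\<^esub>"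
  by (simp_all add: op_ring_def)

lemma cring_op_ring: "cring op_ring"
proof (rule cringI)
  show "abelian_group op_ring"
  proof (rule abelian_groupI)
    fix u assume "u \<in> car op_ring"
    then have u: "u \<in> ops" by (simp add: op_ring_simps)
    let ?w = "compose linear_maps (lscale (\<ominus>\<^bsub>L\<^esub> \<one>\<^bsub>L\<^esub>)) u"
    have w: "?w \<in> ops" using u by (auto intro!: ops.intros)
    have "op_add ?w u = lscale \<zero>\<^bsub>L\<^esub>"
      by (rule ops_eqI) (use u w in \<open>auto simp: op_simps ops_linear ops_closed L.l_minus L.l_neg linear_mapsD intro!: ops.intros\<close>)
    then show "\<exists>w\<in>car op_ring. w \<oplus>\<^bsub>op_ring\<^esub> u = \<zero>\<^bsub>op_ring\<^esub>" using w by (auto simp: op_ring_simps)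
  qed (auto simp: op_ring_simps op_simps ops_closed linear_mapsD L.a_ac intro!: ops.intros ops_eqI)
  show "comm_monoid op_ring"
  proof (rule comm_monoidI)
    fix u w assume "u \<in> car op_ring" "w \<in> car op_ring"
    then show "u \<otimes>\<^bsub>op_ring\<^esub> w = w \<otimes>\<^bsub>op_ring\<^esub> u"
      by (simp add: op_ring_simps) (rule ops_eqI; simp add: op_simps ops_commute ops.intros)
  qed (auto simp: op_ring_simps op_simps ops_linear ops_closed linear_mapsD intro!: ops.intros ops_eqI)
  fix u v w assume "u \<in> car op_ring" "v \<in> car op_ring" "w \<in> car op_ring"
  then show "(u \<oplus>\<^bsub>op_ring\<^esub> v) \<otimes>\<^bsub>op_ring\<^esub> w = u \<otimes>\<^bsub>op_ring\<^esub> w \<oplus>\<^bsub>op_ring\<^esub> v \<otimes>\<^bsub>op_ring\<^esub> w"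
    by (auto simp: op_ring_simps op_simps ops_linear intro!: ops.intros ops_eqI)
qed

sublocale S: cring op_ring by (rule cring_op_ring)

lemma lscale_hom: "lscale \<in> ring_hom L op_ring"
  by (rule ring_hom_memI)
    (auto simp: op_ring_simps op_simps lscale_linear linear_mapsD L.l_distr L.m_assoc intro!: ops.intros ops_eqI)

lemma rscale_hom: "rscale \<in> ring_hom M op_ring"
  by (rule ring_hom_memI)
    (auto simp: op_ring_simps op_simps rscale_linear linear_mapsD M.l_distr M.m_lcomm M.m_assoc
       intro!: ops.intros ops_eqI)

sublocale l: ring_hom_cring L op_ring lscale
  using lscale_hom by unfold_locales

sublocale r: ring_hom_cring M op_ring rscale
  using rscale_hom by unfold_locales

text \<open>The analogue of \<open>L\<close> and \<open>M\<close> meeting exactly in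
  \<open>k\<close> inside the tensor product. If \<open>y\<close> is a scalar with partner
  \<open>c\<close>, then evaluation at \<open>1\<close> of a functional with value \<open>1\<close>
  there gives \<open>x = c\<close>. Otherwise a functional that kills all scalars but not
  \<open>y\<close> tells the two operators apart.\<close>

lemma lscale_eq_rscale_iff:
  assumes "x \<in> car L" "y \<in> car M"
  shows "lscale x = rscale y \<longleftrightarrow> (x, y) \<in> k"
proof
  assume "(x, y) \<in> k"
  then show "lscale x = rscale y"
    using assms by (intro ops_eqI) (simp_all add: op_simps linear_mapsD(4) ops.intros)
next
  assume eq: "lscale x = rscale y"
  then have eq': "x \<otimes>\<^bsub>L\<^esub> \<phi> z = \<phi> (y \<otimes>\<^bsub>M\<^esub> z)" if "\<phi> \<in> linear_maps" "z \<in> car M" for \<phi> z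
  proof -
    have "lscale x \<phi> z = rscale y \<phi> z" using eq by simp
    then show ?thesis using that by (simp add: op_simps)
  qed
  show "(x, y) \<in> k"
  proof (cases "\<exists>c. (c, y) \<in> k")
    case True
    then obtain c where c: "(c, y) \<in> k" by blast
    have "subspace {\<zero>\<^bsub>M\<^esub>}" by (auto simp: subspace_def)
    then obtain \<phi> where \<phi>: "\<phi> \<in> linear_maps" "\<phi> \<one>\<^bsub>M\<^esub> = \<one>\<^bsub>L\<^esub>"
      using separating_functional[of "{\<zero>\<^bsub>M\<^esub>}" "\<one>\<^bsub>M\<^esub>"] by auto
    then have "x = c" using eq'[of \<phi> "\<one>\<^bsub>M\<^esub>"] linear_mapsD(4)[OF \<phi>(1) c M.one_closed] assms c by simp
    then show ?thesis using c by simp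
  next
    case False
    have "subspace (snd ` k)"
      unfolding subspace_def
    proof (intro conjI ballI, goal_cases)
      case 2
      then show ?case using k_zero by force
    next
      case (3 x y)
      then show ?case using k_add by force
    next
      case (4 cd)
      then show ?case using k_mult by (cases cd) force
    qed auto
    moreover have "y \<notin> snd ` k" using False by force
    ultimately obtain \<phi> where \<phi>: "\<phi> \<in> linear_maps" "\<And>w. w \<in> snd ` k \<Longrightarrow> \<phi> w = \<zero>\<^bsub>L\<^esub>" "\<phi> y = \<one>\<^bsub>L\<^esub>"
      using separating_functional assms(2) by blast
    have "\<phi> \<one>\<^bsub>M\<^esub> = \<zero>\<^bsub>L\<^esub>" using \<phi>(2) k_one by force
    then show ?thesis using eq'[OF \<phi>(1) M.one_closed] \<phi>(3) assms by simp
  qed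
qed

end

section \<open>A non-nilpotent difference\<close>

lemma (in ring_hom_cring) hom_add_pow: "x \<in> car R \<Longrightarrow> h ([(n::nat)] \<cdot>\<^bsub>R\<^esub> x) = [n] \<cdot>\<^bsub>S\<^esub> h x"
  by (induction n) auto

lemma (in ring_hom_cring) hom_of_nat: "h ([(n::nat)] \<cdot>\<^bsub>R\<^esub> \<one>\<^bsub>R\<^esub>) = [n] \<cdot>\<^bsub>S\<^esub> \<one>\<^bsub>S\<^esub>"
  by (induction n) auto

lemma (in ring_hom_cring) hom_pow: "x \<in> car R \<Longrightarrow> h (x [^]\<^bsub>R\<^esub> (n::nat)) = h x [^]\<^bsub>S\<^esub> n"
  by (induction n) auto

context field_pair
begin

section \<open>Characteristic p\<close>

definition has_roots :: "nat \<Rightarrow> bool" where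
  "has_roots p \<longleftrightarrow> (\<forall>(c, d)\<in>k. \<exists>(c', d')\<in>k. c' [^]\<^bsub>L\<^esub> p = c \<and> d' [^]\<^bsub>M\<^esub> p = d)"

lemma has_roots_iterated:
  assumes "has_roots p" "(c, d) \<in> k"
  shows "\<exists>(c', d')\<in>k. c' [^]\<^bsub>L\<^esub> (p ^ m) = c \<and> d' [^]\<^bsub>M\<^esub> (p ^ m) = d"
  using assms(2)
proof (induction m arbitrary: c d)
  case 0
  then show ?case by force
next
  case (Suc m)
  obtain c1 d1 where 1: "(c1, d1) \<in> k" "c1 [^]\<^bsub>L\<^esub> p = c" "d1 [^]\<^bsub>M\<^esub> p = d"
    using bspec[OF assms(1)[unfolded has_roots_def] Suc.prems] by auto
  obtain c2 d2 where "(c2, d2) \<in> k" "c2 [^]\<^bsub>L\<^esub> (p ^ m) = c1" "d2 [^]\<^bsub>M\<^esub> (p ^ m) = d1"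
    using Suc.IH[OF 1(1)] by auto
  moreover have "c2 [^]\<^bsub>L\<^esub> (p ^ Suc m) = (c2 [^]\<^bsub>L\<^esub> (p ^ m)) [^]\<^bsub>L\<^esub> p"
    "d2 [^]\<^bsub>M\<^esub> (p ^ Suc m) = (d2 [^]\<^bsub>M\<^esub> (p ^ m)) [^]\<^bsub>M\<^esub> p"
    using calculation(1) by (simp_all add: L.nat_pow_pow M.nat_pow_pow mult.commute)
  ultimately have "c2 [^]\<^bsub>L\<^esub> (p ^ Suc m) = c" "d2 [^]\<^bsub>M\<^esub> (p ^ Suc m) = d" "(c2, d2) \<in> k"
    using 1 by simp_all
  then show ?case by blast
qed

text \<open>With \<open>q = p ^ n\<close>, Frobenius turns the \<open>q\<close>-th power of the
  difference into \<open>x^q - y^q\<close>, so \<open>(x^q, y^q)\<close> lies in \<open>k\<close>.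
  As \<open>k\<close> is perfect, this pair has a \<open>q\<close>-th root in \<open>k\<close>, and
  uniqueness of roots in \<open>L\<close> and \<open>M\<close> identifies that root with
  \<open>(x, y)\<close>.\<close>

lemma nilpotent_difference_char_p:
  assumes p: "prime p" "[(p::nat)] \<cdot>\<^bsub>L\<^esub> \<one>\<^bsub>L\<^esub> = \<zero>\<^bsub>L\<^esub>" and roots: "has_roots p"
    and [simp]: "x \<in> car L" "y \<in> car M"
    and nil: "(lscale x \<ominus>\<^bsub>op_ring\<^esub> rscale y) [^]\<^bsub>op_ring\<^esub> (n::nat) = \<zero>\<^bsub>op_ring\<^esub>"
  shows "(x, y) \<in> k"
proof -
  have pM: "[p] \<cdot>\<^bsub>M\<^esub> \<one>\<^bsub>M\<^esub> = \<zero>\<^bsub>M\<^esub>" using k_zero_iff[OF k_of_nat] p by blast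
  have pS: "[p] \<cdot>\<^bsub>op_ring\<^esub> \<one>\<^bsub>op_ring\<^esub> = \<zero>\<^bsub>op_ring\<^esub>"
    using p l.hom_of_nat[of p] by simp
  let ?t = "lscale x \<ominus>\<^bsub>op_ring\<^esub> rscale y" and ?q = "p ^ n"
  have [simp]: "lscale x \<in> car op_ring" "rscale y \<in> car op_ring" by auto
  \<comment> \<open>The power of \<open>p\<close> has to reach the exponent \<open>n\<close> at
    which the difference vanishes; \<open>p ^ n\<close> does.\<close>
  have "n < ?q" using prime_gt_1_nat[OF p(1)] by (intro power_gt_expt) simp
  then have "?t [^]\<^bsub>op_ring\<^esub> ?q = ?t [^]\<^bsub>op_ring\<^esub> n \<otimes>\<^bsub>op_ring\<^esub> ?t [^]\<^bsub>op_ring\<^esub> (?q - n)"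
    by (simp add: S.nat_pow_mult)
  then have "?t [^]\<^bsub>op_ring\<^esub> ?q = \<zero>\<^bsub>op_ring\<^esub>" using nil by simp
  moreover have "?t [^]\<^bsub>op_ring\<^esub> ?q = lscale x [^]\<^bsub>op_ring\<^esub> ?q \<ominus>\<^bsub>op_ring\<^esub> rscale y [^]\<^bsub>op_ring\<^esub> ?q"
    unfolding a_minus_def
    by (subst S.freshmans_dream_iterated[OF p(1) pS]) (auto simp: S.neg_pow_prime[OF p(1) pS])
  ultimately have "lscale (x [^]\<^bsub>L\<^esub> ?q) = rscale (y [^]\<^bsub>M\<^esub> ?q)"
    by (simp add: l.hom_pow r.hom_pow)
  then have "(x [^]\<^bsub>L\<^esub> ?q, y [^]\<^bsub>M\<^esub> ?q) \<in> k" by (subst (asm) lscale_eq_rscale_iff) auto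
  then obtain c d where cd: "(c, d) \<in> k" "c [^]\<^bsub>L\<^esub> ?q = x [^]\<^bsub>L\<^esub> ?q" "d [^]\<^bsub>M\<^esub> ?q = y [^]\<^bsub>M\<^esub> ?q"
    using has_roots_iterated[OF roots] by blast
  have "c = x" by (rule L.root_unique[OF p _ _ cd(2)]) (use cd in auto)
  moreover have "d = y" by (rule M.root_unique[OF p(1) pM _ _ cd(3)]) (use cd in auto)
  ultimately show ?thesis using cd by simp
qed

section \<open>Characteristic 0: algebraic dependence and derivations\<close>

lemma minus_apply:
  assumes "x \<in> car L" "y \<in> car M" "\<phi> \<in> linear_maps" "z \<in> car M"
  shows "(lscale x \<ominus>\<^bsub>op_ring\<^esub> rscale y) \<phi> z = x \<otimes>\<^bsub>L\<^esub> \<phi> z \<ominus>\<^bsub>L\<^esub> \<phi> (y \<otimes>\<^bsub>M\<^esub> z)"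
proof -
  have "lscale x \<ominus>\<^bsub>op_ring\<^esub> rscale y = op_add (lscale x) (rscale (\<ominus>\<^bsub>M\<^esub> y))"
    using assms by (simp add: a_minus_def flip: op_ring_simps)
  then have "(lscale x \<ominus>\<^bsub>op_ring\<^esub> rscale y) \<phi> z = x \<otimes>\<^bsub>L\<^esub> \<phi> z \<oplus>\<^bsub>L\<^esub> \<phi> ((\<ominus>\<^bsub>M\<^esub> y) \<otimes>\<^bsub>M\<^esub> z)"
    using assms by (simp only: op_simps)
  then show ?thesis
    using assms by (simp add: M.l_minus linear_maps_neg a_minus_def)
qed

lemma one_apply: "\<phi> \<in> linear_maps \<Longrightarrow> z \<in> car M \<Longrightarrow> \<one>\<^bsub>op_ring\<^esub> \<phi> z = \<phi> z"
  unfolding op_ring_simps by (simp only: op_simps linear_mapsD(1) L.l_one)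

lemma zero_apply: "\<phi> \<in> linear_maps \<Longrightarrow> z \<in> car M \<Longrightarrow> \<zero>\<^bsub>op_ring\<^esub> \<phi> z = \<zero>\<^bsub>L\<^esub>"
  unfolding op_ring_simps by (simp only: op_simps linear_mapsD(1) L.l_null)

lemma pow_Suc_apply:
  assumes "u \<in> ops" "\<phi> \<in> linear_maps"
  shows "(u [^]\<^bsub>op_ring\<^esub> Suc n) \<phi> = u ((u [^]\<^bsub>op_ring\<^esub> n) \<phi>)"
proof -
  have u: "u \<in> car op_ring" using assms by (simp add: op_ring_simps)
  have "u [^]\<^bsub>op_ring\<^esub> Suc n = u \<otimes>\<^bsub>op_ring\<^esub> u [^]\<^bsub>op_ring\<^esub> n"
    using u by (rule S.nat_pow_Suc2)
  then show ?thesis using assms(2) by (simp only: op_ring_simps op_simps)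
qed

text \<open>The \<open>k\<close>-span of \<open>1, y, ..., y^(j-1)\<close>. Membership of
  \<open>y^n\<close> in \<open>power_span y n\<close> says that \<open>y\<close> is a root of a
  monic polynomial of degree \<open>n\<close> over \<open>k\<close>.\<close>

fun power_span :: "'m \<Rightarrow> nat \<Rightarrow> 'm set" where
  "power_span y 0 = {\<zero>\<^bsub>M\<^esub>}"
| "power_span y (Suc j) = {w \<oplus>\<^bsub>M\<^esub> d \<otimes>\<^bsub>M\<^esub> y [^]\<^bsub>M\<^esub> j | w c d. w \<in> power_span y j \<and> (c, d) \<in> k}"

lemma subspace_power_span: "y \<in> car M \<Longrightarrow> subspace (power_span y j)"
proof (induction j)
  case 0
  then show ?case by (auto simp: subspace_def)
next
  case (Suc j)
  then show ?case by (simp add: subspace_sum)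
qed

lemma power_span_mono: "y \<in> car M \<Longrightarrow> power_span y j \<subseteq> power_span y (Suc j)"
proof
  fix w assume "y \<in> car M" "w \<in> power_span y j"
  then have "w = w \<oplus>\<^bsub>M\<^esub> \<zero>\<^bsub>M\<^esub> \<otimes>\<^bsub>M\<^esub> y [^]\<^bsub>M\<^esub> j"
    using subspaceD(1)[OF subspace_power_span] by simp
  then show "w \<in> power_span y (Suc j)" using k_zero \<open>w \<in> power_span y j\<close> unfolding power_span.simps by blast
qed

lemma power_in_power_span: "y \<in> car M \<Longrightarrow> i < j \<Longrightarrow> y [^]\<^bsub>M\<^esub> i \<in> power_span y j"
proof (induction j)
  case (Suc j)
  show ?case
  proof (cases "i = j")
    case True
    have "y [^]\<^bsub>M\<^esub> i = \<zero>\<^bsub>M\<^esub> \<oplus>\<^bsub>M\<^esub> \<one>\<^bsub>M\<^esub> \<otimes>\<^bsub>M\<^esub> y [^]\<^bsub>M\<^esub> j" using True Suc.prems by simp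
    then show ?thesis
      using k_one subspaceD(2)[OF subspace_power_span[OF Suc.prems(1)]] unfolding power_span.simps by blast
  next
    case False
    then show ?thesis using Suc power_span_mono by (meson less_SucE subsetD)
  qed
qed simp

text \<open>If \<open>y^n\<close> is not in the span of the lower powers, some \<open>\<phi>\<close>
  vanishes on these and is \<open>1\<close> at \<open>y^n\<close>. Since \<open>t\<close> turns
  \<open>\<theta>\<close> into the map \<open>z \<mapsto> x \<theta>(z) - \<theta>(y z)\<close>,
  each application moves the first nonzero value along \<open>1, y, y^2, ...\<close> one place down.
  After \<open>n\<close> applications it sits at \<open>1\<close>, against
  \<open>t^n = 0\<close>.\<close>

lemma nilpotent_difference_algebraic:
  assumes x: "x \<in> car L" and y: "y \<in> car M"
    and nil: "(lscale x \<ominus>\<^bsub>op_ring\<^esub> rscale y) [^]\<^bsub>op_ring\<^esub> (n::nat) = \<zero>\<^bsub>op_ring\<^esub>"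
  shows "y [^]\<^bsub>M\<^esub> n \<in> power_span y n"
proof (rule ccontr)
  assume "\<not> ?thesis"
  then obtain \<phi> where \<phi>: "\<phi> \<in> linear_maps" "\<And>w. w \<in> power_span y n \<Longrightarrow> \<phi> w = \<zero>\<^bsub>L\<^esub>"
      "\<phi> (y [^]\<^bsub>M\<^esub> n) = \<one>\<^bsub>L\<^esub>"
    using separating_functional[OF subspace_power_span[OF y] M.nat_pow_closed[OF y]] by blast
  let ?t = "lscale x \<ominus>\<^bsub>op_ring\<^esub> rscale y"
  have tS: "?t \<in> car op_ring" using x y by simp
  then have t: "?t \<in> ops" by (simp only: op_ring_simps)
  have "(\<forall>i<n - j. (?t [^]\<^bsub>op_ring\<^esub> j) \<phi> (y [^]\<^bsub>M\<^esub> i) = \<zero>\<^bsub>L\<^esub>) \<and>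
      (?t [^]\<^bsub>op_ring\<^esub> j) \<phi> (y [^]\<^bsub>M\<^esub> (n - j)) \<noteq> \<zero>\<^bsub>L\<^esub>" if "j \<le> n" for j
    using that
  proof (induction j)
    case 0
    have "(?t [^]\<^bsub>op_ring\<^esub> (0::nat)) \<phi> z = \<phi> z" if "z \<in> car M" for z
      using \<phi>(1) that by (simp add: one_apply)
    then show ?case
      using \<phi> y power_in_power_span[OF y] by simp
  next
    case (Suc j)
    let ?\<theta> = "(?t [^]\<^bsub>op_ring\<^esub> j) \<phi>"
    have \<theta>: "?\<theta> \<in> linear_maps"
      using S.nat_pow_closed[OF tS, of j] \<phi>(1) by (simp only: op_ring_simps ops_linear)
    have *: "(?t [^]\<^bsub>op_ring\<^esub> Suc j) \<phi> (y [^]\<^bsub>M\<^esub> i) = x \<otimes>\<^bsub>L\<^esub> ?\<theta> (y [^]\<^bsub>M\<^esub> i) \<ominus>\<^bsub>L\<^esub> ?\<theta> (y [^]\<^bsub>M\<^esub> Suc i)" for i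
      unfolding pow_Suc_apply[OF t \<phi>(1)]
      using minus_apply[OF x y \<theta>] y by (simp add: M.m_comm)
    have IH: "?\<theta> (y [^]\<^bsub>M\<^esub> i) = \<zero>\<^bsub>L\<^esub>" if "i < n - j" for i
      using Suc that by simp
    have IH': "?\<theta> (y [^]\<^bsub>M\<^esub> Suc (n - Suc j)) \<noteq> \<zero>\<^bsub>L\<^esub>"
      using Suc by (simp add: Suc_diff_Suc del: M.nat_pow_Suc)
    have c: "?\<theta> (y [^]\<^bsub>M\<^esub> i) \<in> car L" for i :: nat by (rule linear_mapsD(1)[OF \<theta> M.nat_pow_closed[OF y]])
    show ?case unfolding *
    proof (intro conjI allI impI)
      fix i assume "i < n - Suc j"
      then have "i < n - j" "Suc i < n - j" by auto
      then show "x \<otimes>\<^bsub>L\<^esub> ?\<theta> (y [^]\<^bsub>M\<^esub> i) \<ominus>\<^bsub>L\<^esub> ?\<theta> (y [^]\<^bsub>M\<^esub> Suc i) = \<zero>\<^bsub>L\<^esub>"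
        using x by (simp only: IH L.r_null L.minus_eq L.minus_zero L.l_zero L.zero_closed)
    next
      have "n - Suc j < n - j" using Suc.prems by simp
      then have "?\<theta> (y [^]\<^bsub>M\<^esub> (n - Suc j)) = \<zero>\<^bsub>L\<^esub>" by (rule IH)
      then show "x \<otimes>\<^bsub>L\<^esub> ?\<theta> (y [^]\<^bsub>M\<^esub> (n - Suc j)) \<ominus>\<^bsub>L\<^esub> ?\<theta> (y [^]\<^bsub>M\<^esub> Suc (n - Suc j)) \<noteq> \<zero>\<^bsub>L\<^esub>"
        using IH' c[of "Suc (n - Suc j)"] x
        by (simp only: L.r_null L.minus_eq L.l_zero L.a_inv_closed L.add.inv_eq_1_iff) blast
    qed
  qed
  from this[of n] have "(?t [^]\<^bsub>op_ring\<^esub> n) \<phi> \<one>\<^bsub>M\<^esub> \<noteq> \<zero>\<^bsub>L\<^esub>" by simp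
  then show False unfolding nil using \<phi>(1) by (simp add: zero_apply)
qed

text \<open>The relation between \<open>w\<close> and \<open>w'\<close> is a derivation along \<open>w \<mapsto> x\<close>, which vanishes on the
  scalars; \<open>w'\<close> stays inside the argument of \<open>\<psi>\<close> so that no derivation has to be constructed.\<close>

definition twisted_leibniz :: "('m \<Rightarrow> 'l) \<Rightarrow> ('m \<Rightarrow> 'l) \<Rightarrow> 'm \<Rightarrow> 'l \<Rightarrow> 'm \<Rightarrow> bool" where
  "twisted_leibniz \<psi> \<chi> w x w' \<longleftrightarrow> x \<in> car L \<and> w' \<in> car M \<and>
     (\<forall>z\<in>car M. \<psi> (w \<otimes>\<^bsub>M\<^esub> z) = x \<otimes>\<^bsub>L\<^esub> \<psi> z \<and>
       \<chi> (w \<otimes>\<^bsub>M\<^esub> z) = x \<otimes>\<^bsub>L\<^esub> \<chi> z \<oplus>\<^bsub>L\<^esub> \<psi> (w' \<otimes>\<^bsub>M\<^esub> z))"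

lemma twisted_leibniz_add:
  assumes [simp]: "\<psi> \<in> linear_maps" "\<chi> \<in> linear_maps" "v \<in> car M" "w \<in> car M"
    and v: "twisted_leibniz \<psi> \<chi> v x v'" and w: "twisted_leibniz \<psi> \<chi> w y w'"
  shows "twisted_leibniz \<psi> \<chi> (v \<oplus>\<^bsub>M\<^esub> w) (x \<oplus>\<^bsub>L\<^esub> y) (v' \<oplus>\<^bsub>M\<^esub> w')"
proof -
  have [simp]: "x \<in> car L" "y \<in> car L" "v' \<in> car M" "w' \<in> car M"
    using v w by (auto simp: twisted_leibniz_def)
  show ?thesis
    using v w by (simp add: twisted_leibniz_def M.l_distr L.l_distr linear_mapsD L.a_ac)
qed

lemma twisted_leibniz_scale:
  assumes [simp]: "\<psi> \<in> linear_maps" "\<chi> \<in> linear_maps" "w \<in> car M"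
    and cd: "(c, d) \<in> k" and w: "twisted_leibniz \<psi> \<chi> w y w'"
  shows "twisted_leibniz \<psi> \<chi> (d \<otimes>\<^bsub>M\<^esub> w) (c \<otimes>\<^bsub>L\<^esub> y) (d \<otimes>\<^bsub>M\<^esub> w')"
proof -
  have [simp]: "c \<in> car L" "d \<in> car M" "y \<in> car L" "w' \<in> car M"
    using w cd by (auto simp: twisted_leibniz_def)
  have "\<psi> (d \<otimes>\<^bsub>M\<^esub> x) = c \<otimes>\<^bsub>L\<^esub> \<psi> x" "\<chi> (d \<otimes>\<^bsub>M\<^esub> x) = c \<otimes>\<^bsub>L\<^esub> \<chi> x" if "x \<in> car M" for x
    using linear_mapsD(4)[OF _ cd that] by simp_all
  then show ?thesis
    using w by (simp add: twisted_leibniz_def M.m_assoc L.m_assoc L.r_distr linear_mapsD(1))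
qed

text \<open>A nonzero \<open>v - w\<close> is invertible in \<open>M\<close>, so \<open>z0\<close>
  is a multiple of it and \<open>\<psi>\<close> would vanish at \<open>z0\<close>. This is what
  makes the derivative \<open>w'\<close> in \<open>twisted_leibniz\<close> unique.\<close>

lemma nonzero_functional_injective:
  assumes \<psi>: "\<psi> \<in> linear_maps" "z0 \<in> car M" "\<psi> z0 \<noteq> \<zero>\<^bsub>L\<^esub>" and w: "v \<in> car M" "w \<in> car M"
    and eq: "\<And>z. z \<in> car M \<Longrightarrow> \<psi> (v \<otimes>\<^bsub>M\<^esub> z) = \<psi> (w \<otimes>\<^bsub>M\<^esub> z)"
  shows "v = w"
proof (rule ccontr)
  assume "v \<noteq> w"
  define u where "u = v \<ominus>\<^bsub>M\<^esub> w"
  have u: "u \<in> Units M" using w \<open>v \<noteq> w\<close> by (auto simp: u_def M.field_Units)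
  define z where "z = inv\<^bsub>M\<^esub> u \<otimes>\<^bsub>M\<^esub> z0"
  have [simp]: "z \<in> car M" using u \<psi> by (simp add: z_def)
  have "u \<otimes>\<^bsub>M\<^esub> z = z0"
    using \<psi>(2) M.Units_closed[OF u] M.Units_inv_closed[OF u] M.Units_r_inv[OF u]
    by (simp add: z_def flip: M.m_assoc)
  moreover have "u \<otimes>\<^bsub>M\<^esub> z = v \<otimes>\<^bsub>M\<^esub> z \<oplus>\<^bsub>M\<^esub> \<ominus>\<^bsub>M\<^esub> (w \<otimes>\<^bsub>M\<^esub> z)"
    using w by (simp add: u_def a_minus_def M.l_distr M.l_minus)
  ultimately have "z0 = v \<otimes>\<^bsub>M\<^esub> z \<oplus>\<^bsub>M\<^esub> \<ominus>\<^bsub>M\<^esub> (w \<otimes>\<^bsub>M\<^esub> z)" by simp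
  also have "\<psi> \<dots> = \<psi> (v \<otimes>\<^bsub>M\<^esub> z) \<oplus>\<^bsub>L\<^esub> \<ominus>\<^bsub>L\<^esub> \<psi> (w \<otimes>\<^bsub>M\<^esub> z)"
    using w by (simp add: linear_mapsD(3)[OF \<psi>(1)] linear_maps_neg[OF \<psi>(1)])
  finally have "\<psi> z0 = \<psi> (v \<otimes>\<^bsub>M\<^esub> z) \<oplus>\<^bsub>L\<^esub> \<ominus>\<^bsub>L\<^esub> \<psi> (w \<otimes>\<^bsub>M\<^esub> z)" .
  then show False
    using eq[of z] \<psi> w by (simp add: L.r_neg linear_mapsD(1)[OF \<psi>(1)])
qed

text \<open>Apply the derivation to a relation expressing \<open>y^(j+1)\<close> by lower powers.
  The left side yields \<open>-(j+1) y^j\<close>, the right side only powers below \<open>j\<close>.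
  Dividing by \<open>j+1\<close>, as characteristic 0 permits, gives a relation one degree
  lower.\<close>

lemma derivation_imp_not_algebraic:
  assumes char0: "\<And>n::nat. n > 0 \<Longrightarrow> [n] \<cdot>\<^bsub>M\<^esub> \<one>\<^bsub>M\<^esub> \<noteq> \<zero>\<^bsub>M\<^esub>"
    and x [simp]: "x \<in> car L" and y [simp]: "y \<in> car M"
    and \<psi>: "\<psi> \<in> linear_maps" "z0 \<in> car M" "\<psi> z0 \<noteq> \<zero>\<^bsub>L\<^esub>" and \<chi>: "\<chi> \<in> linear_maps"
    and leib: "twisted_leibniz \<psi> \<chi> y x (\<ominus>\<^bsub>M\<^esub> \<one>\<^bsub>M\<^esub>)"
  shows "y [^]\<^bsub>M\<^esub> (j::nat) \<notin> power_span y j"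
proof (induction j)
  case 0
  then show ?case by simp
next
  case (Suc j)
  \<comment> \<open>The derivative of \<open>y^j\<close> when that of \<open>y\<close> is
    \<open>-1\<close>. At \<open>j = 0\<close> the exponent is truncated, but there the coefficient
    is zero.\<close>
  let ?\<delta> = "\<lambda>j::nat. \<ominus>\<^bsub>M\<^esub> ([j] \<cdot>\<^bsub>M\<^esub> \<one>\<^bsub>M\<^esub> \<otimes>\<^bsub>M\<^esub> y [^]\<^bsub>M\<^esub> (j - 1))"
  have pow: "twisted_leibniz \<psi> \<chi> (y [^]\<^bsub>M\<^esub> i) (x [^]\<^bsub>L\<^esub> i) (?\<delta> i)" for i :: nat
  proof (induction i)
    case 0
    then show ?case using \<psi>(1) \<chi> by (simp add: twisted_leibniz_def linear_mapsD(1) linear_maps_zero)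
  next
    case (Suc i)
    have "twisted_leibniz \<psi> \<chi> (y [^]\<^bsub>M\<^esub> i \<otimes>\<^bsub>M\<^esub> y) (x [^]\<^bsub>L\<^esub> i \<otimes>\<^bsub>L\<^esub> x)
        (?\<delta> i \<otimes>\<^bsub>M\<^esub> y \<ominus>\<^bsub>M\<^esub> y [^]\<^bsub>M\<^esub> i)"
      unfolding twisted_leibniz_def
    proof (intro conjI ballI)
      fix z assume z [simp]: "z \<in> car M"
      have A: "\<psi> (y [^]\<^bsub>M\<^esub> i \<otimes>\<^bsub>M\<^esub> w) = x [^]\<^bsub>L\<^esub> i \<otimes>\<^bsub>L\<^esub> \<psi> w"
        "\<chi> (y [^]\<^bsub>M\<^esub> i \<otimes>\<^bsub>M\<^esub> w) = x [^]\<^bsub>L\<^esub> i \<otimes>\<^bsub>L\<^esub> \<chi> w \<oplus>\<^bsub>L\<^esub> \<psi> (?\<delta> i \<otimes>\<^bsub>M\<^esub> w)" if "w \<in> car M" for w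
        using Suc that unfolding twisted_leibniz_def by blast+
      have B: "\<psi> (y \<otimes>\<^bsub>M\<^esub> z) = x \<otimes>\<^bsub>L\<^esub> \<psi> z"
        "\<chi> (y \<otimes>\<^bsub>M\<^esub> z) = x \<otimes>\<^bsub>L\<^esub> \<chi> z \<oplus>\<^bsub>L\<^esub> \<ominus>\<^bsub>L\<^esub> \<psi> z"
        using leib \<psi>(1) by (simp_all add: twisted_leibniz_def M.l_minus linear_maps_neg)
      have [simp]: "\<psi> w \<in> car L" "\<chi> w \<in> car L" if "w \<in> car M" for w
        using linear_mapsD(1) \<psi>(1) \<chi> that by blast+
      show "\<psi> (y [^]\<^bsub>M\<^esub> i \<otimes>\<^bsub>M\<^esub> y \<otimes>\<^bsub>M\<^esub> z) = x [^]\<^bsub>L\<^esub> i \<otimes>\<^bsub>L\<^esub> x \<otimes>\<^bsub>L\<^esub> \<psi> z"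
        by (simp add: M.m_assoc A B L.m_assoc)
      have "\<chi> (y [^]\<^bsub>M\<^esub> i \<otimes>\<^bsub>M\<^esub> y \<otimes>\<^bsub>M\<^esub> z) =
          x [^]\<^bsub>L\<^esub> i \<otimes>\<^bsub>L\<^esub> x \<otimes>\<^bsub>L\<^esub> \<chi> z \<oplus>\<^bsub>L\<^esub> (\<psi> (?\<delta> i \<otimes>\<^bsub>M\<^esub> (y \<otimes>\<^bsub>M\<^esub> z)) \<oplus>\<^bsub>L\<^esub> \<ominus>\<^bsub>L\<^esub> (x [^]\<^bsub>L\<^esub> i \<otimes>\<^bsub>L\<^esub> \<psi> z))"
        by (simp add: M.m_assoc A B L.m_assoc L.r_distr L.r_minus L.a_ac)
      also have "\<ominus>\<^bsub>L\<^esub> (x [^]\<^bsub>L\<^esub> i \<otimes>\<^bsub>L\<^esub> \<psi> z) = \<psi> (\<ominus>\<^bsub>M\<^esub> (y [^]\<^bsub>M\<^esub> i) \<otimes>\<^bsub>M\<^esub> z)"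
        using \<psi>(1) by (simp add: A M.l_minus linear_maps_neg)
      also have "\<psi> (?\<delta> i \<otimes>\<^bsub>M\<^esub> (y \<otimes>\<^bsub>M\<^esub> z)) \<oplus>\<^bsub>L\<^esub> \<psi> (\<ominus>\<^bsub>M\<^esub> (y [^]\<^bsub>M\<^esub> i) \<otimes>\<^bsub>M\<^esub> z) =
          \<psi> ((?\<delta> i \<otimes>\<^bsub>M\<^esub> y \<ominus>\<^bsub>M\<^esub> y [^]\<^bsub>M\<^esub> i) \<otimes>\<^bsub>M\<^esub> z)"
        by (simp add: a_minus_def M.l_distr M.m_assoc flip: linear_mapsD(3)[OF \<psi>(1)])
      finally show "\<chi> (y [^]\<^bsub>M\<^esub> i \<otimes>\<^bsub>M\<^esub> y \<otimes>\<^bsub>M\<^esub> z) = x [^]\<^bsub>L\<^esub> i \<otimes>\<^bsub>L\<^esub> x \<otimes>\<^bsub>L\<^esub> \<chi> z \<oplus>\<^bsub>L\<^esub>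
          \<psi> ((?\<delta> i \<otimes>\<^bsub>M\<^esub> y \<ominus>\<^bsub>M\<^esub> y [^]\<^bsub>M\<^esub> i) \<otimes>\<^bsub>M\<^esub> z)" .
    qed simp_all
    moreover have "?\<delta> i \<otimes>\<^bsub>M\<^esub> y \<ominus>\<^bsub>M\<^esub> y [^]\<^bsub>M\<^esub> i = ?\<delta> (Suc i)"
    proof (cases i)
      case 0
      then show ?thesis by (simp add: a_minus_def)
    next
      case (Suc i')
      then show ?thesis
        by (simp add: a_minus_def M.l_distr M.m_assoc M.l_minus M.minus_add M.a_ac)
    qed
    ultimately show ?case by simp
  qed
  \<comment> \<open>The derivative lowers the degree of a combination of powers by one; at
    \<open>i = 0\<close> both spans are zero, so truncated subtraction is harmless.\<close>
  have span: "\<exists>u w'. w' \<in> power_span y (i - 1) \<and> twisted_leibniz \<psi> \<chi> w u w'" if "w \<in> power_span y i" for i w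
    using that
  proof (induction i arbitrary: w)
    case 0
    then have "twisted_leibniz \<psi> \<chi> w \<zero>\<^bsub>L\<^esub> \<zero>\<^bsub>M\<^esub>"
      using \<psi>(1) \<chi> by (simp add: twisted_leibniz_def linear_mapsD(1) linear_maps_zero)
    then show ?case by auto
  next
    case (Suc i)
    note sub = subspace_power_span[OF y]
    obtain w1 c d where w1: "w1 \<in> power_span y i" "(c, d) \<in> k" "w = w1 \<oplus>\<^bsub>M\<^esub> d \<otimes>\<^bsub>M\<^esub> y [^]\<^bsub>M\<^esub> i"
      using Suc.prems unfolding power_span.simps by blast
    obtain u w' where w': "w' \<in> power_span y (i - 1)" "twisted_leibniz \<psi> \<chi> w1 u w'"
      using Suc.IH[OF w1(1)] by blast
    have "twisted_leibniz \<psi> \<chi> w (u \<oplus>\<^bsub>L\<^esub> c \<otimes>\<^bsub>L\<^esub> x [^]\<^bsub>L\<^esub> i) (w' \<oplus>\<^bsub>M\<^esub> d \<otimes>\<^bsub>M\<^esub> ?\<delta> i)"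
      unfolding w1(3)
      by (intro twisted_leibniz_add twisted_leibniz_scale pow w' w1 \<psi> \<chi> M.m_closed M.nat_pow_closed y)
        (use w1 subspaceD(1)[OF sub] in auto)
    moreover have "w' \<oplus>\<^bsub>M\<^esub> d \<otimes>\<^bsub>M\<^esub> ?\<delta> i \<in> power_span y i"
    proof (rule subspaceD(3)[OF sub])
      show "w' \<in> power_span y i" using w'(1) power_span_mono[OF y, of "i - 1"] by (cases i) auto
      have "?\<delta> i \<in> power_span y i"
      proof (cases i)
        case 0
        then show ?thesis by simp
      next
        case (Suc i')
        then have "y [^]\<^bsub>M\<^esub> (i - 1) \<in> power_span y i" by (intro power_in_power_span[OF y]) simp
        then show ?thesis by (intro subspace_neg[OF sub] subspaceD(4)[OF sub k_of_nat])
      qed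
      then show "d \<otimes>\<^bsub>M\<^esub> ?\<delta> i \<in> power_span y i" by (rule subspaceD(4)[OF sub w1(2)])
    qed
    ultimately show ?case by auto
  qed
  show ?case
  proof
    assume "y [^]\<^bsub>M\<^esub> Suc j \<in> power_span y (Suc j)"
    from span[OF this] obtain u w' where w': "w' \<in> power_span y j"
      and tw: "twisted_leibniz \<psi> \<chi> (y [^]\<^bsub>M\<^esub> Suc j) u w'" by auto
    note sub = subspace_power_span[OF y]
    have [simp]: "w' \<in> car M" "u \<in> car L" using tw by (auto simp: twisted_leibniz_def)
    have [simp]: "\<psi> w \<in> car L" "\<chi> w \<in> car L" if "w \<in> car M" for w
      using linear_mapsD(1) \<psi>(1) \<chi> that by blast+
    note tw' = pow[of "Suc j"]
    \<comment> \<open>Two relations for \<open>y^(j+1)\<close> are now at hand, one from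
      \<open>span\<close> and one from \<open>pow\<close>. Cancelling \<open>\<psi> z0\<close> shows
      that their coefficients in \<open>L\<close> agree, after which the derivatives agree as
      well.\<close>
    have "u \<otimes>\<^bsub>L\<^esub> \<psi> z0 = x [^]\<^bsub>L\<^esub> Suc j \<otimes>\<^bsub>L\<^esub> \<psi> z0"
      using tw tw' \<psi>(2) unfolding twisted_leibniz_def by metis
    then have u: "u = x [^]\<^bsub>L\<^esub> Suc j"
      using \<psi>(2,3) by (subst (asm) L.m_rcancel) auto
    have "w' = ?\<delta> (Suc j)"
    proof (rule nonzero_functional_injective[OF \<psi>])
      fix z assume z: "z \<in> car M"
      have "x [^]\<^bsub>L\<^esub> Suc j \<otimes>\<^bsub>L\<^esub> \<chi> z \<oplus>\<^bsub>L\<^esub> \<psi> (w' \<otimes>\<^bsub>M\<^esub> z) =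
          x [^]\<^bsub>L\<^esub> Suc j \<otimes>\<^bsub>L\<^esub> \<chi> z \<oplus>\<^bsub>L\<^esub> \<psi> (?\<delta> (Suc j) \<otimes>\<^bsub>M\<^esub> z)"
        using tw tw' z unfolding twisted_leibniz_def u by metis
      then show "\<psi> (w' \<otimes>\<^bsub>M\<^esub> z) = \<psi> (?\<delta> (Suc j) \<otimes>\<^bsub>M\<^esub> z)"
        using z by (subst (asm) L.add.l_cancel) auto
    qed simp_all
    then have "\<ominus>\<^bsub>M\<^esub> (?\<delta> (Suc j)) \<in> power_span y j" using w' subspace_neg[OF sub] by metis
    then have in_span: "[Suc j] \<cdot>\<^bsub>M\<^esub> \<one>\<^bsub>M\<^esub> \<otimes>\<^bsub>M\<^esub> y [^]\<^bsub>M\<^esub> j \<in> power_span y j" by simp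
    obtain c d where cd: "(c, d) \<in> k" "d \<otimes>\<^bsub>M\<^esub> [Suc j] \<cdot>\<^bsub>M\<^esub> \<one>\<^bsub>M\<^esub> = \<one>\<^bsub>M\<^esub>"
      using k_inv[OF k_of_nat char0[of "Suc j"]] by auto
    have "d \<otimes>\<^bsub>M\<^esub> ([Suc j] \<cdot>\<^bsub>M\<^esub> \<one>\<^bsub>M\<^esub> \<otimes>\<^bsub>M\<^esub> y [^]\<^bsub>M\<^esub> j) = y [^]\<^bsub>M\<^esub> j"
      using cd by (simp del: M.add.nat_pow_Suc flip: M.m_assoc)
    then show False using subspaceD(4)[OF sub cd(1) in_span] Suc.IH by simp
  qed
qed

text \<open>By \<open>lscale_eq_rscale_iff\<close> the operator \<open>t\<close> is nonzero, so the
  least \<open>N\<close> with \<open>t^N = 0\<close> is at least 2. For a \<open>\<phi>\<close> not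
  killed by \<open>t^(N-1)\<close>, the maps \<open>\<psi> = t^(N-1) \<phi>\<close> and
  \<open>\<chi> = t^(N-2) \<phi>\<close> satisfy \<open>\<psi> = t \<chi>\<close> and
  \<open>t \<psi> = 0\<close>. Then the two preceding results on \<open>power_span\<close>, both at
  exponent \<open>N\<close>, contradict each other.\<close>

lemma nilpotent_difference_char_0:
  assumes char0: "\<And>n::nat. n > 0 \<Longrightarrow> [n] \<cdot>\<^bsub>M\<^esub> \<one>\<^bsub>M\<^esub> \<noteq> \<zero>\<^bsub>M\<^esub>"
    and x [simp]: "x \<in> car L" and y [simp]: "y \<in> car M"
    and nil: "(lscale x \<ominus>\<^bsub>op_ring\<^esub> rscale y) [^]\<^bsub>op_ring\<^esub> (n::nat) = \<zero>\<^bsub>op_ring\<^esub>"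
  shows "(x, y) \<in> k"
proof (rule ccontr)
  assume nk: "(x, y) \<notin> k"
  let ?t = "lscale x \<ominus>\<^bsub>op_ring\<^esub> rscale y"
  have tS: "?t \<in> car op_ring" by simp
  then have t: "?t \<in> ops" by (simp only: op_ring_simps)
  have tn: "?t [^]\<^bsub>op_ring\<^esub> i \<in> ops" for i :: nat
    using S.nat_pow_closed[OF tS, of i] by (simp only: op_ring_simps)
  have t0: "?t \<noteq> \<zero>\<^bsub>op_ring\<^esub>" using nk lscale_eq_rscale_iff[OF x y] by simp
  define N where "N = (LEAST n. ?t [^]\<^bsub>op_ring\<^esub> (n::nat) = \<zero>\<^bsub>op_ring\<^esub>)"
  have N: "?t [^]\<^bsub>op_ring\<^esub> N = \<zero>\<^bsub>op_ring\<^esub>" unfolding N_def by (rule LeastI[of _ n]) (rule nil)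
  have least: "?t [^]\<^bsub>op_ring\<^esub> i \<noteq> \<zero>\<^bsub>op_ring\<^esub>" if "i < N" for i
    using that unfolding N_def by (rule not_less_Least)
  have "N \<noteq> 0"
  proof
    assume "N = 0"
    then have "\<one>\<^bsub>op_ring\<^esub> = \<zero>\<^bsub>op_ring\<^esub>" using N by simp
    then show False using t0 tS S.one_zeroD by blast
  qed
  moreover have "N \<noteq> 1" using N t0 tS by auto
  ultimately obtain m where m: "N = Suc (Suc m)" by (metis One_nat_def not0_implies_Suc)
  obtain \<phi> z0 where \<phi>: "\<phi> \<in> linear_maps" "z0 \<in> car M"
    "(?t [^]\<^bsub>op_ring\<^esub> Suc m) \<phi> z0 \<noteq> \<zero>\<^bsub>op_ring\<^esub> \<phi> z0"
  proof (rule ccontr)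
    assume "\<not> thesis"
    then have "?t [^]\<^bsub>op_ring\<^esub> Suc m = \<zero>\<^bsub>op_ring\<^esub>"
      using tn[of "Suc m"] that S.zero_closed by (intro ops_eqI) (auto simp only: op_ring_simps)
    then show False using least[of "Suc m"] m by simp
  qed
  define \<chi> where "\<chi> = (?t [^]\<^bsub>op_ring\<^esub> m) \<phi>"
  define \<psi> where "\<psi> = (?t [^]\<^bsub>op_ring\<^esub> Suc m) \<phi>"
  have lin: "\<chi> \<in> linear_maps" "\<psi> \<in> linear_maps"
    unfolding \<chi>_def \<psi>_def using \<phi>(1) by (rule ops_linear[OF tn])+
  have \<psi>0: "\<psi> z0 \<noteq> \<zero>\<^bsub>L\<^esub>" unfolding \<psi>_def using \<phi>(3) zero_apply[OF \<phi>(1,2)] by simp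
  have \<psi>: "\<psi> = ?t \<chi>" unfolding \<chi>_def \<psi>_def by (rule pow_Suc_apply[OF t \<phi>(1)])
  have "?t \<psi> = \<zero>\<^bsub>op_ring\<^esub> \<phi>"
    unfolding \<psi>_def using pow_Suc_apply[OF t \<phi>(1), of "Suc m"] N m by metis
  \<comment> \<open>\<open>t \<psi> = 0\<close> reads \<open>\<psi>(y z) = x \<psi>(z)\<close>, and
    \<open>\<psi> = t \<chi>\<close> reads \<open>\<chi>(y z) = x \<chi>(z) - \<psi>(z)\<close>;
    together they are the Leibniz relation with derivative \<open>-1\<close>.\<close>
  have "twisted_leibniz \<psi> \<chi> y x (\<ominus>\<^bsub>M\<^esub> \<one>\<^bsub>M\<^esub>)"
    unfolding twisted_leibniz_def
  proof (intro conjI ballI)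
    fix z assume z: "z \<in> car M"
    have c: "\<psi> z \<in> car L" "\<psi> (y \<otimes>\<^bsub>M\<^esub> z) \<in> car L" "\<chi> z \<in> car L" "\<chi> (y \<otimes>\<^bsub>M\<^esub> z) \<in> car L"
      using z y by (auto intro: linear_mapsD(1)[OF lin(1)] linear_mapsD(1)[OF lin(2)])
    have "x \<otimes>\<^bsub>L\<^esub> \<psi> z \<ominus>\<^bsub>L\<^esub> \<psi> (y \<otimes>\<^bsub>M\<^esub> z) = \<zero>\<^bsub>L\<^esub>"
      using minus_apply[OF x y lin(2) z] \<open>?t \<psi> = _\<close> zero_apply[OF \<phi>(1) z] by simp
    then show "\<psi> (y \<otimes>\<^bsub>M\<^esub> z) = x \<otimes>\<^bsub>L\<^esub> \<psi> z" using c by simp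
    have "\<psi> z = x \<otimes>\<^bsub>L\<^esub> \<chi> z \<ominus>\<^bsub>L\<^esub> \<chi> (y \<otimes>\<^bsub>M\<^esub> z)"
      using minus_apply[OF x y lin(1) z] \<psi> by simp
    moreover have "\<psi> (\<ominus>\<^bsub>M\<^esub> \<one>\<^bsub>M\<^esub> \<otimes>\<^bsub>M\<^esub> z) = \<ominus>\<^bsub>L\<^esub> \<psi> z"
      using z lin by (simp add: M.l_minus linear_maps_neg)
    ultimately show "\<chi> (y \<otimes>\<^bsub>M\<^esub> z) = x \<otimes>\<^bsub>L\<^esub> \<chi> z \<oplus>\<^bsub>L\<^esub> \<psi> (\<ominus>\<^bsub>M\<^esub> \<one>\<^bsub>M\<^esub> \<otimes>\<^bsub>M\<^esub> z)"
      using c by (simp add: a_minus_def L.minus_add L.r_neg2 L.m_closed)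
  qed simp_all
  then have "y [^]\<^bsub>M\<^esub> N \<notin> power_span y N"
    using derivation_imp_not_algebraic[OF char0 x y lin(2) \<phi>(2) \<psi>0 lin(1)] by blast
  then show False using nilpotent_difference_algebraic[OF x y N] by blast
qed

end

section \<open>A field separating two points\<close>

lemma Quot_zero: "\<zero>\<^bsub>R Quot P\<^esub> = P"
  by (simp add: FactRing_def)

lemma Quot_image: "(+>\<^bsub>R\<^esub>) P ` car R = car (R Quot P)"
  by (auto simp: FactRing_def A_RCOSETS_def')

definition frobenius_surj :: "('a, 'm) ring_scheme \<Rightarrow> nat \<Rightarrow> bool" where
  "frobenius_surj R p \<longleftrightarrow> (\<forall>a\<in>car R. \<exists>r\<in>car R. r [^]\<^bsub>R\<^esub> p = a)"

lemma frobenius_surj_image: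
  assumes "ring_hom_cring R S h" "h ` car R = car S" "frobenius_surj R p"
  shows "frobenius_surj S p"
  unfolding frobenius_surj_def
proof
  interpret ring_hom_cring R S h by fact
  fix a assume "a \<in> car S"
  then have "a \<in> h ` car R" using assms(2) by simp
  then obtain r where r: "r \<in> car R" "h r = a" by blast
  then obtain q where q: "q \<in> car R" "q [^]\<^bsub>R\<^esub> p = r"
    using assms(3) unfolding frobenius_surj_def by blast
  have "h q [^]\<^bsub>S\<^esub> p = a" using hom_pow[OF q(1), of p] q r by simp
  then show "\<exists>s\<in>car S. s [^]\<^bsub>S\<^esub> p = a" using hom_closed[OF q(1)] by blast
qed

context domain
begin

lemma frac_pow:
  assumes "a \<in> car R" "b \<in> car R - {\<zero>}"
  shows "frac R a b [^]\<^bsub>frac_field R\<^esub> (n::nat) = frac R (a [^] n) (b [^] n) \<and> b [^] n \<noteq> \<zero>"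
proof (induction n)
  case 0
  interpret K: field "frac_field R" by (rule field_frac_field)
  show ?case by (simp add: frac_one)
next
  case (Suc n)
  then show ?case using assms by (auto simp: frac_mult integral_iff)
qed

text \<open>Roots are taken in numerator and denominator separately; \<open>p > 0\<close> keeps the
  root of the denominator nonzero.\<close>

lemma frobenius_surj_frac_field:
  assumes "frobenius_surj R p" "p > 0"
  shows "frobenius_surj (frac_field R) p"
  unfolding frobenius_surj_def
proof
  fix X assume "X \<in> car (frac_field R)"
  then obtain a b where ab: "X = frac R a b" "a \<in> car R" "b \<in> car R" "b \<noteq> \<zero>"
    by (rule carrier_frac_fieldE)
  obtain c d where cd: "c \<in> car R" "c [^] p = a" "d \<in> car R" "d [^] p = b"
    using assms(1) ab unfolding frobenius_surj_def by blast
  have "d \<noteq> \<zero>" using cd ab assms(2) by (auto simp: nat_pow_zero)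
  then have "frac R c d [^]\<^bsub>frac_field R\<^esub> p = X" "frac R c d \<in> car (frac_field R)"
    using frac_pow[of c d p] cd ab by (auto intro: frac_in_carrier)
  then show "\<exists>Y\<in>car (frac_field R). Y [^]\<^bsub>frac_field R\<^esub> p = X" by blast
qed

end

context field_pair
begin

text \<open>The generators have p-th roots, and p-th powers are closed under composition and, by the
  Frobenius identity, under sums.\<close>

lemma frobenius_surj_op_ring:
  assumes p: "prime p" "[(p::nat)] \<cdot>\<^bsub>L\<^esub> \<one>\<^bsub>L\<^esub> = \<zero>\<^bsub>L\<^esub>"
    and "frobenius_surj L p" "frobenius_surj M p"
  shows "frobenius_surj op_ring p"
proof -
  have pS: "[p] \<cdot>\<^bsub>op_ring\<^esub> \<one>\<^bsub>op_ring\<^esub> = \<zero>\<^bsub>op_ring\<^esub>"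
    using p l.hom_of_nat[of p] by simp
  have "\<exists>r\<in>car op_ring. r [^]\<^bsub>op_ring\<^esub> p = u" if "u \<in> ops" for u
    using that
  proof (induction u rule: ops.induct)
    case (lscale x)
    then obtain r where "r \<in> car L" "r [^]\<^bsub>L\<^esub> p = x" using assms(3) unfolding frobenius_surj_def by blast
    then show ?case by (intro bexI[of _ "lscale r"]) (auto simp: l.hom_pow[symmetric])
  next
    case (rscale y)
    then obtain r where "r \<in> car M" "r [^]\<^bsub>M\<^esub> p = y" using assms(4) unfolding frobenius_surj_def by blast
    then show ?case by (intro bexI[of _ "rscale r"]) (auto simp: r.hom_pow[symmetric])
  next
    case (add u w)
    then obtain q r where *: "q \<in> car op_ring" "q [^]\<^bsub>op_ring\<^esub> p = u" "r \<in> car op_ring" "r [^]\<^bsub>op_ring\<^esub> p = w" by blast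
    then have "(q \<oplus>\<^bsub>op_ring\<^esub> r) [^]\<^bsub>op_ring\<^esub> p = op_add u w"
      using S.freshmans_dream[OF p(1) pS *(1,3)] by (simp add: op_ring_simps(3))
    then show ?case using * by blast
  next
    case (mult u w)
    then obtain q r where *: "q \<in> car op_ring" "q [^]\<^bsub>op_ring\<^esub> p = u" "r \<in> car op_ring" "r [^]\<^bsub>op_ring\<^esub> p = w" by blast
    then have "(q \<otimes>\<^bsub>op_ring\<^esub> r) [^]\<^bsub>op_ring\<^esub> p = compose linear_maps u w"
      using S.nat_pow_distrib[OF *(1,3), of p] by (simp only: * op_ring_simps(2))
    then show ?case using * by blast
  qed
  then show ?thesis unfolding frobenius_surj_def op_ring_simps(1) by blast
qed

text \<open>The operator ring modulo the prime is only a domain, so \<open>K\<close> is its field of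
  fractions. The last clause tracks perfectness through operators, quotient and fractions; it later
  makes \<open>K\<close> weakly rooted.\<close>

theorem exists_separating_field:
  assumes x: "x \<in> car L" and y: "y \<in> car M" and nk: "(x, y) \<notin> k"
    and char: "(\<forall>n::nat. n > 0 \<longrightarrow> [n] \<cdot>\<^bsub>M\<^esub> \<one>\<^bsub>M\<^esub> \<noteq> \<zero>\<^bsub>M\<^esub>) \<or>
      (\<exists>p::nat. prime p \<and> [p] \<cdot>\<^bsub>L\<^esub> \<one>\<^bsub>L\<^esub> = \<zero>\<^bsub>L\<^esub> \<and> has_roots p)"
  obtains K :: "((('m \<Rightarrow> 'l) \<Rightarrow> 'm \<Rightarrow> 'l) set \<times> (('m \<Rightarrow> 'l) \<Rightarrow> 'm \<Rightarrow> 'l) set) set ring" and g h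
  where "field K" "g \<in> ring_hom L K" "h \<in> ring_hom M K" "\<forall>(c, d)\<in>k. g c = h d" "g x \<noteq> h y"
    "\<forall>p::nat. prime p \<and> [p] \<cdot>\<^bsub>L\<^esub> \<one>\<^bsub>L\<^esub> = \<zero>\<^bsub>L\<^esub> \<and> frobenius_surj L p \<and> frobenius_surj M p \<longrightarrow> frobenius_surj K p"
proof -
  let ?t = "lscale x \<ominus>\<^bsub>op_ring\<^esub> rscale y"
  have t: "?t \<in> car op_ring" using x y by simp
  have "?t [^]\<^bsub>op_ring\<^esub> n \<noteq> \<zero>\<^bsub>op_ring\<^esub>" for n :: nat
  proof
    assume nil: "?t [^]\<^bsub>op_ring\<^esub> n = \<zero>\<^bsub>op_ring\<^esub>"
    show False using char
    proof
      assume "\<forall>n::nat. n > 0 \<longrightarrow> [n] \<cdot>\<^bsub>M\<^esub> \<one>\<^bsub>M\<^esub> \<noteq> \<zero>\<^bsub>M\<^esub>"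
      then show False using nilpotent_difference_char_0[OF _ x y nil] nk by blast
    next
      assume "\<exists>p::nat. prime p \<and> [p] \<cdot>\<^bsub>L\<^esub> \<one>\<^bsub>L\<^esub> = \<zero>\<^bsub>L\<^esub> \<and> has_roots p"
      then show False using nilpotent_difference_char_p[OF _ _ _ x y nil] nk by blast
    qed
  qed
  then obtain P where P: "primeideal P op_ring" "?t \<notin> P"
    using S.exists_primeideal_avoiding_powers[OF S.zeroideal t] by auto
  interpret P: primeideal P op_ring by fact
  let ?D = "op_ring Quot P"
  interpret D: domain ?D by (rule P.quotient_is_domain)
  interpret q: ring_hom_cring op_ring ?D "(+>\<^bsub>op_ring\<^esub>) P" by (rule P.rcos_ring_hom_cring)
  let ?K = "frac_field ?D"
  interpret K: field ?K by (rule D.field_frac_field)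
  let ?i = "\<lambda>a. frac ?D a \<one>\<^bsub>?D\<^esub>"
  let ?\<pi> = "\<lambda>u. ?i (P +>\<^bsub>op_ring\<^esub> u)"
  have \<pi>: "?\<pi> \<in> ring_hom op_ring ?K"
    using ring_hom_trans[OF q.homh D.frac_ring_hom] by (simp add: comp_def)
  interpret \<pi>: ring_hom_cring op_ring ?K ?\<pi> using \<pi> by unfold_locales
  have t_nz: "?\<pi> ?t \<noteq> \<zero>\<^bsub>?K\<^esub>"
  proof
    assume "?\<pi> ?t = \<zero>\<^bsub>?K\<^esub>"
    then have "P +>\<^bsub>op_ring\<^esub> ?t = \<zero>\<^bsub>?D\<^esub>" by (subst (asm) D.frac_inj[OF q.hom_closed[OF t]])
    also have "\<zero>\<^bsub>?D\<^esub> = P" by (rule Quot_zero)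
    finally have eq: "P +>\<^bsub>op_ring\<^esub> ?t = P" .
    have "?t \<in> P +>\<^bsub>op_ring\<^esub> ?t" by (rule P.a_rcos_self[OF t])
    then show False using P(2) unfolding eq by blast
  qed
  show thesis
  proof (rule that[of ?K "?\<pi> \<circ> lscale" "?\<pi> \<circ> rscale"])
    show "field ?K" by (rule D.field_frac_field)
    show "?\<pi> \<circ> lscale \<in> ring_hom L ?K" "?\<pi> \<circ> rscale \<in> ring_hom M ?K"
      by (rule ring_hom_trans[OF _ \<pi>], rule lscale_hom rscale_hom)+
    have "(?\<pi> \<circ> lscale) c = (?\<pi> \<circ> rscale) d" if "(c, d) \<in> k" for c d
      using lscale_eq_rscale_iff[of c d] that by simp
    then show "\<forall>(c, d)\<in>k. (?\<pi> \<circ> lscale) c = (?\<pi> \<circ> rscale) d" by blast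
    show "(?\<pi> \<circ> lscale) x \<noteq> (?\<pi> \<circ> rscale) y"
    proof
      assume eq: "(?\<pi> \<circ> lscale) x = (?\<pi> \<circ> rscale) y"
      have "?\<pi> ?t = ?\<pi> (lscale x) \<ominus>\<^bsub>?K\<^esub> ?\<pi> (rscale y)"
        unfolding a_minus_def using x y
        by (subst \<pi>.hom_add) (simp_all only: \<pi>.hom_a_inv l.hom_closed r.hom_closed S.a_inv_closed)
      then show False using t_nz eq \<pi>.hom_closed[OF r.hom_closed[OF y]] by simp
    qed
    have "frobenius_surj ?K p" if "prime p" "[p] \<cdot>\<^bsub>L\<^esub> \<one>\<^bsub>L\<^esub> = \<zero>\<^bsub>L\<^esub>" "frobenius_surj L p" "frobenius_surj M p" for p :: nat
    proof (rule D.frobenius_surj_frac_field)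
      show "frobenius_surj ?D p"
        by (rule frobenius_surj_image[OF q.ring_hom_cring_axioms Quot_image frobenius_surj_op_ring[OF that]])
    qed (use that prime_gt_0_nat in blast)
    then show "\<forall>p::nat. prime p \<and> [p] \<cdot>\<^bsub>L\<^esub> \<one>\<^bsub>L\<^esub> = \<zero>\<^bsub>L\<^esub> \<and> frobenius_surj L p \<and> frobenius_surj M p \<longrightarrow>
        frobenius_surj ?K p" by blast
  qed
qed

end

section \<open>Implicitly closed fields and their identities\<close>

definition toring :: "'a alg \<Rightarrow> 'a ring" where
  "toring R = \<lparr>partial_object.carrier = carrier R, monoid.mult = mul R, monoid.one = one R,
     ring.zero = zero R, ring.add = add R\<rparr>"

lemma toring_simps [simp]:
  "car (toring R) = carrier R" "x \<otimes>\<^bsub>toring R\<^esub> y = mul R x y" "x \<oplus>\<^bsub>toring R\<^esub> y = add R x y"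
  "\<one>\<^bsub>toring R\<^esub> = one R" "\<zero>\<^bsub>toring R\<^esub> = zero R"
  by (simp_all add: toring_def)

lemma field_toring:
  assumes "field_ax R"
  shows "field (toring R)"
proof -
  note ax = assms[unfolded field_ax_def]
  have closed: "zero R \<in> carrier R" "one R \<in> carrier R"
    "\<And>x y. x \<in> carrier R \<Longrightarrow> y \<in> carrier R \<Longrightarrow> add R x y \<in> carrier R"
    "\<And>x y. x \<in> carrier R \<Longrightarrow> y \<in> carrier R \<Longrightarrow> mul R x y \<in> carrier R"
    "\<And>x. x \<in> carrier R \<Longrightarrow> neg R x \<in> carrier R"
    using ax by blast+
  have assoc: "\<And>x y z. x \<in> carrier R \<Longrightarrow> y \<in> carrier R \<Longrightarrow> z \<in> carrier R \<Longrightarrow>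
      add R (add R x y) z = add R x (add R y z)"
    "\<And>x y z. x \<in> carrier R \<Longrightarrow> y \<in> carrier R \<Longrightarrow> z \<in> carrier R \<Longrightarrow>
      mul R (mul R x y) z = mul R x (mul R y z)"
    using ax by blast+
  have comm: "\<And>x y. x \<in> carrier R \<Longrightarrow> y \<in> carrier R \<Longrightarrow> add R x y = add R y x"
    "\<And>x y. x \<in> carrier R \<Longrightarrow> y \<in> carrier R \<Longrightarrow> mul R x y = mul R y x"
    using ax by blast+
  interpret cring "toring R"
  proof (rule cringI)
    show "abelian_group (toring R)"
    proof (rule abelian_groupI)
      fix x assume "x \<in> car (toring R)"
      then show "\<exists>y\<in>car (toring R). y \<oplus>\<^bsub>toring R\<^esub> x = \<zero>\<^bsub>toring R\<^esub>"
        using ax comm closed by (intro bexI[of _ "neg R x"]) simp_all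
    next
      fix x assume "x \<in> car (toring R)"
      then have "add R x (zero R) = x" "add R (zero R) x = add R x (zero R)" using ax comm(1) closed by simp_all
      then show "\<zero>\<^bsub>toring R\<^esub> \<oplus>\<^bsub>toring R\<^esub> x = x" by simp
    qed (simp_all add: closed assoc(1), simp add: comm(1))
    show "comm_monoid (toring R)"
    proof (rule comm_monoidI)
      fix x assume "x \<in> car (toring R)"
      then have "mul R x (one R) = x" "mul R (one R) x = mul R x (one R)" using ax comm(2) closed by simp_all
      then show "\<one>\<^bsub>toring R\<^esub> \<otimes>\<^bsub>toring R\<^esub> x = x" by simp
    qed (simp_all add: closed assoc(2), simp add: comm(2))
    fix x y z assume *: "x \<in> car (toring R)" "y \<in> car (toring R)" "z \<in> car (toring R)"
    then have "mul R (add R x y) z = mul R z (add R x y)" "mul R x z = mul R z x" "mul R y z = mul R z y"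
      "mul R z (add R x y) = add R (mul R z x) (mul R z y)" using ax comm(2) closed by simp_all
    then show "(x \<oplus>\<^bsub>toring R\<^esub> y) \<otimes>\<^bsub>toring R\<^esub> z = x \<otimes>\<^bsub>toring R\<^esub> z \<oplus>\<^bsub>toring R\<^esub> y \<otimes>\<^bsub>toring R\<^esub> z"
      by simp
  qed
  show ?thesis
    by (rule cring_fieldI2) (use ax in simp_all)
qed

lemma neg_eq_a_inv:
  assumes "field_ax R" "x \<in> carrier R"
  shows "neg R x = \<ominus>\<^bsub>toring R\<^esub> x"
proof -
  interpret field "toring R" using assms by (intro field_toring)
  show ?thesis
    using assms sum_zero_eq_neg[of "neg R x" x] a_comm[of x "neg R x"] by (simp add: field_ax_def)
qed

lemma natmult_eq:
  assumes "cring (toring R)" "x \<in> carrier R"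
  shows "natmult R n x = [n] \<cdot>\<^bsub>toring R\<^esub> x"
proof -
  interpret cring "toring R" by fact
  have x: "x \<in> car (toring R)" using assms by simp
  show ?thesis
  proof (induction n)
    case (Suc n)
    have "natmult R (Suc n) x = x \<oplus>\<^bsub>toring R\<^esub> natmult R n x" by (simp add: natmult_def)
    then show ?case using Suc a_comm[OF x add.nat_pow_closed[OF x]] by simp
  qed (simp add: natmult_def)
qed

lemma apow_eq:
  assumes "cring (toring R)" "x \<in> carrier R"
  shows "apow R x n = x [^]\<^bsub>toring R\<^esub> n"
proof -
  interpret cring "toring R" by fact
  have x: "x \<in> car (toring R)" using assms by simp
  show ?thesis
  proof (induction n)
    case (Suc n)
    have "apow R x (Suc n) = x \<otimes>\<^bsub>toring R\<^esub> apow R x n" by (simp add: apow_def)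
    also have "\<dots> = x [^]\<^bsub>toring R\<^esub> Suc n" unfolding Suc using nat_pow_Suc2[OF x] by simp
    finally show ?case .
  qed (simp add: apow_def)
qed

text \<open>The root selected by \<open>SOME\<close> exists when \<open>K\<close> is perfect, and it
  is the only one because Frobenius is injective on a field.\<close>

definition of_field :: "'a ring \<Rightarrow> 'a alg" where
  "of_field K = \<lparr>carrier = car K, add = ring.add K, mul = monoid.mult K, neg = a_inv K,
     zero = ring.zero K, one = monoid.one K,
     winv = (\<lambda>x. if x = \<zero>\<^bsub>K\<^esub> then \<zero>\<^bsub>K\<^esub> else inv\<^bsub>K\<^esub> x),
     wroot = (\<lambda>p a. if [p] \<cdot>\<^bsub>K\<^esub> \<one>\<^bsub>K\<^esub> = \<zero>\<^bsub>K\<^esub> then SOME r. r \<in> car K \<and> r [^]\<^bsub>K\<^esub> p = a else \<zero>\<^bsub>K\<^esub>)\<rparr>"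

lemma toring_of_field [simp]: "toring (of_field K) = K"
  by (simp add: toring_def of_field_def)

lemma implicitly_closed_field_of_field:
  assumes "field K"
    and char: "(\<forall>n::nat. n > 0 \<longrightarrow> [n] \<cdot>\<^bsub>K\<^esub> \<one>\<^bsub>K\<^esub> \<noteq> \<zero>\<^bsub>K\<^esub>) \<or>
      (\<exists>p::nat. prime p \<and> [p] \<cdot>\<^bsub>K\<^esub> \<one>\<^bsub>K\<^esub> = \<zero>\<^bsub>K\<^esub>)"
    and roots: "\<And>p::nat. prime p \<Longrightarrow> [p] \<cdot>\<^bsub>K\<^esub> \<one>\<^bsub>K\<^esub> = \<zero>\<^bsub>K\<^esub> \<Longrightarrow> frobenius_surj K p"
  shows "implicitly_closed_field (of_field K)"
proof -
  interpret field K by fact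
  let ?K = "of_field K"
  have cr: "cring (toring ?K)" by (simp add: is_cring)
  have sel: "carrier ?K = car K" "zero ?K = \<zero>\<^bsub>K\<^esub>" "one ?K = \<one>\<^bsub>K\<^esub>" "add ?K = (\<oplus>\<^bsub>K\<^esub>)" "mul ?K = (\<otimes>\<^bsub>K\<^esub>)"
    "neg ?K = a_inv K" by (simp_all add: of_field_def)
  have nm: "natmult ?K n (one ?K) = [n] \<cdot>\<^bsub>K\<^esub> \<one>\<^bsub>K\<^esub>" for n
    using natmult_eq[OF cr, of "one ?K" n] by (simp add: sel)
  have ap: "apow ?K x n = x [^]\<^bsub>K\<^esub> n" if "x \<in> car K" for x n
    using apow_eq[OF cr, of x n] that by (simp add: sel)
  have inv: "x \<otimes>\<^bsub>K\<^esub> inv\<^bsub>K\<^esub> x = \<one>\<^bsub>K\<^esub>" "inv\<^bsub>K\<^esub> x \<in> car K" if "x \<in> car K" "x \<noteq> \<zero>\<^bsub>K\<^esub>" for x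
    using that by (auto simp: field_Units)
  have fa: "field_ax ?K"
    unfolding field_ax_def sel using inv by (auto simp: a_ac m_ac r_distr r_neg)
  have "weakly_rooted ?K"
    unfolding weakly_rooted_def
  proof (intro conjI fa)
    show "char_zero_alg ?K \<or> (\<exists>p. char_is ?K p \<and> (\<forall>a\<in>carrier ?K. \<exists>r\<in>carrier ?K. apow ?K r p = a))"
      using char
    proof
      assume "\<exists>p::nat. prime p \<and> [p] \<cdot>\<^bsub>K\<^esub> \<one>\<^bsub>K\<^esub> = \<zero>\<^bsub>K\<^esub>"
      then obtain p :: nat where p: "prime p" "[p] \<cdot>\<^bsub>K\<^esub> \<one>\<^bsub>K\<^esub> = \<zero>\<^bsub>K\<^esub>" by blast
      have "\<exists>r\<in>carrier ?K. apow ?K r p = a" if "a \<in> carrier ?K" for a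
        using roots[OF p] that by (simp add: frobenius_surj_def sel ap)
      then show ?thesis using p by (auto simp: char_is_def nm sel(2))
    qed (simp add: char_zero_alg_def nm sel(2))
  qed
  moreover have "wroot ?K p a \<in> car K \<and>
      (if char_is ?K p then apow ?K (wroot ?K p a) p = a else wroot ?K p a = \<zero>\<^bsub>K\<^esub>)"
    if p: "prime p" and a: "a \<in> car K" for p a
  proof (cases "[p] \<cdot>\<^bsub>K\<^esub> \<one>\<^bsub>K\<^esub> = \<zero>\<^bsub>K\<^esub>")
    case True
    let ?r = "SOME r. r \<in> car K \<and> r [^]\<^bsub>K\<^esub> p = a"
    have "\<exists>r. r \<in> car K \<and> r [^]\<^bsub>K\<^esub> p = a" using roots[OF p True] a by (auto simp: frobenius_surj_def)
    then have "?r \<in> car K \<and> ?r [^]\<^bsub>K\<^esub> p = a" by (rule someI_ex)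
    moreover have "wroot ?K p a = ?r" using True by (simp add: of_field_def)
    ultimately show ?thesis using True p by (simp add: ap char_is_def nm sel(2))
  next
    case False
    then have "wroot ?K p a = \<zero>\<^bsub>K\<^esub>" by (simp add: of_field_def)
    then show ?thesis using False by (simp add: char_is_def nm sel(2))
  qed
  moreover have "winv ?K (zero ?K) = zero ?K" by (simp add: of_field_def)
  moreover have "winv ?K x \<in> car K \<and> x \<otimes>\<^bsub>K\<^esub> winv ?K x = \<one>\<^bsub>K\<^esub>" if "x \<in> car K" "x \<noteq> \<zero>\<^bsub>K\<^esub>" for x
    using inv[OF that] that by (simp add: of_field_def)
  ultimately show ?thesis by (simp add: implicitly_closed_field_def sel)
qed

text \<open>Equations that hold in every implicitly closed field and therefore pass to products and
  subalgebras. In a field the element \<open>e\<close> is \<open>1\<close> in characteristic p and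
  \<open>0\<close> otherwise. So the last equation makes \<open>wroot S p x\<close> a p-th root of
  \<open>x\<close> in characteristic p, while its p-fold sum being zero makes it vanish in every
  other characteristic.\<close>

definition icm_identities :: "'a alg \<Rightarrow> bool" where
  "icm_identities S \<longleftrightarrow> is_alg S \<and> cring (toring S) \<and>
     (\<forall>x\<in>carrier S. neg S x = \<ominus>\<^bsub>toring S\<^esub> x \<and> mul S (mul S x (winv S x)) x = x \<and>
        mul S (mul S (winv S x) x) (winv S x) = winv S x) \<and>
     (\<forall>p. prime p \<longrightarrow> (\<forall>x\<in>carrier S. [p] \<cdot>\<^bsub>toring S\<^esub> wroot S p x = zero S \<and>
        (let q = [p] \<cdot>\<^bsub>toring S\<^esub> one S; e = one S \<ominus>\<^bsub>toring S\<^esub> mul S q (winv S q)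
         in mul S e (wroot S p x [^]\<^bsub>toring S\<^esub> p) = mul S e x)))"

lemma icm_identities_field:
  assumes F: "implicitly_closed_field F"
  shows "icm_identities F"
proof -
  have fa: "field_ax F" using F by (simp add: implicitly_closed_field_def weakly_rooted_def)
  interpret field "toring F" using fa by (rule field_toring)
  have cr: "cring (toring F)" by (rule is_cring)
  have z: "winv F (zero F) = zero F" using F by (simp add: implicitly_closed_field_def)
  have inv: "winv F x \<in> carrier F" "mul F x (winv F x) = one F" if "x \<in> carrier F" "x \<noteq> zero F" for x
    using F that by (auto simp: implicitly_closed_field_def)
  have winv_closed: "winv F x \<in> carrier F" if "x \<in> carrier F" for x
    using inv(1)[OF that] z zero_closed by (cases "x = zero F") auto
  have root: "wroot F p a \<in> carrier F" "char_is F p \<Longrightarrow> wroot F p a [^]\<^bsub>toring F\<^esub> p = a"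
    "\<not> char_is F p \<Longrightarrow> wroot F p a = zero F" if "prime p" "a \<in> carrier F" for p a
  proof -
    have *: "wroot F p a \<in> carrier F \<and>
        (if char_is F p then apow F (wroot F p a) p = a else wroot F p a = zero F)"
      using F that unfolding implicitly_closed_field_def by blast
    then show "wroot F p a \<in> carrier F" "\<not> char_is F p \<Longrightarrow> wroot F p a = zero F" by auto
    assume "char_is F p"
    with * show "wroot F p a [^]\<^bsub>toring F\<^esub> p = a" by (simp add: apow_eq[OF cr, symmetric])
  qed
  have ch: "char_is F p \<longleftrightarrow> [p] \<cdot>\<^bsub>toring F\<^esub> one F = zero F" if "prime p" for p
    using that natmult_eq[OF cr, of "one F"] one_closed by (simp add: char_is_def)
  have "is_alg F"
    using fa winv_closed root(1) by (auto simp: is_alg_def field_ax_def)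
  moreover have "mul F (mul F x (winv F x)) x = x \<and> mul F (mul F (winv F x) x) (winv F x) = winv F x"
    if x: "x \<in> carrier F" for x
  proof (cases "x = zero F")
    case True
    then show ?thesis using z l_null r_null zero_closed by simp
  next
    case False
    have "mul F (winv F x) x = one F" using inv[OF x False] m_comm[of x "winv F x"] x by simp
    then show ?thesis using inv[OF x False] l_one[of x] l_one[of "winv F x"] x by simp
  qed
  moreover have "[p] \<cdot>\<^bsub>toring F\<^esub> wroot F p x = zero F \<and>
      (let q = [p] \<cdot>\<^bsub>toring F\<^esub> one F; e = one F \<ominus>\<^bsub>toring F\<^esub> mul F q (winv F q)
         in mul F e (wroot F p x [^]\<^bsub>toring F\<^esub> p) = mul F e x)" if p: "prime p" and x: "x \<in> carrier F" for p x
  proof (cases "char_is F p")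
    case True
    then have "[p] \<cdot>\<^bsub>toring F\<^esub> \<one>\<^bsub>toring F\<^esub> = \<zero>\<^bsub>toring F\<^esub>" using ch[OF p] by simp
    from add_pow_one_eq_zero[OF this, of "wroot F p x" p]
    have "[p] \<cdot>\<^bsub>toring F\<^esub> wroot F p x = zero F" using root(1)[OF p x] by simp
    then show ?thesis using root(2)[OF p x True] by simp
  next
    case False
    let ?q = "[p] \<cdot>\<^bsub>toring F\<^esub> one F"
    have r: "wroot F p x = zero F" using root(3)[OF p x] False by simp
    have q: "?q \<in> carrier F" "?q \<noteq> zero F" using ch[OF p] False add.nat_pow_closed[OF one_closed] by simp_all
    \<comment> \<open>Outside characteristic p the element \<open>?q\<close> is a unit, so the
      idempotent is zero and both sides of the root equation vanish.\<close>
    have "one F \<ominus>\<^bsub>toring F\<^esub> mul F ?q (winv F ?q) = zero F"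
      using inv(2)[OF q] r_neg[OF one_closed] by (simp add: a_minus_def)
    moreover have "zero F [^]\<^bsub>toring F\<^esub> p \<in> carrier F" "[p] \<cdot>\<^bsub>toring F\<^esub> zero F = zero F"
      using nat_pow_closed[OF zero_closed, of p] add.nat_pow_one[of p] by simp_all
    ultimately show ?thesis using r l_null[of x] l_null[of "zero F [^]\<^bsub>toring F\<^esub> p"] x by (simp add: Let_def)
  qed
  ultimately show ?thesis
    unfolding icm_identities_def using cr neg_eq_a_inv[OF fa] by blast
qed

lemma homD:
  assumes "hom A B f" "x \<in> carrier A"
  shows "f x \<in> carrier B" "y \<in> carrier A \<Longrightarrow> f (add A x y) = add B (f x) (f y)"
    "y \<in> carrier A \<Longrightarrow> f (mul A x y) = mul B (f x) (f y)"
    "f (neg A x) = neg B (f x)" "f (winv A x) = winv B (f x)"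
    "prime p \<Longrightarrow> f (wroot A p x) = wroot B p (f x)"
  using assms by (auto simp: hom_def)

lemma hom_zero_one: "hom A B f \<Longrightarrow> f (zero A) = zero B" "hom A B f \<Longrightarrow> f (one A) = one B"
  by (auto simp: hom_def)

lemma is_algD:
  assumes "is_alg A"
  shows "zero A \<in> carrier A" "one A \<in> carrier A"
    "x \<in> carrier A \<Longrightarrow> y \<in> carrier A \<Longrightarrow> add A x y \<in> carrier A"
    "x \<in> carrier A \<Longrightarrow> y \<in> carrier A \<Longrightarrow> mul A x y \<in> carrier A"
    "x \<in> carrier A \<Longrightarrow> neg A x \<in> carrier A" "x \<in> carrier A \<Longrightarrow> winv A x \<in> carrier A"
    "prime p \<Longrightarrow> x \<in> carrier A \<Longrightarrow> wroot A p x \<in> carrier A"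
  using assms by (auto simp: is_alg_def)

lemma icm_identitiesD:
  assumes "icm_identities S"
  shows "is_alg S" "cring (toring S)" "x \<in> carrier S \<Longrightarrow> neg S x = \<ominus>\<^bsub>toring S\<^esub> x"
    "x \<in> carrier S \<Longrightarrow> mul S (mul S x (winv S x)) x = x"
    "x \<in> carrier S \<Longrightarrow> mul S (mul S (winv S x) x) (winv S x) = winv S x"
    "prime p \<Longrightarrow> x \<in> carrier S \<Longrightarrow> [p] \<cdot>\<^bsub>toring S\<^esub> wroot S p x = zero S"
    "prime p \<Longrightarrow> x \<in> carrier S \<Longrightarrow> q = [p] \<cdot>\<^bsub>toring S\<^esub> one S \<Longrightarrow>
      e = one S \<ominus>\<^bsub>toring S\<^esub> mul S q (winv S q) \<Longrightarrow>
      mul S e (wroot S p x [^]\<^bsub>toring S\<^esub> p) = mul S e x"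
  using assms unfolding icm_identities_def Let_def by blast+

lemma hom_toring: "hom A B f \<Longrightarrow> f \<in> ring_hom (toring A) (toring B)"
  by (auto simp: hom_def intro!: ring_hom_memI)

text \<open>Equations can be checked after each map of a jointly injective family. Two such families
  occur: the projections on a subalgebra of a product, and the single inclusion of a
  subalgebra.\<close>

lemma icm_identities_separated:
  assumes S: "is_alg S"
    and F: "\<And>i. i \<in> I \<Longrightarrow> icm_identities (F i)" and e: "\<And>i. i \<in> I \<Longrightarrow> hom S (F i) (e i)"
    and sep: "\<And>x y. x \<in> carrier S \<Longrightarrow> y \<in> carrier S \<Longrightarrow> (\<And>i. i \<in> I \<Longrightarrow> e i x = e i y) \<Longrightarrow> x = y"
  shows "icm_identities S"
proof -
  note cl = is_algD[OF S]
  have cr: "cring (toring S)"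
  proof (rule cringI)
    show "abelian_group (toring S)"
    proof (rule abelian_groupI)
      fix x y z assume *: "x \<in> car (toring S)" "y \<in> car (toring S)" "z \<in> car (toring S)"
      have "e i (add S (add S x y) z) = e i (add S x (add S y z))" if i: "i \<in> I" for i
      proof -
        interpret Q: cring "toring (F i)" using icm_identitiesD(2)[OF F[OF i]] .
        show ?thesis
          using * Q.a_assoc[of "e i x" "e i y" "e i z"] by (simp add: homD[OF e[OF i]] cl)
      qed
      then show "x \<oplus>\<^bsub>toring S\<^esub> y \<oplus>\<^bsub>toring S\<^esub> z = x \<oplus>\<^bsub>toring S\<^esub> (y \<oplus>\<^bsub>toring S\<^esub> z)"
        using sep * by (simp add: cl)
    next
      fix x y assume *: "x \<in> car (toring S)" "y \<in> car (toring S)"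
      have "e i (add S x y) = e i (add S y x)" if i: "i \<in> I" for i
      proof -
        interpret Q: cring "toring (F i)" using icm_identitiesD(2)[OF F[OF i]] .
        show ?thesis
          using * Q.a_comm[of "e i x" "e i y"] by (simp add: homD[OF e[OF i]] cl)
      qed
      then show "x \<oplus>\<^bsub>toring S\<^esub> y = y \<oplus>\<^bsub>toring S\<^esub> x"
        using sep * by (simp add: cl)
    next
      fix x assume *: "x \<in> car (toring S)"
      have "e i (add S (zero S) x) = e i x \<and> e i (add S (neg S x) x) = e i (zero S)" if i: "i \<in> I" for i
      proof -
        interpret Q: cring "toring (F i)" using icm_identitiesD(2)[OF F[OF i]] .
        show ?thesis
          using * Q.l_zero[of "e i x"] Q.l_neg[of "e i x"] icm_identitiesD(3)[OF F[OF i], of "e i x"]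
          by (simp add: homD[OF e[OF i]] hom_zero_one[OF e[OF i]] cl)
      qed
      then show "\<zero>\<^bsub>toring S\<^esub> \<oplus>\<^bsub>toring S\<^esub> x = x"
          "\<exists>y\<in>car (toring S). y \<oplus>\<^bsub>toring S\<^esub> x = \<zero>\<^bsub>toring S\<^esub>"
        using sep * by (auto simp: cl intro!: bexI[of _ "neg S x"])
    qed (simp_all add: cl)
    show "comm_monoid (toring S)"
    proof (rule comm_monoidI)
      fix x y z assume *: "x \<in> car (toring S)" "y \<in> car (toring S)" "z \<in> car (toring S)"
      have "e i (mul S (mul S x y) z) = e i (mul S x (mul S y z))" if i: "i \<in> I" for i
      proof -
        interpret Q: cring "toring (F i)" using icm_identitiesD(2)[OF F[OF i]] .
        show ?thesis
          using * Q.m_assoc[of "e i x" "e i y" "e i z"] by (simp add: homD[OF e[OF i]] cl)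
      qed
      then show "x \<otimes>\<^bsub>toring S\<^esub> y \<otimes>\<^bsub>toring S\<^esub> z = x \<otimes>\<^bsub>toring S\<^esub> (y \<otimes>\<^bsub>toring S\<^esub> z)"
        using sep * by (simp add: cl)
    next
      fix x y assume *: "x \<in> car (toring S)" "y \<in> car (toring S)"
      have "e i (mul S x y) = e i (mul S y x)" if i: "i \<in> I" for i
      proof -
        interpret Q: cring "toring (F i)" using icm_identitiesD(2)[OF F[OF i]] .
        show ?thesis
          using * Q.m_comm[of "e i x" "e i y"] by (simp add: homD[OF e[OF i]] cl)
      qed
      then show "x \<otimes>\<^bsub>toring S\<^esub> y = y \<otimes>\<^bsub>toring S\<^esub> x"
        using sep * by (simp add: cl)
    next
      fix x assume *: "x \<in> car (toring S)"
      have "e i (mul S (one S) x) = e i x" if i: "i \<in> I" for i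
      proof -
        interpret Q: cring "toring (F i)" using icm_identitiesD(2)[OF F[OF i]] .
        show ?thesis
          using * Q.l_one[of "e i x"] by (simp add: homD[OF e[OF i]] hom_zero_one[OF e[OF i]] cl)
      qed
      then show "\<one>\<^bsub>toring S\<^esub> \<otimes>\<^bsub>toring S\<^esub> x = x"
        using sep * by (simp add: cl)
    qed (simp_all add: cl)
    fix x y z assume *: "x \<in> car (toring S)" "y \<in> car (toring S)" "z \<in> car (toring S)"
    have "e i (mul S (add S x y) z) = e i (add S (mul S x z) (mul S y z))" if i: "i \<in> I" for i
    proof -
      interpret Q: cring "toring (F i)" using icm_identitiesD(2)[OF F[OF i]] .
      show ?thesis
        using * Q.l_distr[of "e i x" "e i y" "e i z"] by (simp add: homD[OF e[OF i]] cl)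
    qed
    then show "(x \<oplus>\<^bsub>toring S\<^esub> y) \<otimes>\<^bsub>toring S\<^esub> z = x \<otimes>\<^bsub>toring S\<^esub> z \<oplus>\<^bsub>toring S\<^esub> y \<otimes>\<^bsub>toring S\<^esub> z"
      using sep * by (simp add: cl)
  qed
  then interpret cring "toring S" .
  have e_hom: "ring_hom_cring (toring S) (toring (F i)) (e i)" if i: "i \<in> I" for i
    using hom_toring[OF e[OF i]] icm_identitiesD(2)[OF F[OF i]] cr
    by (simp add: ring_hom_cring_def ring_hom_cring_axioms_def)
  have "neg S x = \<ominus>\<^bsub>toring S\<^esub> x \<and> mul S (mul S x (winv S x)) x = x \<and>
        mul S (mul S (winv S x) x) (winv S x) = winv S x" if x: "x \<in> carrier S" for x
  proof -
    have "e i (neg S x) = e i (\<ominus>\<^bsub>toring S\<^esub> x)" "e i (mul S (mul S x (winv S x)) x) = e i x"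
      "e i (mul S (mul S (winv S x) x) (winv S x)) = e i (winv S x)" if i: "i \<in> I" for i
    proof -
      interpret h: ring_hom_cring "toring S" "toring (F i)" "e i" by (rule e_hom[OF i])
      have "e i x \<in> carrier (F i)" using homD[OF e[OF i]] x by simp
      then show "e i (neg S x) = e i (\<ominus>\<^bsub>toring S\<^esub> x)" "e i (mul S (mul S x (winv S x)) x) = e i x"
        "e i (mul S (mul S (winv S x) x) (winv S x)) = e i (winv S x)"
        using x h.hom_a_inv[of x] icm_identitiesD(3-5)[OF F[OF i], of "e i x"]
        by (simp_all add: homD[OF e[OF i]] cl)
    qed
    then show ?thesis using sep x a_inv_closed[of x] by (auto simp: cl)
  qed
  moreover have "[p] \<cdot>\<^bsub>toring S\<^esub> wroot S p x = zero S \<and>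
        (let q = [p] \<cdot>\<^bsub>toring S\<^esub> one S; e = one S \<ominus>\<^bsub>toring S\<^esub> mul S q (winv S q)
         in mul S e (wroot S p x [^]\<^bsub>toring S\<^esub> p) = mul S e x)"
    if p: "prime p" and x: "x \<in> carrier S" for p x
  proof -
    let ?q = "[p] \<cdot>\<^bsub>toring S\<^esub> one S"
    let ?e = "one S \<ominus>\<^bsub>toring S\<^esub> mul S ?q (winv S ?q)"
    let ?r = "wroot S p x"
    have r: "?r \<in> carrier S" using p x by (simp add: cl)
    have rp: "?r [^]\<^bsub>toring S\<^esub> p \<in> carrier S" "[p] \<cdot>\<^bsub>toring S\<^esub> ?r \<in> carrier S"
      using nat_pow_closed[of ?r p] add.nat_pow_closed[of ?r p] r by simp_all
    have q: "?q \<in> carrier S" using add.nat_pow_closed[of "one S" p] by (simp add: cl)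
    have m: "mul S ?q (winv S ?q) \<in> carrier S" using q by (simp add: cl)
    have ee: "?e \<in> carrier S" using minus_closed[of "one S" "mul S ?q (winv S ?q)"] m by (simp add: cl)
    have "e i ([p] \<cdot>\<^bsub>toring S\<^esub> ?r) = e i (zero S)"
      "e i (mul S ?e (?r [^]\<^bsub>toring S\<^esub> p)) = e i (mul S ?e x)" if i: "i \<in> I" for i
    proof -
      interpret h: ring_hom_cring "toring S" "toring (F i)" "e i" by (rule e_hom[OF i])
      have x': "e i x \<in> carrier (F i)" using homD[OF e[OF i]] x by simp
      show "e i ([p] \<cdot>\<^bsub>toring S\<^esub> ?r) = e i (zero S)"
        using h.hom_add_pow[of ?r p] r p x icm_identitiesD(6)[OF F[OF i] p x']
        by (simp add: homD[OF e[OF i]] hom_zero_one[OF e[OF i]])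
      have q': "e i ?q = [p] \<cdot>\<^bsub>toring (F i)\<^esub> one (F i)"
        using h.hom_add_pow[of "one S" p] by (simp add: cl hom_zero_one[OF e[OF i]])
      have e': "e i ?e = one (F i) \<ominus>\<^bsub>toring (F i)\<^esub> mul (F i) (e i ?q) (winv (F i) (e i ?q))"
        using h.hom_add[of "one S" "\<ominus>\<^bsub>toring S\<^esub> mul S ?q (winv S ?q)"] h.hom_a_inv[of "mul S ?q (winv S ?q)"]
          a_inv_closed[of "mul S ?q (winv S ?q)"] m q
        by (simp add: a_minus_def homD[OF e[OF i]] hom_zero_one[OF e[OF i]] cl)
      show "e i (mul S ?e (?r [^]\<^bsub>toring S\<^esub> p)) = e i (mul S ?e x)"
        using icm_identitiesD(7)[OF F[OF i] p x' q' e'] h.hom_pow[of ?r p] r rp ee x p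
        by (simp add: homD[OF e[OF i]])
    qed
    then show ?thesis using sep rp ee x by (simp add: cl Let_def)
  qed
  ultimately show ?thesis unfolding icm_identities_def using S cr by blast
qed

text \<open>In a field, \<open>y w y = y\<close> and \<open>w y w = w\<close> leave only one
  \<open>w\<close>. As for roots, in characteristic p the idempotent of
  \<open>icm_identities\<close> goes to \<open>1\<close>, so the image of the weak root is a p-th
  root, and that is unique. Otherwise the p-fold sum of the image is zero while \<open>p\<close> is
  invertible.\<close>

lemma hom_to_implicitly_closed_field:
  assumes S: "icm_identities S" and F: "implicitly_closed_field F"
    and f: "f \<in> ring_hom (toring S) (toring F)"
  shows "hom S F f"
proof -
  have fa: "field_ax F" using F by (simp add: implicitly_closed_field_def weakly_rooted_def)
  interpret F: field "toring F" using fa by (rule field_toring)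
  interpret S: cring "toring S" by (rule icm_identitiesD(2)[OF S])
  interpret h: ring_hom_cring "toring S" "toring F" f using f by unfold_locales
  note cl = is_algD[OF icm_identitiesD(1)[OF S]]
  note iF = icm_identities_field[OF F]
  note clF = is_algD[OF icm_identitiesD(1)[OF iF]]
  have fc: "f x \<in> carrier F" if "x \<in> carrier S" for x using h.hom_closed[of x] that by simp
  have fm: "f (mul S x y) = mul F (f x) (f y)" if "x \<in> carrier S" "y \<in> carrier S" for x y
    using h.hom_mult[of x y] that by simp
  have winv: "f (winv S x) = winv F (f x)" if x: "x \<in> carrier S" for x
  proof -
    let ?y = "f x" and ?w = "f (winv S x)"
    have c: "?y \<in> carrier F" "?w \<in> carrier F" using x fc cl by auto
    have 1: "mul F (mul F ?y ?w) ?y = ?y" "mul F (mul F ?w ?y) ?w = ?w"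
      using fm[symmetric] icm_identitiesD(4,5)[OF S x] x by (simp_all add: cl)
    show ?thesis
    proof (cases "?y = zero F")
      case True
      have "?w = zero F" using 1(2) F.l_null[of ?w] F.r_null[of ?w] c True by simp
      then show ?thesis using True F by (simp add: implicitly_closed_field_def)
    next
      case False
      have inv: "winv F ?y \<in> carrier F" "mul F ?y (winv F ?y) = one F"
        using F c False by (auto simp: implicitly_closed_field_def)
      have "mul F ?y (mul F ?w ?y) = mul F ?y (one F)"
        using 1(1) F.m_assoc[of ?y ?w ?y] F.r_one[of ?y] c by simp
      then have "mul F ?w ?y = one F"
        using F.m_lcancel[of ?y "mul F ?w ?y" "one F"] False c clF by simp
      then have "?w = mul F (mul F ?w ?y) (winv F ?y)"
        using inv F.m_assoc[of ?w ?y "winv F ?y"] F.r_one[of ?w] c by simp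
      also have "\<dots> = winv F ?y" using \<open>mul F ?w ?y = one F\<close> F.l_one[of "winv F ?y"] inv by simp
      finally show ?thesis .
    qed
  qed
  have root: "f (wroot S p x) = wroot F p (f x)" if p: "prime p" and x: "x \<in> carrier S" for p x
  proof -
    let ?r = "wroot S p x" and ?q = "[p] \<cdot>\<^bsub>toring S\<^esub> one S" and ?qF = "[p] \<cdot>\<^bsub>toring F\<^esub> one F"
    have r: "?r \<in> carrier S" using p x cl by simp
    have q: "?q \<in> carrier S" using S.add.nat_pow_closed[of "one S" p] by (simp add: cl)
    have fq: "f ?q = ?qF" using h.hom_of_nat[of p] by simp
    have ch: "char_is F p \<longleftrightarrow> ?qF = zero F"
      using p natmult_eq[OF F.is_cring, of "one F"] clF(2) by (simp add: char_is_def)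
    have rF: "if char_is F p then apow F (wroot F p (f x)) p = f x else wroot F p (f x) = zero F"
      using F p fc[OF x] by (simp add: implicitly_closed_field_def)
    show ?thesis
    proof (cases "char_is F p")
      case True
      then have q0: "?qF = zero F" using ch by simp
      let ?m = "mul S ?q (winv S ?q)" and ?e = "one S \<ominus>\<^bsub>toring S\<^esub> mul S ?q (winv S ?q)"
      have m: "?m \<in> carrier S" using q cl by simp
      have e: "?e \<in> carrier S" using S.minus_closed[of "one S" ?m] m by (simp add: cl)
      have "f ?m = zero F" using fm[of ?q "winv S ?q"] fq q0 q F.l_null[of "f (winv S ?q)"] fc cl by simp
      then have "f ?e = one F"
        using h.hom_add[of "one S" "\<ominus>\<^bsub>toring S\<^esub> ?m"] h.hom_a_inv[of ?m] S.a_inv_closed[of ?m] m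
          F.minus_zero F.r_zero[of "one F"] h.hom_one
        by (simp add: a_minus_def cl clF)
      moreover have rp: "?r [^]\<^bsub>toring S\<^esub> p \<in> carrier S" using S.nat_pow_closed[of ?r p] r by simp
      moreover have "f (mul S ?e (?r [^]\<^bsub>toring S\<^esub> p)) = f (mul S ?e x)"
        using icm_identitiesD(7)[OF S p x refl refl] by simp
      ultimately have "f (?r [^]\<^bsub>toring S\<^esub> p) = f x"
        using fm[OF e rp] fm[OF e x] F.l_one[of "f x"] F.l_one[of "f (?r [^]\<^bsub>toring S\<^esub> p)"] fc x by simp
      then have "f ?r [^]\<^bsub>toring F\<^esub> p = wroot F p (f x) [^]\<^bsub>toring F\<^esub> p"
        using h.hom_pow[of ?r p] r rF True apow_eq[OF F.is_cring, of "wroot F p (f x)" p] clF(7)[OF p fc[OF x]]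
        by simp
      then show ?thesis
        using F.root_unique[OF p, of "f ?r" "wroot F p (f x)" 1] q0 fc[OF r] clF(7)[OF p fc[OF x]] by simp
    next
      case False
      then have q0: "?qF \<noteq> zero F" using ch by simp
      have "[p] \<cdot>\<^bsub>toring F\<^esub> f ?r = zero F"
        using h.hom_add_pow[of ?r p] icm_identitiesD(6)[OF S p x] r h.hom_zero by simp
      moreover have "mul F ?qF (f ?r) = [p] \<cdot>\<^bsub>toring F\<^esub> f ?r"
        using F.add_pow_ldistr[of "one F" "f ?r" p] F.l_one[of "f ?r"] fc[OF r] clF by simp
      ultimately have "f ?r = zero F"
        using F.integral[of ?qF "f ?r"] q0 fc[OF r] F.add.nat_pow_closed[of "one F" p] clF by simp
      then show ?thesis using rF False by simp
    qed
  qed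
  show ?thesis
    unfolding hom_def
    using h.hom_zero h.hom_one h.hom_add h.hom_mult h.hom_a_inv fc winv root
      icm_identitiesD(3)[OF S] neg_eq_a_inv[OF fa] by simp
qed

lemma field_hom_eq_zero:
  assumes "field L" "field K" "g \<in> ring_hom L K" "x \<in> car L" "g x = \<zero>\<^bsub>K\<^esub>"
  shows "x = \<zero>\<^bsub>L\<^esub>"
proof (rule ccontr)
  interpret L: field L by fact
  interpret K: field K by fact
  interpret h: ring_hom_cring L K g using assms(3) by unfold_locales
  assume "x \<noteq> \<zero>\<^bsub>L\<^esub>"
  then have x: "x \<in> Units L" using assms(4) by (simp add: L.field_Units)
  then have "g (x \<otimes>\<^bsub>L\<^esub> inv\<^bsub>L\<^esub> x) = \<zero>\<^bsub>K\<^esub>" using assms(4,5) by (subst h.hom_mult) auto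
  then show False using x by simp
qed

text \<open>The idempotent of \<open>icm_identities\<close> goes to \<open>1\<close> here. Hence
  images of \<open>S\<close>, and of its subalgebras, in such a domain have p-th roots.\<close>

lemma root_in_domain:
  assumes S: "icm_identities S" and "domain L" and \<alpha>: "\<alpha> \<in> ring_hom (toring S) L"
    and p: "prime p" "[(p::nat)] \<cdot>\<^bsub>L\<^esub> \<one>\<^bsub>L\<^esub> = \<zero>\<^bsub>L\<^esub>" and x: "x \<in> carrier S"
  shows "\<alpha> (wroot S p x) [^]\<^bsub>L\<^esub> p = \<alpha> x"
proof -
  interpret L: domain L by fact
  interpret S: cring "toring S" by (rule icm_identitiesD(2)[OF S])
  interpret h: ring_hom_cring "toring S" L \<alpha> using \<alpha> by unfold_locales
  note cl = is_algD[OF icm_identitiesD(1)[OF S]]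
  let ?r = "wroot S p x" and ?q = "[p] \<cdot>\<^bsub>toring S\<^esub> one S"
  let ?m = "mul S ?q (winv S ?q)" and ?e = "one S \<ominus>\<^bsub>toring S\<^esub> mul S ?q (winv S ?q)"
  have r: "?r \<in> carrier S" using p x cl by simp
  have q: "?q \<in> carrier S" using S.add.nat_pow_closed[of "one S" p] by (simp add: cl)
  have m: "?m \<in> carrier S" using q cl by simp
  have e: "?e \<in> carrier S" using S.minus_closed[of "one S" ?m] m by (simp add: cl)
  have rp: "?r [^]\<^bsub>toring S\<^esub> p \<in> carrier S" using S.nat_pow_closed[of ?r p] r by simp
  have "\<alpha> ?m = \<zero>\<^bsub>L\<^esub>"
    using h.hom_mult[of ?q "winv S ?q"] h.hom_of_nat[of p] p(2) q h.hom_closed[of "winv S ?q"] cl by simp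
  then have "\<alpha> ?e = \<one>\<^bsub>L\<^esub>"
    using h.hom_add[of "one S" "\<ominus>\<^bsub>toring S\<^esub> ?m"] h.hom_a_inv[of ?m] S.a_inv_closed[of ?m] m h.hom_one
    by (simp add: a_minus_def cl)
  moreover have "\<alpha> (mul S ?e (?r [^]\<^bsub>toring S\<^esub> p)) = \<alpha> (mul S ?e x)"
    using icm_identitiesD(7)[OF S p(1) x refl refl] by simp
  ultimately have "\<alpha> (?r [^]\<^bsub>toring S\<^esub> p) = \<alpha> x"
    using h.hom_mult[of ?e "?r [^]\<^bsub>toring S\<^esub> p"] h.hom_mult[of ?e x] h.hom_closed[of x]
      h.hom_closed[of "?r [^]\<^bsub>toring S\<^esub> p"] e rp x by simp
  then show ?thesis using h.hom_pow[of ?r p] r by simp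
qed

text \<open>Because \<open>\<alpha>\<close> and \<open>\<beta>\<close> vanish at the same elements
  of \<open>A0\<close>, the pairs \<open>(\<alpha> a, \<beta> a)\<close> form a common subfield; the
  assumption on \<open>b\<close> says exactly that \<open>(\<alpha> b, \<beta> b)\<close> is not one
  of them.\<close>

lemma separate_points:
  fixes S :: "'a alg" and L :: "'l ring" and M :: "'m ring"
  assumes S: "icm_identities S" and A0: "A0 \<subseteq> carrier S" "is_alg (S\<lparr>carrier := A0\<rparr>)"
    and LM: "field L" "field M"
    and \<alpha>: "\<alpha> \<in> ring_hom (toring S) L" "\<alpha> ` carrier S = car L"
    and \<beta>: "\<beta> \<in> ring_hom (toring S) M" "\<beta> ` carrier S = car M"
    and zero_iff: "\<And>a. a \<in> A0 \<Longrightarrow> \<alpha> a = \<zero>\<^bsub>L\<^esub> \<longleftrightarrow> \<beta> a = \<zero>\<^bsub>M\<^esub>"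
    and b: "b \<in> carrier S" "\<not> (\<exists>a\<in>A0. \<alpha> a = \<alpha> b \<and> \<beta> a = \<beta> b)"
  obtains K :: "((('m \<Rightarrow> 'l) \<Rightarrow> 'm \<Rightarrow> 'l) set \<times> (('m \<Rightarrow> 'l) \<Rightarrow> 'm \<Rightarrow> 'l) set) set alg" and g h
  where "implicitly_closed_field K" "hom S K g" "hom S K h" "\<And>a. a \<in> A0 \<Longrightarrow> g a = h a" "g b \<noteq> h b"
proof -
  interpret L: field L by fact
  interpret M: field M by fact
  interpret R: cring "toring S" by (rule icm_identitiesD(2)[OF S])
  interpret \<alpha>: ring_hom_cring "toring S" L \<alpha> using \<alpha>(1) by unfold_locales
  interpret \<beta>: ring_hom_cring "toring S" M \<beta> using \<beta>(1) by unfold_locales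
  note cl = is_algD[OF A0(2), simplified]
  have c: "x \<in> carrier S" if "x \<in> A0" for x using A0(1) that by blast
  define k where "k = (\<lambda>a. (\<alpha> a, \<beta> a)) ` A0"
  have kI: "(\<alpha> a, \<beta> a) \<in> k" if "a \<in> A0" for a using that by (simp add: k_def)
  interpret field_pair L M k
  proof (unfold_locales, goal_cases)
    case (1 x y)
    then show ?case using \<alpha>.hom_closed \<beta>.hom_closed c by (auto simp: k_def)
  next
    case 2
    show ?case using kI[OF cl(2)] \<alpha>.hom_one \<beta>.hom_one by simp
  next
    case (3 x y)
    then obtain a where a: "a \<in> A0" "x = \<alpha> a" "y = \<beta> a" by (auto simp: k_def)
    show ?case
      using kI[OF cl(5)[OF a(1)]] \<alpha>.hom_a_inv[of a] \<beta>.hom_a_inv[of a] icm_identitiesD(3)[OF S c[OF a(1)]] a c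
      by simp
  next
    case (4 x y x' y')
    then obtain a a' where a: "a \<in> A0" "x = \<alpha> a" "y = \<beta> a" "a' \<in> A0" "x' = \<alpha> a'" "y' = \<beta> a'"
      by (auto simp: k_def)
    show ?case
      using kI[OF cl(3)[OF a(1,4)]] \<alpha>.hom_add[of a a'] \<beta>.hom_add[of a a'] a c by simp
  next
    case (5 x y x' y')
    then obtain a a' where a: "a \<in> A0" "x = \<alpha> a" "y = \<beta> a" "a' \<in> A0" "x' = \<alpha> a'" "y' = \<beta> a'"
      by (auto simp: k_def)
    show ?case
      using kI[OF cl(4)[OF a(1,4)]] \<alpha>.hom_mult[of a a'] \<beta>.hom_mult[of a a'] a c by simp
  next
    case (6 x y)
    then show ?case using zero_iff by (auto simp: k_def)
  next
    case (7 x y)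
    then obtain a where a: "a \<in> A0" "x = \<alpha> a" "y = \<beta> a" by (auto simp: k_def)
    \<comment> \<open>\<open>winv S a\<close> supplies the inverse scalar: the identity
      \<open>a winv(a) a = a\<close> is mapped to \<open>M\<close>, and the nonzero
      \<open>\<beta> a\<close> is cancelled.\<close>
    have w: "winv S a \<in> A0" using cl a by simp
    have "\<beta> (mul S (mul S a (winv S a)) a) = \<beta> a" using icm_identitiesD(4)[OF S] a c by simp
    moreover have aw: "mul S a (winv S a) \<in> A0" using cl a w by simp
    ultimately have "\<beta> a \<otimes>\<^bsub>M\<^esub> \<beta> (winv S a) \<otimes>\<^bsub>M\<^esub> \<beta> a = \<one>\<^bsub>M\<^esub> \<otimes>\<^bsub>M\<^esub> \<beta> a"
      using \<beta>.hom_mult[of a "winv S a"] \<beta>.hom_mult[of "mul S a (winv S a)" a] \<beta>.hom_closed[of a] a w c[OF aw] c by simp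
    then have "\<beta> a \<otimes>\<^bsub>M\<^esub> \<beta> (winv S a) = \<one>\<^bsub>M\<^esub>"
      using M.m_rcancel[of "\<beta> a" "\<beta> a \<otimes>\<^bsub>M\<^esub> \<beta> (winv S a)" "\<one>\<^bsub>M\<^esub>"] \<beta>.hom_closed 7(2) a w c by simp
    then have "\<beta> (winv S a) \<otimes>\<^bsub>M\<^esub> \<beta> a = \<one>\<^bsub>M\<^esub>"
      using M.m_comm[of "\<beta> a" "\<beta> (winv S a)"] \<beta>.hom_closed a w c by simp
    then show ?case using kI[OF w] a by auto
  qed
  have p_iff: "[p] \<cdot>\<^bsub>L\<^esub> \<one>\<^bsub>L\<^esub> = \<zero>\<^bsub>L\<^esub> \<longleftrightarrow> [p] \<cdot>\<^bsub>M\<^esub> \<one>\<^bsub>M\<^esub> = \<zero>\<^bsub>M\<^esub>" for p :: nat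
    using k_zero_iff[OF k_of_nat] .
  have frob: "frobenius_surj L p" "frobenius_surj M p"
    if p: "prime p" "[p] \<cdot>\<^bsub>L\<^esub> \<one>\<^bsub>L\<^esub> = \<zero>\<^bsub>L\<^esub>" for p :: nat
  proof -
    have w: "wroot S p x \<in> carrier S" if "x \<in> carrier S" for x
      using is_algD(7)[OF icm_identitiesD(1)[OF S] p(1) that] .
    have "\<exists>r\<in>car L. r [^]\<^bsub>L\<^esub> p = \<alpha> x" "\<exists>r\<in>car M. r [^]\<^bsub>M\<^esub> p = \<beta> x" if x: "x \<in> carrier S" for x
      using root_in_domain[OF S L.domain_axioms \<alpha>(1) p x]
        root_in_domain[OF S M.domain_axioms \<beta>(1) p(1) p(2)[unfolded p_iff] x]
        \<alpha>.hom_closed[of "wroot S p x"] \<beta>.hom_closed[of "wroot S p x"] w[OF x] by auto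
    then show "frobenius_surj L p" "frobenius_surj M p"
      unfolding frobenius_surj_def \<alpha>(2)[symmetric] \<beta>(2)[symmetric] by blast+
  qed
  have char: "(\<forall>n::nat. n > 0 \<longrightarrow> [n] \<cdot>\<^bsub>M\<^esub> \<one>\<^bsub>M\<^esub> \<noteq> \<zero>\<^bsub>M\<^esub>) \<or>
      (\<exists>p::nat. prime p \<and> [p] \<cdot>\<^bsub>L\<^esub> \<one>\<^bsub>L\<^esub> = \<zero>\<^bsub>L\<^esub> \<and> has_roots p)"
  proof (cases "\<forall>n::nat. n > 0 \<longrightarrow> [n] \<cdot>\<^bsub>M\<^esub> \<one>\<^bsub>M\<^esub> \<noteq> \<zero>\<^bsub>M\<^esub>")
    case False
    then obtain p :: nat where p: "prime p" "[p] \<cdot>\<^bsub>M\<^esub> \<one>\<^bsub>M\<^esub> = \<zero>\<^bsub>M\<^esub>"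
      using M.exists_prime_char by blast
    then have pL: "[p] \<cdot>\<^bsub>L\<^esub> \<one>\<^bsub>L\<^esub> = \<zero>\<^bsub>L\<^esub>" using p_iff by blast
    \<comment> \<open>Closure of \<open>A0\<close> under \<open>wroot\<close> makes the common
      subfield perfect: one root in \<open>A0\<close> serves both components of a pair.\<close>
    have "has_roots p"
      unfolding has_roots_def
    proof
      fix cd assume "cd \<in> k"
      then obtain a where a: "a \<in> A0" "cd = (\<alpha> a, \<beta> a)" by (auto simp: k_def)
      have "(\<alpha> (wroot S p a), \<beta> (wroot S p a)) \<in> k" using kI cl(7)[OF p(1) a(1)] by blast
      then show "case cd of (c, d) \<Rightarrow> \<exists>(c', d')\<in>k. c' [^]\<^bsub>L\<^esub> p = c \<and> d' [^]\<^bsub>M\<^esub> p = d"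
        using root_in_domain[OF S L.domain_axioms \<alpha>(1) p(1) pL c[OF a(1)]]
          root_in_domain[OF S M.domain_axioms \<beta>(1) p c[OF a(1)]] a by auto
    qed
    then show ?thesis using p pL by blast
  qed blast
  have bc: "\<alpha> b \<in> car L" "\<beta> b \<in> car M" using \<alpha>.hom_closed[of b] \<beta>.hom_closed[of b] b by auto
  have bk: "(\<alpha> b, \<beta> b) \<notin> k" using b(2) by (auto simp: k_def)
  obtain K :: "((('m \<Rightarrow> 'l) \<Rightarrow> 'm \<Rightarrow> 'l) set \<times> (('m \<Rightarrow> 'l) \<Rightarrow> 'm \<Rightarrow> 'l) set) set ring" and g h
    where K: "field K" "g \<in> ring_hom L K" "h \<in> ring_hom M K" "\<forall>(c, d)\<in>k. g c = h d" "g (\<alpha> b) \<noteq> h (\<beta> b)"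
    "\<forall>p::nat. prime p \<and> [p] \<cdot>\<^bsub>L\<^esub> \<one>\<^bsub>L\<^esub> = \<zero>\<^bsub>L\<^esub> \<and> frobenius_surj L p \<and> frobenius_surj M p \<longrightarrow> frobenius_surj K p"
    by (rule exists_separating_field[OF bc bk char])
  interpret K: field K by (rule K(1))
  interpret g: ring_hom_cring L K g using K(2) by unfold_locales
  have "implicitly_closed_field (of_field K)"
  proof (rule implicitly_closed_field_of_field[OF K(1)])
    show "(\<forall>n::nat. n > 0 \<longrightarrow> [n] \<cdot>\<^bsub>K\<^esub> \<one>\<^bsub>K\<^esub> \<noteq> \<zero>\<^bsub>K\<^esub>) \<or> (\<exists>p::nat. prime p \<and> [p] \<cdot>\<^bsub>K\<^esub> \<one>\<^bsub>K\<^esub> = \<zero>\<^bsub>K\<^esub>)"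
      using K.exists_prime_char by blast
  next
    fix p :: nat assume p: "prime p" "[p] \<cdot>\<^bsub>K\<^esub> \<one>\<^bsub>K\<^esub> = \<zero>\<^bsub>K\<^esub>"
    then have "g ([p] \<cdot>\<^bsub>L\<^esub> \<one>\<^bsub>L\<^esub>) = \<zero>\<^bsub>K\<^esub>" by (simp add: g.hom_of_nat)
    then have pL: "[p] \<cdot>\<^bsub>L\<^esub> \<one>\<^bsub>L\<^esub> = \<zero>\<^bsub>L\<^esub>"
      by (rule field_hom_eq_zero[OF LM(1) K(1,2) L.add.nat_pow_closed[OF L.one_closed]])
    show "frobenius_surj K p" using K(6) p(1) pL frob[OF p(1) pL] by blast
  qed
  moreover from this have "hom S (of_field K) (g \<circ> \<alpha>)" "hom S (of_field K) (h \<circ> \<beta>)"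
    using ring_hom_trans[OF \<alpha>(1) K(2)] ring_hom_trans[OF \<beta>(1) K(3)]
    by (auto intro!: hom_to_implicitly_closed_field[OF S])
  moreover have "(g \<circ> \<alpha>) a = (h \<circ> \<beta>) a" if "a \<in> A0" for a using bspec[OF K(4) kI[OF that]] by simp
  moreover have "(g \<circ> \<alpha>) b \<noteq> (h \<circ> \<beta>) b" using K(5) by simp
  ultimately show thesis by (rule that)
qed

section \<open>Prime ideals in rings with weak inverses\<close>

lemma (in cring) idealI_cring:
  assumes "I \<subseteq> car R" "\<zero> \<in> I" "\<And>x y. x \<in> I \<Longrightarrow> y \<in> I \<Longrightarrow> x \<oplus> y \<in> I"
    "\<And>r x. r \<in> car R \<Longrightarrow> x \<in> I \<Longrightarrow> r \<otimes> x \<in> I"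
  shows "ideal I R"
proof (rule idealI)
  show "subgroup I (add_monoid R)"
  proof (rule add.subgroupI)
    fix x assume x: "x \<in> I"
    then have "\<ominus> \<one> \<otimes> x \<in> I" using assms(4) by blast
    moreover have "\<ominus> \<one> \<otimes> x = \<ominus> x" using x assms(1) by (auto simp: l_minus)
    ultimately show "\<ominus> x \<in> I" by simp
  qed (use assms in auto)
  fix x r assume xr: "x \<in> I" "r \<in> car R"
  then show "r \<otimes> x \<in> I" by (rule assms(4)[rotated])
  then show "x \<otimes> r \<in> I" using xr assms(1) m_comm[of r x] by auto
qed (rule ring_axioms)

lemma winv_idempotent:
  assumes S: "icm_identities S" and x: "x \<in> carrier S"
  shows "mul S x (one S \<ominus>\<^bsub>toring S\<^esub> mul S x (winv S x)) = zero S"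
proof -
  interpret S: cring "toring S" by (rule icm_identitiesD(2)[OF S])
  note cl = is_algD[OF icm_identitiesD(1)[OF S]]
  let ?m = "mul S x (winv S x)"
  have m: "?m \<in> carrier S" using cl x by simp
  have "mul S x ?m = x" using icm_identitiesD(4)[OF S x] S.m_comm[of x ?m] x m by simp
  then show ?thesis
    using S.r_distr[of "one S" "\<ominus>\<^bsub>toring S\<^esub> ?m" x] S.a_inv_closed[of ?m] S.r_minus[of x ?m] S.r_one[of x]
      S.r_neg[of x] x m by (simp add: a_minus_def cl)
qed

text \<open>The product of \<open>x\<close> with this element is zero, hence in \<open>P\<close>,
  and \<open>x\<close> is not in \<open>P\<close>.\<close>

lemma winv_prime:
  assumes S: "icm_identities S" and P: "primeideal P (toring S)" and x: "x \<in> carrier S" "x \<notin> P"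
  shows "one S \<ominus>\<^bsub>toring S\<^esub> mul S x (winv S x) \<in> P"
proof -
  interpret S: cring "toring S" by (rule icm_identitiesD(2)[OF S])
  interpret P: primeideal P "toring S" by fact
  note cl = is_algD[OF icm_identitiesD(1)[OF S]]
  let ?m = "mul S x (winv S x)"
  have m: "?m \<in> carrier S" using cl x by simp
  have "one S \<ominus>\<^bsub>toring S\<^esub> ?m \<in> carrier S" using S.minus_closed[of "one S" ?m] m by (simp add: cl)
  moreover have "mul S x (one S \<ominus>\<^bsub>toring S\<^esub> ?m) \<in> P"
    using winv_idempotent[OF S x(1)] P.zero_closed by simp
  ultimately show ?thesis using P.I_prime[of x "one S \<ominus>\<^bsub>toring S\<^esub> ?m"] x by auto
qed

text \<open>By \<open>winv_prime\<close>, \<open>winv S x\<close> is an inverse of \<open>x\<close>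
  modulo \<open>P\<close>; primes of a von Neumann regular ring are maximal.\<close>

lemma field_Quot:
  assumes S: "icm_identities S" and P: "primeideal P (toring S)"
  shows "field (toring S Quot P)"
proof -
  interpret S: cring "toring S" by (rule icm_identitiesD(2)[OF S])
  interpret P: primeideal P "toring S" by fact
  interpret D: domain "toring S Quot P" by (rule P.quotient_is_domain)
  interpret h: ring_hom_cring "toring S" "toring S Quot P" "(+>\<^bsub>toring S\<^esub>) P" by (rule P.rcos_ring_hom_cring)
  note cl = is_algD[OF icm_identitiesD(1)[OF S]]
  show ?thesis
  proof (rule D.cring_fieldI2)
    fix X assume X: "X \<in> car (toring S Quot P)" "X \<noteq> \<zero>\<^bsub>toring S Quot P\<^esub>"
    then obtain x where x: "x \<in> carrier S" "X = P +>\<^bsub>toring S\<^esub> x"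
      using Quot_image[of "toring S" P] by auto
    have "x \<notin> P" using X(2) x P.a_rcos_const[of x] by (auto simp: Quot_zero)
    from winv_prime[OF S P x(1) this]
    have "P +>\<^bsub>toring S\<^esub> one S = P +>\<^bsub>toring S\<^esub> mul S x (winv S x)"
      using S.quotient_eq_iff_same_a_r_cos[OF P.is_ideal, of "one S" "mul S x (winv S x)"] x cl by simp
    then have "X \<otimes>\<^bsub>toring S Quot P\<^esub> (P +>\<^bsub>toring S\<^esub> winv S x) = \<one>\<^bsub>toring S Quot P\<^esub>"
      using h.hom_mult[of x "winv S x"] h.hom_one x cl by simp
    then show "\<exists>Y\<in>car (toring S Quot P). X \<otimes>\<^bsub>toring S Quot P\<^esub> Y = \<one>\<^bsub>toring S Quot P\<^esub>"
      using h.hom_closed[of "winv S x"] x cl by auto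
  qed (rule D.zero_not_one)
qed

section \<open>Separating an element from a subalgebra\<close>

lemma (in cring) minus_minus_minus:
  "x \<in> car R \<Longrightarrow> y \<in> car R \<Longrightarrow> z \<in> car R \<Longrightarrow> x \<ominus> y = (x \<ominus> z) \<oplus> \<ominus> (y \<ominus> z)"
  by algebra

lemma (in cring) minus_add_minus:
  "x \<in> car R \<Longrightarrow> y \<in> car R \<Longrightarrow> z \<in> car R \<Longrightarrow> x \<ominus> z = (x \<ominus> y) \<oplus> (y \<ominus> z)"
  by algebra

lemma separate_from_subalgebra:
  fixes S :: "'a alg"
  assumes S: "icm_identities S" and A0: "A0 \<subseteq> carrier S" "is_alg (S\<lparr>carrier := A0\<rparr>)"
    and b: "b \<in> carrier S" "b \<notin> A0"
  obtains K :: "((('a set \<Rightarrow> 'a set) \<Rightarrow> 'a set \<Rightarrow> 'a set) set \<times> (('a set \<Rightarrow> 'a set) \<Rightarrow> 'a set \<Rightarrow> 'a set) set) set alg"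
    and g h
  where "implicitly_closed_field K" "hom S K g" "hom S K h" "\<And>a. a \<in> A0 \<Longrightarrow> g a = h a" "g b \<noteq> h b"
proof -
  let ?A = "S\<lparr>carrier := A0\<rparr>"
  interpret R: cring "toring S" by (rule icm_identitiesD(2)[OF S])
  note cl = is_algD[OF icm_identitiesD(1)[OF S]]
  note clA = is_algD[OF A0(2), simplified]
  have c: "x \<in> carrier S" if "x \<in> A0" for x using A0(1) that by blast
  have IA: "icm_identities ?A"
    by (rule icm_identities_separated[of _ "{()}" "\<lambda>_. S" "\<lambda>_ x. x"])
      (use S A0 in \<open>auto simp: hom_def\<close>)
  interpret A: cring "toring ?A" by (rule icm_identitiesD(2)[OF IA])
  \<comment> \<open>The conductor of \<open>b\<close> into \<open>A0\<close>. It misses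
    \<open>1\<close> because \<open>b\<close> is not in \<open>A0\<close>, so avoiding the powers of
    \<open>1\<close> gives a prime above it.\<close>
  define I where "I = {x \<in> A0. mul S x b \<in> A0}"
  have "ideal I (toring ?A)"
  proof (rule A.idealI_cring)
    show "\<zero>\<^bsub>toring ?A\<^esub> \<in> I" using R.l_null[of b] b clA by (simp add: I_def)
  next
    fix x y assume "x \<in> I" "y \<in> I"
    then show "x \<oplus>\<^bsub>toring ?A\<^esub> y \<in> I"
      using R.l_distr[of x y b] b c clA by (simp add: I_def)
  next
    fix r x assume "r \<in> car (toring ?A)" "x \<in> I"
    then show "r \<otimes>\<^bsub>toring ?A\<^esub> x \<in> I"
      using R.m_assoc[of r x b] b c clA by (simp add: I_def)
  qed (simp add: I_def)
  moreover have "one S \<notin> I" using R.l_one[of b] b by (simp add: I_def)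
  then have "\<one>\<^bsub>toring ?A\<^esub> [^]\<^bsub>toring ?A\<^esub> (n::nat) \<notin> I" for n
    using A.nat_pow_one[of n] by simp
  ultimately obtain m where m: "primeideal m (toring ?A)" "I \<subseteq> m" "\<one>\<^bsub>toring ?A\<^esub> \<notin> m"
    using A.exists_primeideal_avoiding_powers[OF _ A.one_closed] by metis
  interpret m: primeideal m "toring ?A" by (rule m(1))
  have mA: "m \<subseteq> A0" using m.a_subset by simp
  \<comment> \<open>The kernel of inverting \<open>A0 - m\<close> in \<open>S\<close>. It is the
    ideal generated by \<open>m\<close>: if \<open>s x = 0\<close>, then \<open>x\<close> equals its
    product with \<open>1 - s winv(s)\<close>, which lies in \<open>m\<close>; conversely, elements
    of \<open>m\<close> are shown to lie in \<open>N\<close> in the proof of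
    \<open>mem_iff\<close>.\<close>
  define N where "N = {x \<in> carrier S. \<exists>s\<in>A0 - m. mul S s x = zero S}"
  have N: "ideal N (toring S)"
  proof (rule R.idealI_cring)
    have "mul S (one S) (zero S) = zero S" using R.l_one[of "zero S"] cl by simp
    then show "\<zero>\<^bsub>toring S\<^esub> \<in> N" using clA(2) m(3) cl by (auto simp: N_def)
  next
    fix x y assume "x \<in> N" "y \<in> N"
    then obtain s s' where *: "x \<in> carrier S" "y \<in> carrier S" "s \<in> A0" "s \<notin> m" "s' \<in> A0" "s' \<notin> m"
      "mul S s x = zero S" "mul S s' y = zero S" by (auto simp: N_def)
    have "mul S s s' \<notin> m" using m.I_prime[of s s'] * by auto
    moreover have "mul S s s' \<in> A0" using * clA by simp
    moreover have "mul S (mul S s s') (add S x y) = zero S"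
    proof -
      have "(s \<otimes>\<^bsub>toring S\<^esub> s') \<otimes>\<^bsub>toring S\<^esub> (x \<oplus>\<^bsub>toring S\<^esub> y) =
          s' \<otimes>\<^bsub>toring S\<^esub> (s \<otimes>\<^bsub>toring S\<^esub> x) \<oplus>\<^bsub>toring S\<^esub> s \<otimes>\<^bsub>toring S\<^esub> (s' \<otimes>\<^bsub>toring S\<^esub> y)"
      proof -
        have "s \<in> car (toring S)" "s' \<in> car (toring S)" "x \<in> car (toring S)" "y \<in> car (toring S)"
          using * c by simp_all
        then show ?thesis by (simp only: R.r_distr R.m_closed R.m_ac)
      qed
      then show ?thesis using * c R.r_null[of s] R.r_null[of s'] R.l_zero[of "zero S"] cl by simp
    qed
    ultimately show "x \<oplus>\<^bsub>toring S\<^esub> y \<in> N" using * cl unfolding N_def by auto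
  next
    fix r x assume r: "r \<in> car (toring S)" and "x \<in> N"
    then obtain s where *: "x \<in> carrier S" "s \<in> A0" "s \<notin> m" "mul S s x = zero S" by (auto simp: N_def)
    have "mul S s (mul S r x) = zero S"
      using R.m_lcomm[of s r x] R.r_null[of r] * r c by simp
    then show "r \<otimes>\<^bsub>toring S\<^esub> x \<in> N" using * r cl unfolding N_def by auto
  qed (auto simp: N_def)
  have radical: "x \<in> N" if x: "x \<in> carrier S" and pow: "x [^]\<^bsub>toring S\<^esub> (n::nat) \<in> N" for x n
  proof -
    obtain s where s: "s \<in> A0" "s \<notin> m" "mul S s (x [^]\<^bsub>toring S\<^esub> n) = zero S"
      using pow by (auto simp: N_def)
    have "n \<noteq> 0"
    proof
      assume "n = 0"
      then have "s = zero S" using s R.r_one[of s] c by simp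
      then show False using s m.zero_closed by simp
    qed
    \<comment> \<open>As \<open>x = x winv(x) x\<close>, the element \<open>s x^(k+1)\<close> is a
      multiple of \<open>s x^(k+2)\<close>, so the exponent can be lowered down to 1.\<close>
    have down: "mul S s (x [^]\<^bsub>toring S\<^esub> Suc k) = zero S \<Longrightarrow> mul S s x = zero S" for k
    proof (induction k)
      case 0
      then show ?case using R.l_one[of x] x by simp
    next
      case (Suc k)
      have xk: "x [^]\<^bsub>toring S\<^esub> j \<in> car (toring S)" for j :: nat using R.nat_pow_closed x by simp
      have xw: "x \<in> car (toring S)" "winv S x \<in> car (toring S)" "s \<in> car (toring S)" using x s c cl by simp_all
      have "x = x \<otimes>\<^bsub>toring S\<^esub> winv S x \<otimes>\<^bsub>toring S\<^esub> x" using icm_identitiesD(4)[OF S x] by simp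
      then have "s \<otimes>\<^bsub>toring S\<^esub> x [^]\<^bsub>toring S\<^esub> Suc k =
          s \<otimes>\<^bsub>toring S\<^esub> (x [^]\<^bsub>toring S\<^esub> k \<otimes>\<^bsub>toring S\<^esub> (x \<otimes>\<^bsub>toring S\<^esub> winv S x \<otimes>\<^bsub>toring S\<^esub> x))"
        by simp
      also have "\<dots> = (s \<otimes>\<^bsub>toring S\<^esub> x [^]\<^bsub>toring S\<^esub> Suc (Suc k)) \<otimes>\<^bsub>toring S\<^esub> winv S x"
        using xk xw by (simp only: R.nat_pow_Suc R.m_closed R.m_ac)
      also have "\<dots> = zero S" using Suc.prems R.l_null[OF xw(2)] by simp
      finally show ?case using Suc.IH by simp
    qed
    then have "mul S s x = zero S" using s(3) \<open>n \<noteq> 0\<close> not0_implies_Suc by metis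
    then show ?thesis using s x by (auto simp: N_def)
  qed
  \<comment> \<open>From \<open>s (a - b) = 0\<close> it follows that \<open>s b = s a\<close> is in
    \<open>A0\<close>, so \<open>s\<close> belongs to the conductor and hence to
    \<open>m\<close>.\<close>
  have diff_N: "a \<ominus>\<^bsub>toring S\<^esub> b \<notin> N" if a: "a \<in> A0" for a
  proof
    assume "a \<ominus>\<^bsub>toring S\<^esub> b \<in> N"
    then obtain s where s: "s \<in> A0" "s \<notin> m" "mul S s (a \<ominus>\<^bsub>toring S\<^esub> b) = zero S" by (auto simp: N_def)
    have car: "s \<in> car (toring S)" "a \<in> car (toring S)" "b \<in> car (toring S)" using s a b c by simp_all
    have "s \<otimes>\<^bsub>toring S\<^esub> a \<ominus>\<^bsub>toring S\<^esub> s \<otimes>\<^bsub>toring S\<^esub> b = s \<otimes>\<^bsub>toring S\<^esub> (a \<ominus>\<^bsub>toring S\<^esub> b)"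
      using car by (simp only: R.minus_eq R.r_distr R.r_minus R.a_inv_closed)
    then have "s \<otimes>\<^bsub>toring S\<^esub> a \<ominus>\<^bsub>toring S\<^esub> s \<otimes>\<^bsub>toring S\<^esub> b = \<zero>\<^bsub>toring S\<^esub>" using s(3) by simp
    then have "s \<otimes>\<^bsub>toring S\<^esub> a = s \<otimes>\<^bsub>toring S\<^esub> b" using R.r_right_minus_eq car by (metis R.m_closed)
    then have "mul S s b \<in> A0" using clA(4)[OF s(1) a] by simp
    then have "s \<in> I" using s by (simp add: I_def)
    then show False using m(2) s by blast
  qed
  \<comment> \<open>The idempotent annihilating \<open>a\<close>. It must be recognized both in
    \<open>S\<close> and in the ring on \<open>A0\<close>, whose subtractions are formally
    different.\<close>
  let ?u = "\<lambda>a. one S \<ominus>\<^bsub>toring S\<^esub> mul S a (winv S a)"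
  have u: "?u a \<in> A0" "?u a = one S \<ominus>\<^bsub>toring ?A\<^esub> mul S a (winv S a)"
    "add S (?u a) (mul S a (winv S a)) = one S" if a: "a \<in> A0" for a
  proof -
    have w: "mul S a (winv S a) \<in> A0" using a clA by simp
    have "?u a = add S (one S) (neg S (mul S a (winv S a)))"
      using icm_identitiesD(3)[OF S c[OF w]] by (simp add: a_minus_def)
    moreover have "one S \<ominus>\<^bsub>toring ?A\<^esub> mul S a (winv S a) = add S (one S) (neg S (mul S a (winv S a)))"
      using icm_identitiesD(3)[OF IA, of "mul S a (winv S a)"] w by (simp add: a_minus_def)
    ultimately show "?u a \<in> A0" "?u a = one S \<ominus>\<^bsub>toring ?A\<^esub> mul S a (winv S a)"
      using w clA by simp_all
    have car: "one S \<in> car (toring S)" "mul S a (winv S a) \<in> car (toring S)" using w c clA by simp_all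
    have "?u a \<oplus>\<^bsub>toring S\<^esub> mul S a (winv S a) = one S"
      using car by (simp only: R.minus_eq R.a_assoc R.a_inv_closed R.l_neg R.r_zero)
    then show "add S (?u a) (mul S a (winv S a)) = one S" by simp
  qed
  \<comment> \<open>For \<open>x\<close> in \<open>m\<close> the idempotent \<open>?u x\<close> is
    outside \<open>m\<close> and kills \<open>x\<close>, so \<open>x\<close> is in \<open>N\<close>.
    If \<open>a\<close> in \<open>n\<close> were outside \<open>m\<close>, then \<open>?u a\<close>
    would lie in \<open>m\<close>, hence in \<open>n\<close>, and adding \<open>a winv(a)\<close>
    would put \<open>1\<close> into \<open>n\<close>.\<close>
  have mem_iff: "a \<in> n \<longleftrightarrow> a \<in> m" if n: "primeideal n (toring S)" "N \<subseteq> n" and a: "a \<in> A0" for n a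
  proof -
    interpret n: primeideal n "toring S" by (rule n(1))
    have mn: "x \<in> n" if x: "x \<in> m" for x
    proof -
      have xA: "x \<in> A0" using x mA by blast
      have "?u x \<notin> m"
      proof
        assume "?u x \<in> m"
        moreover have "mul S x (winv S x) \<in> m"
          using m.I_r_closed[of x "winv S x"] x xA clA by simp
        ultimately have "one S \<in> m" using m.a_closed[of "?u x" "mul S x (winv S x)"] u(3)[OF xA] by simp
        then show False using m(3) by simp
      qed
      moreover have "mul S (?u x) x = zero S"
        using winv_idempotent[OF S c[OF xA]] R.m_comm[of "?u x" x] c[OF xA] c[OF u(1)[OF xA]] by simp
      ultimately have "x \<in> N" using u(1)[OF xA] c[OF xA] by (auto simp: N_def)
      then show ?thesis using n(2) by blast
    qed
    show ?thesis
    proof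
      assume an: "a \<in> n"
      show "a \<in> m"
      proof (rule ccontr)
        assume "a \<notin> m"
        then have "?u a \<in> m" using winv_prime[OF IA m(1), of a] a u(2)[OF a] by simp
        then have "?u a \<in> n" by (rule mn)
        moreover have "mul S a (winv S a) \<in> n" using n.I_r_closed[of a "winv S a"] an a c cl by simp
        ultimately have "one S \<in> n" using n.a_closed[of "?u a" "mul S a (winv S a)"] u(3)[OF a] by simp
        then show False using n.one_imp_carrier n.I_notcarr by simp
      qed
    qed (rule mn)
  qed
  have point: "\<exists>n. primeideal n (toring S) \<and> N \<subseteq> n \<and> a \<ominus>\<^bsub>toring S\<^esub> b \<notin> n" if a: "a \<in> A0" for a
  proof -
    have d: "a \<ominus>\<^bsub>toring S\<^esub> b \<in> car (toring S)" using a b c by (intro R.minus_closed) simp_all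
    have "(a \<ominus>\<^bsub>toring S\<^esub> b) [^]\<^bsub>toring S\<^esub> (n::nat) \<notin> N" for n
      using radical[of "a \<ominus>\<^bsub>toring S\<^esub> b" n] diff_N[OF a] d by auto
    then show ?thesis using R.exists_primeideal_avoiding_powers[OF N d] by metis
  qed
  \<comment> \<open>\<open>zero S\<close> merely serves as an element of \<open>A0\<close> for which
    \<open>point\<close> yields some prime above \<open>N\<close>.\<close>
  obtain n0 where n0: "primeideal n0 (toring S)" "N \<subseteq> n0" using point[OF clA(1)] by blast
  \<comment> \<open>If no element of \<open>A0\<close> agrees with \<open>b\<close> modulo
    \<open>n0\<close>, then \<open>n0\<close> is used twice. Otherwise \<open>n1\<close> separates
    \<open>b\<close> from one such \<open>a0\<close>. An \<open>a\<close> agreeing with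
    \<open>b\<close> modulo both would give \<open>a0 - a\<close> in \<open>n0\<close>, hence in
    \<open>m\<close> and in \<open>n1\<close>, so \<open>a0\<close> would agree with
    \<open>b\<close> modulo \<open>n1\<close>.\<close>
  have "\<exists>n1. primeideal n1 (toring S) \<and> N \<subseteq> n1 \<and>
      \<not> (\<exists>a\<in>A0. a \<ominus>\<^bsub>toring S\<^esub> b \<in> n0 \<and> a \<ominus>\<^bsub>toring S\<^esub> b \<in> n1)"
  proof (cases "\<exists>a\<in>A0. a \<ominus>\<^bsub>toring S\<^esub> b \<in> n0")
    case False
    then show ?thesis using n0 by blast
  next
    case True
    then obtain a0 where a0: "a0 \<in> A0" "a0 \<ominus>\<^bsub>toring S\<^esub> b \<in> n0" by blast
    obtain n1 where n1: "primeideal n1 (toring S)" "N \<subseteq> n1" "a0 \<ominus>\<^bsub>toring S\<^esub> b \<notin> n1"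
      using point[OF a0(1)] by blast
    interpret n0: primeideal n0 "toring S" by (rule n0(1))
    interpret n1: primeideal n1 "toring S" by (rule n1(1))
    have False if a: "a \<in> A0" "a \<ominus>\<^bsub>toring S\<^esub> b \<in> n0" "a \<ominus>\<^bsub>toring S\<^esub> b \<in> n1" for a
    proof -
      let ?d = "add S a0 (neg S a)"
      have car: "a \<in> car (toring S)" "a0 \<in> car (toring S)" "b \<in> car (toring S)" using a a0 b c by simp_all
      have d: "?d = a0 \<ominus>\<^bsub>toring S\<^esub> a" using icm_identitiesD(3)[OF S c[OF a(1)]] by (simp add: a_minus_def)
      have dA: "?d \<in> A0" using a a0 clA by simp
      have "a0 \<ominus>\<^bsub>toring S\<^esub> a = (a0 \<ominus>\<^bsub>toring S\<^esub> b) \<oplus>\<^bsub>toring S\<^esub> \<ominus>\<^bsub>toring S\<^esub> (a \<ominus>\<^bsub>toring S\<^esub> b)"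
        by (rule R.minus_minus_minus[OF car(2,1,3)])
      then have "?d \<in> n0" unfolding d using n0.a_closed[OF a0(2) n0.a_inv_closed[OF a(2)]] by simp
      then have "?d \<in> n1" using mem_iff[OF n0 dA] mem_iff[OF n1(1,2) dA] by simp
      moreover have "a0 \<ominus>\<^bsub>toring S\<^esub> b = (a0 \<ominus>\<^bsub>toring S\<^esub> a) \<oplus>\<^bsub>toring S\<^esub> (a \<ominus>\<^bsub>toring S\<^esub> b)"
        by (rule R.minus_add_minus[OF car(2,1,3)])
      ultimately have "a0 \<ominus>\<^bsub>toring S\<^esub> b \<in> n1" unfolding d using n1.a_closed[OF _ a(3)] by simp
      then show False using n1(3) by simp
    qed
    then show ?thesis using n1 by blast
  qed
  then obtain n1 where n1: "primeideal n1 (toring S)" "N \<subseteq> n1"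
    "\<not> (\<exists>a\<in>A0. a \<ominus>\<^bsub>toring S\<^esub> b \<in> n0 \<and> a \<ominus>\<^bsub>toring S\<^esub> b \<in> n1)" by blast
  have quot: "(+>\<^bsub>toring S\<^esub>) n \<in> ring_hom (toring S) (toring S Quot n)"
    "(+>\<^bsub>toring S\<^esub>) n ` carrier S = car (toring S Quot n)"
    "\<And>a. a \<in> A0 \<Longrightarrow> n +>\<^bsub>toring S\<^esub> a = \<zero>\<^bsub>toring S Quot n\<^esub> \<longleftrightarrow> a \<in> m"
    "\<And>a. a \<in> A0 \<Longrightarrow> n +>\<^bsub>toring S\<^esub> a = n +>\<^bsub>toring S\<^esub> b \<longleftrightarrow> a \<ominus>\<^bsub>toring S\<^esub> b \<in> n"
    if n: "primeideal n (toring S)" "N \<subseteq> n" for n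
  proof -
    interpret n: primeideal n "toring S" by (rule n(1))
    show "(+>\<^bsub>toring S\<^esub>) n \<in> ring_hom (toring S) (toring S Quot n)" by (rule n.rcos_ring_hom)
    show "(+>\<^bsub>toring S\<^esub>) n ` carrier S = car (toring S Quot n)"
      using Quot_image[of "toring S" n] by simp
    show "n +>\<^bsub>toring S\<^esub> a = \<zero>\<^bsub>toring S Quot n\<^esub> \<longleftrightarrow> a \<in> m" if "a \<in> A0" for a
      using n.a_rcos_const[of a] n.a_rcos_self[of a] c[OF that] mem_iff[OF n that] by (auto simp: Quot_zero)
    show "n +>\<^bsub>toring S\<^esub> a = n +>\<^bsub>toring S\<^esub> b \<longleftrightarrow> a \<ominus>\<^bsub>toring S\<^esub> b \<in> n" if "a \<in> A0" for a
      using R.quotient_eq_iff_same_a_r_cos[OF n.is_ideal, of a b] c[OF that] b by simp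
  qed
  show thesis
  proof (rule separate_points[OF S A0 field_Quot[OF S n0(1)] field_Quot[OF S n1(1)]
        quot(1,2)[OF n0] quot(1,2)[OF n1(1,2)] _ b(1)])
    show "n0 +>\<^bsub>toring S\<^esub> a = \<zero>\<^bsub>toring S Quot n0\<^esub> \<longleftrightarrow> n1 +>\<^bsub>toring S\<^esub> a = \<zero>\<^bsub>toring S Quot n1\<^esub>"
      if "a \<in> A0" for a using quot(3)[OF n0 that] quot(3)[OF n1(1,2) that] by simp
    show "\<not> (\<exists>a\<in>A0. n0 +>\<^bsub>toring S\<^esub> a = n0 +>\<^bsub>toring S\<^esub> b \<and> n1 +>\<^bsub>toring S\<^esub> a = n1 +>\<^bsub>toring S\<^esub> b)"
      using n1(3) quot(4)[OF n0] quot(4)[OF n1(1,2)] by blast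
  qed (rule that; assumption)
qed

section \<open>Cardinality\<close>

text \<open>Inverses and p-th roots are operations, so the existential axioms have witnesses already
  in \<open>C\<close>; the remaining conditions are reflected by the injective
  \<open>e\<close>.\<close>

lemma implicitly_closed_field_pullback:
  assumes C: "is_alg C" and e: "hom C K e" "inj_on e (carrier C)" and K: "implicitly_closed_field K"
  shows "implicitly_closed_field C"
proof -
  note cl = is_algD[OF C]
  note ee = homD[OF e(1)] hom_zero_one[OF e(1)]
  have faK: "field_ax K" using K by (simp add: implicitly_closed_field_def weakly_rooted_def)
  note ax = faK[unfolded field_ax_def]
  have eq: "x = y \<longleftrightarrow> e x = e y" if "x \<in> carrier C" "y \<in> carrier C" for x y
    using e(2) that by (auto simp: inj_on_def)
  have zero_iff: "e x = zero K \<longleftrightarrow> x = zero C" if "x \<in> carrier C" for x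
    using eq[OF that cl(1)] ee by simp
  have winv: "mul C x (winv C x) = one C" if "x \<in> carrier C" "x \<noteq> zero C" for x
    using K that zero_iff[of x] eq[of "mul C x (winv C x)" "one C"]
    by (simp add: implicitly_closed_field_def ee cl)
  have ec: "e x \<in> carrier K" if "x \<in> carrier C" for x using that by (rule ee(1))
  have comm: "add C x y = add C y x \<and> mul C x y = mul C y x" if "x \<in> carrier C" "y \<in> carrier C" for x y
    using that ax ec eq[of "add C x y" "add C y x"] eq[of "mul C x y" "mul C y x"] by (simp add: ee cl)
  have assoc: "add C (add C x y) z = add C x (add C y z) \<and> mul C (mul C x y) z = mul C x (mul C y z) \<and>
      mul C x (add C y z) = add C (mul C x y) (mul C x z)"
    if c: "x \<in> carrier C" "y \<in> carrier C" "z \<in> carrier C" for x y z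
  proof -
    have "add K (add K (e x) (e y)) (e z) = add K (e x) (add K (e y) (e z)) \<and>
        mul K (mul K (e x) (e y)) (e z) = mul K (e x) (mul K (e y) (e z)) \<and>
        mul K (e x) (add K (e y) (e z)) = add K (mul K (e x) (e y)) (mul K (e x) (e z))"
      using ax ec[OF c(1)] ec[OF c(2)] ec[OF c(3)] by blast
    then show ?thesis
      using c eq[of "add C (add C x y) z" "add C x (add C y z)"] eq[of "mul C (mul C x y) z" "mul C x (mul C y z)"]
        eq[of "mul C x (add C y z)" "add C (mul C x y) (mul C x z)"] by (simp add: ee cl)
  qed
  have unit: "add C x (zero C) = x \<and> add C x (neg C x) = zero C \<and> mul C x (one C) = x"
    if x: "x \<in> carrier C" for x
  proof -
    have "add K (e x) (zero K) = e x \<and> add K (e x) (neg K (e x)) = zero K \<and> mul K (e x) (one K) = e x"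
      using ax ec[OF x] by blast
    then show ?thesis
      using x eq[of "add C x (zero C)" x] eq[of "add C x (neg C x)" "zero C"] eq[of "mul C x (one C)" x]
      by (simp add: ee cl)
  qed
  have nontrivial: "zero C \<noteq> one C" using ax eq[of "zero C" "one C"] by (simp add: ee cl)
  have inverse: "\<exists>y\<in>carrier C. mul C x y = one C" if "x \<in> carrier C" "x \<noteq> zero C" for x
    using winv[OF that] cl(6)[OF that(1)] by blast
  have fa: "field_ax C"
    unfolding field_ax_def
    by (intro conjI ballI impI nontrivial inverse cl(1-5) comm[THEN conjunct1] comm[THEN conjunct2]
        assoc[THEN conjunct1] assoc[THEN conjunct2, THEN conjunct1] assoc[THEN conjunct2, THEN conjunct2]
        unit[THEN conjunct1] unit[THEN conjunct2, THEN conjunct1] unit[THEN conjunct2, THEN conjunct2])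
  interpret C: field "toring C" by (rule field_toring[OF fa])
  have nm: "natmult C n (one C) \<in> carrier C \<and> e (natmult C n (one C)) = natmult K n (one K)" for n
    by (induction n) (auto simp: natmult_def ee cl)
  have ap: "apow C x n \<in> carrier C \<and> e (apow C x n) = apow K (e x) n" if "x \<in> carrier C" for x n
    using that by (induction n) (auto simp: apow_def ee cl)
  have ch: "char_is C p \<longleftrightarrow> char_is K p" for p
    using nm[of p] zero_iff[of "natmult C p (one C)"] by (auto simp: char_is_def)
  have ch0: "char_zero_alg C \<longleftrightarrow> char_zero_alg K"
    using nm zero_iff by (simp add: char_zero_alg_def) metis
  have root: "wroot C p a \<in> carrier C \<and>
        (if char_is C p then apow C (wroot C p a) p = a else wroot C p a = zero C)"
    if p: "prime p" and a: "a \<in> carrier C" for p a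
  proof -
    have r: "wroot C p a \<in> carrier C" using cl p a by simp
    have "if char_is K p then apow K (wroot K p (e a)) p = e a else wroot K p (e a) = zero K"
      using K p ee(1)[OF a] by (simp add: implicitly_closed_field_def)
    then show ?thesis
      using r ap[OF r, of p] eq[of "apow C (wroot C p a) p" a] a zero_iff[OF r] ee(6)[OF a, of p] p ch
      by (auto split: if_splits)
  qed
  have "weakly_rooted C"
    unfolding weakly_rooted_def
  proof (intro conjI fa)
    show "char_zero_alg C \<or> (\<exists>p. char_is C p \<and> (\<forall>a\<in>carrier C. \<exists>r\<in>carrier C. apow C r p = a))"
    proof (cases "char_zero_alg C")
      case False
      then obtain p where p: "char_is C p"
        using K ch0 ch by (auto simp: implicitly_closed_field_def weakly_rooted_def)
      then have "prime p" by (simp add: char_is_def)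
      have "\<exists>r\<in>carrier C. apow C r p = a" if "a \<in> carrier C" for a
        using root[OF \<open>prime p\<close> that] p by (intro bexI[of _ "wroot C p a"]) auto
      then show ?thesis using p by blast
    qed simp
  qed
  moreover have "winv C (zero C) = zero C"
    using K eq[of "winv C (zero C)" "zero C"] by (simp add: implicitly_closed_field_def ee cl)
  ultimately show ?thesis
    unfolding implicitly_closed_field_def
    by (intro conjI allI ballI impI root winv cl(6))
qed

section \<open>Replacing the separating field by one on a small type\<close>

inductive_set generated :: "'k alg \<Rightarrow> 'k set \<Rightarrow> 'k set" for K X where
  base: "x \<in> X \<Longrightarrow> x \<in> generated K X"
| zero: "zero K \<in> generated K X"
| one: "one K \<in> generated K X"
| add: "x \<in> generated K X \<Longrightarrow> y \<in> generated K X \<Longrightarrow> add K x y \<in> generated K X"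
| mul: "x \<in> generated K X \<Longrightarrow> y \<in> generated K X \<Longrightarrow> mul K x y \<in> generated K X"
| neg: "x \<in> generated K X \<Longrightarrow> neg K x \<in> generated K X"
| winv: "x \<in> generated K X \<Longrightarrow> winv K x \<in> generated K X"
| wroot: "x \<in> generated K X \<Longrightarrow> prime p \<Longrightarrow> wroot K p x \<in> generated K X"

lemma generated_subset:
  assumes "is_alg K" "X \<subseteq> carrier K"
  shows "generated K X \<subseteq> carrier K"
proof
  fix x assume "x \<in> generated K X"
  then show "x \<in> carrier K"
    by induction (use assms in \<open>auto simp: is_alg_def\<close>)
qed

text \<open>Terms over \<^typ>\<open>'c\<close>; the operation symbol is a number, with \<open>p + 6\<close> for the \<open>p\<close>-th root,
  and unary and nullary symbols ignore superfluous arguments.\<close>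
datatype 'c trm = VarL 'c | VarR 'c | App nat "'c trm" "'c trm"

primrec trm_value :: "'k alg \<Rightarrow> ('c \<Rightarrow> 'k) \<Rightarrow> ('c \<Rightarrow> 'k) \<Rightarrow> 'c trm \<Rightarrow> 'k" where
  "trm_value K u v (VarL c) = u c"
| "trm_value K u v (VarR c) = v c"
| "trm_value K u v (App n s t) =
    (let x = trm_value K u v s; y = trm_value K u v t in
     if n = 0 then zero K else if n = 1 then one K else if n = 2 then add K x y
     else if n = 3 then mul K x y else if n = 4 then neg K x else if n = 5 then winv K x
     else wroot K (n - 6) x)"

lemma generated_eq_value:
  assumes "x \<in> generated K (range u \<union> range v)"
  shows "\<exists>t. trm_value K u v t = x"
  using assms
proof induction
  case (base x)
  then show ?case by (metis UnE rangeE trm_value.simps(1,2))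
next
  case zero
  show ?case by (rule exI[of _ "App 0 (VarL undefined) (VarL undefined)"]) simp
next
  case one
  show ?case by (rule exI[of _ "App 1 (VarL undefined) (VarL undefined)"]) simp
next
  case (add x y)
  then obtain s t where "trm_value K u v s = x" "trm_value K u v t = y" by blast
  then show ?case by (intro exI[of _ "App 2 s t"]) simp
next
  case (mul x y)
  then obtain s t where "trm_value K u v s = x" "trm_value K u v t = y" by blast
  then show ?case by (intro exI[of _ "App 3 s t"]) simp
next
  case (neg x)
  then obtain s where "trm_value K u v s = x" by blast
  then show ?case by (intro exI[of _ "App 4 s s"]) simp
next
  case (winv x)
  then obtain s where "trm_value K u v s = x" by blast
  then show ?case by (intro exI[of _ "App 5 s s"]) simp
next
  case (wroot x p)
  then obtain s where "trm_value K u v s = x" by blast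
  then show ?case by (intro exI[of _ "App (p + 6) s s"]) simp
qed

text \<open>Tags \<open>0\<close> and \<open>1\<close> mark the two kinds of variables, hence the
  shift by 2 for operation symbols.\<close>

primrec trm_code :: "(nat \<Rightarrow> 'c) \<Rightarrow> ('c \<times> 'c \<Rightarrow> 'c) \<Rightarrow> 'c trm \<Rightarrow> 'c" where
  "trm_code i f (VarL c) = f (i 0, c)"
| "trm_code i f (VarR c) = f (i 1, c)"
| "trm_code i f (App n s t) = f (i (n + 2), f (trm_code i f s, trm_code i f t))"

lemma inj_trm_code:
  assumes i: "inj i" and f: "inj f"
  shows "inj (trm_code i f)"
proof (rule injI)
  have [simp]: "f x = f y \<longleftrightarrow> x = y" "i m = i n \<longleftrightarrow> m = n" for x y m n
    using i f by (auto simp: inj_eq)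
  fix s t assume "trm_code i f s = trm_code i f t"
  then show "s = t"
  proof (induction s arbitrary: t)
    case (App n s1 s2)
    then show ?case by (cases t) auto
  next
    case (VarL c)
    then show ?case by (cases t) auto
  next
    case (VarR c)
    then show ?case by (cases t) auto
  qed
qed

text \<open>An infinite type is in bijection with its square, which provides the pairing function
  for \<open>trm_code\<close>.\<close>

lemma exists_inj_trm:
  assumes "infinite (UNIV :: 'c set)"
  obtains \<iota> :: "'c trm \<Rightarrow> 'c" where "inj \<iota>"
proof -
  obtain f :: "'c \<times> 'c \<Rightarrow> 'c" where "bij_betw f (UNIV \<times> UNIV) UNIV"
    using card_of_Times_same_infinite[OF assms] card_of_ordIso by blast
  then have f: "inj f" by (simp add: bij_betw_def)
  obtain i :: "nat \<Rightarrow> 'c" where "inj i" using infinite_countable_subset[OF assms] by blast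
  then show thesis using that inj_trm_code f by blast
qed

lemma hom_comp: "hom A B f \<Longrightarrow> hom B C g \<Longrightarrow> hom A C (g \<circ> f)"
  by (simp add: hom_def)

text \<open>Elements of the subalgebra generated by both images are values of terms over
  \<open>'c\<close>, with \<open>VarL\<close> standing for values of \<open>g\<close> and
  \<open>VarR\<close> for values of \<open>h\<close>. Choosing a term and coding it embeds the
  subalgebra into \<open>'c\<close>.\<close>

lemma downward_loewenheim_skolem:
  fixes j :: "'a \<Rightarrow> 'c"
  assumes K: "implicitly_closed_field K" and S: "is_alg S" and gh: "hom S K g" "hom S K h"
    and j: "inj_on j (carrier S)" and inf: "infinite (UNIV :: 'c set)"
  obtains C :: "'c alg" and g' h'
  where "implicitly_closed_field C" "hom S C g'" "hom S C h'"
    "\<And>x y. x \<in> carrier S \<Longrightarrow> y \<in> carrier S \<Longrightarrow> g' x = h' y \<longleftrightarrow> g x = h y"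
proof -
  have KA: "is_alg K" using icm_identitiesD(1)[OF icm_identities_field[OF K]] .
  \<comment> \<open>A left inverse of \<open>j\<close>, with default \<open>zero S\<close> so that
    \<open>u\<close> and \<open>v\<close> are total and take only values of \<open>g\<close> and
    \<open>h\<close> on \<open>S\<close>.\<close>
  define s where "s = (\<lambda>c. if c \<in> j ` carrier S then inv_into (carrier S) j c else zero S)"
  define u where "u = g \<circ> s"
  define v where "v = h \<circ> s"
  have sc: "s c \<in> carrier S" for c
    using is_algD(1)[OF S] by (auto simp: s_def inv_into_into)
  have sj: "s (j x) = x" if "x \<in> carrier S" for x using that j by (simp add: s_def)
  let ?G = "generated K (range u \<union> range v)"
  have G: "?G \<subseteq> carrier K"
    using homD(1)[OF gh(1) sc] homD(1)[OF gh(2) sc] by (intro generated_subset KA) (auto simp: u_def v_def)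
  have gG: "g x \<in> ?G" "h x \<in> ?G" if "x \<in> carrier S" for x
  proof -
    have "g x = u (j x)" "h x = v (j x)" using sj[OF that] by (simp_all add: u_def v_def)
    then show "g x \<in> ?G" "h x \<in> ?G" by (auto intro!: generated.base)
  qed
  obtain \<iota> :: "'c trm \<Rightarrow> 'c" where \<iota>: "inj \<iota>" using exists_inj_trm[OF inf] .
  define i where "i = (\<lambda>x. \<iota> (SOME t. trm_value K u v t = x))"
  have "trm_value K u v (SOME t. trm_value K u v t = x) = x" if "x \<in> ?G" for x
    using generated_eq_value[OF that] by (rule someI_ex)
  then have i: "inj_on i ?G" unfolding i_def inj_on_def using \<iota> by (metis injD)
  define e where "e = inv_into ?G i"
  have e: "e c \<in> ?G" if "c \<in> i ` ?G" for c using that by (simp add: e_def inv_into_into)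
  have ei: "e (i x) = x" if "x \<in> ?G" for x using that i by (simp add: e_def)
  \<comment> \<open>Transport of structure along \<open>i\<close>, whose inverse on the image is
    \<open>e\<close>.\<close>
  define C where "C = \<lparr>carrier = i ` ?G, add = (\<lambda>a b. i (add K (e a) (e b))),
    mul = (\<lambda>a b. i (mul K (e a) (e b))), neg = (\<lambda>a. i (neg K (e a))), zero = i (zero K), one = i (one K),
    winv = (\<lambda>a. i (winv K (e a))), wroot = (\<lambda>p a. i (wroot K p (e a)))\<rparr>"
  have CA: "is_alg C"
    unfolding is_alg_def C_def
    by (auto simp: ei intro!: imageI generated.zero generated.one generated.add generated.mul
        generated.neg generated.winv generated.wroot)
  have eC: "hom C K e"
    unfolding hom_def C_def using G
    by (auto simp: ei generated.zero generated.one generated.add generated.mul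
        generated.neg generated.winv generated.wroot)
  have "inj_on e (carrier C)" unfolding C_def e_def by (simp add: inj_on_inv_into)
  then have "implicitly_closed_field C"
    using implicitly_closed_field_pullback[OF CA eC _ K] by blast
  moreover have "hom S C (i \<circ> g)" if g: "hom S K g" and gG: "\<And>x. x \<in> carrier S \<Longrightarrow> g x \<in> ?G" for g
    using g gG unfolding hom_def C_def by (auto simp: ei)
  then have "hom S C (i \<circ> g)" "hom S C (i \<circ> h)" using gh gG by blast+
  moreover have "(i \<circ> g) x = (i \<circ> h) y \<longleftrightarrow> g x = h y" if "x \<in> carrier S" "y \<in> carrier S" for x y
    using gG that inj_on_eq_iff[OF i] by simp
  ultimately show thesis by (rule that)
qed

section \<open>Membership in the class and the final argument\<close>

lemma ICM_implicitly_closed_field: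
  fixes C :: "'c alg"
  assumes C: "implicitly_closed_field C"
  shows "ICM TYPE('i) TYPE('c) C"
proof -
  let ?F = "\<lambda>_ :: 'i. C"
  \<comment> \<open>The field is regarded as a product with a single factor.\<close>
  let ?I = "{undefined :: 'i}"
  let ?P = "prod_alg ?I ?F"
  have CA: "is_alg C" using icm_identitiesD(1)[OF icm_identities_field[OF C]] .
  note cl = is_algD[OF CA]
  have "is_alg ?P" unfolding is_alg_def prod_alg_def by (auto simp: cl PiE_def)
  then have sub: "subalg ?P ?P" by (simp add: subalg_def)
  have iso: "isomorphic C ?P"
    unfolding isomorphic_def iso_def
  proof (intro exI[of _ "\<lambda>x. \<lambda>i\<in>?I. x"] conjI)
    show "hom C ?P (\<lambda>x. \<lambda>i\<in>?I. x)" by (auto simp: hom_def prod_alg_def cl)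
    show "bij_betw (\<lambda>x. \<lambda>i\<in>?I. x) (carrier C) (carrier ?P)"
    proof (rule bij_betw_byWitness[where f' = "\<lambda>x. x undefined"])
      show "\<forall>x\<in>carrier ?P. (\<lambda>i\<in>?I. x undefined) = x"
        by (auto simp: prod_alg_def PiE_def extensional_def)
    qed (auto simp: prod_alg_def split: if_splits)
  qed
  show ?thesis
    unfolding ICM_def
    by (intro exI[of _ ?I] exI[of _ ?F] exI[of _ ?P] conjI ballI C sub iso)
qed

lemma icm_identities_ICM:
  assumes I: "\<And>i. i \<in> I \<Longrightarrow> implicitly_closed_field (F i)" and S: "subalg S (prod_alg I F)"
  shows "icm_identities S"
proof (rule icm_identities_separated[of S I F "\<lambda>i x. x i"])
  have sub: "carrier S \<subseteq> (\<Pi>\<^sub>E i\<in>I. carrier (F i))" using S by (simp add: subalg_def prod_alg_def)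
  show "hom S (F i) (\<lambda>x. x i)" if i: "i \<in> I" for i
    using S i sub unfolding subalg_def hom_def prod_alg_def by auto
  show "x = y" if "x \<in> carrier S" "y \<in> carrier S" "\<And>i. i \<in> I \<Longrightarrow> x i = y i" for x y
    using sub that by (intro PiE_ext[of x I "\<lambda>i. carrier (F i)" y]) auto
qed (use S I in \<open>auto simp: subalg_def icm_identities_field\<close>)

text \<open>\<^const>\<open>ICM\<close> does not force \<^term>\<open>B\<close> itself to be closed under its operations, so the
  argument takes place in the isomorphic subalgebra \<^term>\<open>S\<close> of a product.\<close>

theorem mainTheorem3:
  fixes A B :: "'b alg"
  assumes "ICM TYPE('i) TYPE('f) B"
    and "subalg A B"
  shows "dominion (\<lambda>C :: ('b \<times> nat) alg.
            ICM TYPE(('b \<times> nat) \<times> ('b \<times> nat)) TYPE('b \<times> nat) C) A B = carrier A"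
proof
  show "carrier A \<subseteq> dominion (\<lambda>C :: ('b \<times> nat) alg.
            ICM TYPE(('b \<times> nat) \<times> ('b \<times> nat)) TYPE('b \<times> nat) C) A B"
    using assms(2) by (auto simp: dominion_def subalg_def)
  show "dominion (\<lambda>C :: ('b \<times> nat) alg.
            ICM TYPE(('b \<times> nat) \<times> ('b \<times> nat)) TYPE('b \<times> nat) C) A B \<subseteq> carrier A"
  proof (rule ccontr)
    assume "\<not> ?thesis"
    then obtain b where b: "b \<in> carrier B" "b \<notin> carrier A"
      and dom: "\<And>(C :: ('b \<times> nat) alg) g h.
        ICM TYPE(('b \<times> nat) \<times> ('b \<times> nat)) TYPE('b \<times> nat) C \<Longrightarrow> hom B C g \<Longrightarrow> hom B C h \<Longrightarrow>
        (\<forall>a\<in>carrier A. g a = h a) \<Longrightarrow> g b = h b"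
      unfolding dominion_def by blast
    obtain I :: "'i set" and F :: "'i \<Rightarrow> 'f alg" and S f
      where F: "\<And>i. i \<in> I \<Longrightarrow> implicitly_closed_field (F i)" and S: "subalg S (prod_alg I F)"
        and f: "hom B S f" "bij_betw f (carrier B) (carrier S)"
      using assms(1) unfolding ICM_def isomorphic_def iso_def by blast
    have A: "is_alg A" "carrier A \<subseteq> carrier B" using assms(2) by (simp_all add: subalg_def)
    have SI: "icm_identities S" by (rule icm_identities_ICM[OF F S])
    define A0 where "A0 = f ` carrier A"
    have sub: "A0 \<subseteq> carrier S" using A(2) f(2) by (auto simp: A0_def bij_betw_def)
    have AB: "x \<in> carrier B" if "x \<in> carrier A" for x using that A(2) by blast
    \<comment> \<open>The operations of \<open>A\<close> and \<open>B\<close> agree on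
      \<open>A\<close>, so \<open>f\<close> is also a homomorphism on \<open>A\<close>; this makes
      its image \<open>A0\<close> closed under the operations of \<open>S\<close>.\<close>
    have hom_A: "hom A S f" using f(1) assms(2) unfolding hom_def subalg_def by (simp add: AB)
    have "is_alg (S\<lparr>carrier := A0\<rparr>)"
    proof -
      note fA = homD(2-6)[OF hom_A, symmetric] hom_zero_one[OF hom_A, symmetric] and clA = is_algD[OF A(1)]
      show ?thesis
        unfolding is_alg_def A0_def by (auto simp: fA intro!: imageI clA)
    qed
    moreover have "f b \<notin> A0"
      using b A(2) f(2) unfolding A0_def bij_betw_def inj_on_def by blast
    ultimately obtain K :: "(((('i \<Rightarrow> 'f) set \<Rightarrow> ('i \<Rightarrow> 'f) set) \<Rightarrow> ('i \<Rightarrow> 'f) set \<Rightarrow> ('i \<Rightarrow> 'f) set) set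
        \<times> ((('i \<Rightarrow> 'f) set \<Rightarrow> ('i \<Rightarrow> 'f) set) \<Rightarrow> ('i \<Rightarrow> 'f) set \<Rightarrow> ('i \<Rightarrow> 'f) set) set) set alg" and g h
      where K: "implicitly_closed_field K" "hom S K g" "hom S K h" "\<And>a. a \<in> A0 \<Longrightarrow> g a = h a" "g (f b) \<noteq> h (f b)"
      using separate_from_subalgebra[OF SI sub _ homD(1)[OF f(1) b(1)]] by blast
    \<comment> \<open>\<open>S\<close> is in bijection with \<open>B\<close> and so embeds in
      \<open>'b\<close>; the factor \<open>nat\<close> makes the type infinite, as
      \<open>downward_loewenheim_skolem\<close> demands.\<close>
    define j where "j = (\<lambda>x. (inv_into (carrier B) f x, 0 :: nat))"
    have j: "inj_on j (carrier S)"
      using f(2) by (auto simp: j_def inj_on_def bij_betw_def dest: inv_into_injective)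
    have inf: "infinite (UNIV :: ('b \<times> nat) set)" by (simp add: finite_prod)
    obtain C :: "('b \<times> nat) alg" and g' h'
      where C: "implicitly_closed_field C" "hom S C g'" "hom S C h'"
        and gh: "\<And>x y. x \<in> carrier S \<Longrightarrow> y \<in> carrier S \<Longrightarrow> g' x = h' y \<longleftrightarrow> g x = h y"
      using downward_loewenheim_skolem[OF K(1) icm_identitiesD(1)[OF SI] K(2,3) j inf] by blast
    \<comment> \<open>Composition with \<open>f\<close> moves the separating pair from
      \<open>S\<close> to \<open>B\<close>, where it agrees on \<open>A\<close>; membership of
      \<open>b\<close> in the dominion then forces equal values at \<open>f b\<close>.\<close>
    have "(g' \<circ> f) b = (h' \<circ> f) b"
    proof (rule dom)
      show "ICM TYPE(('b \<times> nat) \<times> ('b \<times> nat)) TYPE('b \<times> nat) C" by (rule ICM_implicitly_closed_field[OF C(1)])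
      show "hom B C (g' \<circ> f)" "hom B C (h' \<circ> f)" using hom_comp f(1) C(2,3) by blast+
      show "\<forall>a\<in>carrier A. (g' \<circ> f) a = (h' \<circ> f) a"
        using gh K(4) sub by (auto simp: A0_def)
    qed
    then show False using gh[of "f b" "f b"] K(5) homD(1)[OF f(1) b(1)] by simp
  qed
qed

end
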